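(* For every $n=1,2,3,\dots$ there exists, formally, a canonical transformation $T_n(\boldsymbol\alpha,\bar{\boldsymbol\alpha})$ such that $$H_n:=H_\Omega\circ T_n=h_0+Z_n+R_n,$$ where $\{Z_n,h_0\}_{\mathcal S}=0$ and, in terms of $(\boldsymbol\beta,\bar{\boldsymbol\beta})$, $\mathrm{ord}(R_n)\ge n+1$. Moreover, all exponents of $Z_n$ and $R_n$ satisfy $$\mathscr E(Z_n)\subset\mathscr C,\qquad \mathscr E(R_n)\subset\mathscr C.$$
   Context: **Setting.** $N\ge2$; $a_1,\dots,a_N$ are nonzero real vortex strengths; $A_k=\sum_{l=1}^ka_l\ne0$ for all $k$; $\kappa_k=a_k/A_k$, with indices mod $N$ (so $\kappa_{N+1}=\kappa_1=1$). $\Omega\subset\mathbb R^2\simeq\mathbb C$ is a simply connected domain, $G(z_1,z_2)=\frac1{2\pi}\ln|z_1-z_2|+\gamma(z_1,z_2)$ its Dirichlet Green's function with regular part $\gamma$, and $0\in\Omega$ is a critical point of $\tilde\gamma(z)=\gamma(z,z)$. $\varphi:\Omega\to\mathbb D$ is biholomorphic with $\varphi(0)=0$ and $2|\varphi'(0)|^3>|\varphi'''(0)|$. The vortex Hamiltonian is $$H=-\sum_{k,l=1}^N\frac{a_ka_l}{2}\gamma(z_k,z_l)-\sum_{l<k}\frac{a_ka_l}{2\pi}\ln|z_k-z_l|.$$ **Coordinates.** Jacobi coordinates $w_k=\frac1{A_k}\sum_{l\le k}a_lz_l-z_{k+1}$ ($k\le N-1$), $w_N=\frac1{A_N}\sum_{l}a_lz_l$.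 Put $\zeta_k=w_k$ for $k\le N-1$ and $\zeta_N=Sw_N$, where $S$ is a real-linear map of $\mathbb R^2\simeq\mathbb C$ of determinant $1$ such that the quadratic part of $-\frac{A_N^2}{2}\tilde\gamma(S^{-1}\zeta_N)$ at $0$ equals $-\frac\omega2|\zeta_N|^2$ with $\omega>0$ (it exists by the stability condition). Put $\boldsymbol\alpha=\boldsymbol\zeta/\sqrt2$, $\bar{\boldsymbol\alpha}=\bar{\boldsymbol\zeta}/\sqrt2$, and $$\beta_i=\frac{\alpha_i}{\alpha_{i+1}}\ (1\le i\le N-2),\quad \beta_{N-1}=\alpha_{N-1},\quad \beta_N=\alpha_N,$$ with $\bar\beta_i$ the conjugates. $H_\Omega(\boldsymbol\alpha,\bar{\boldsymbol\alpha})$ is $H$ in these coordinates, additive constants dropped. The unperturbed part is $$h_0=-\sum_{k=1}^{N-1}\frac{a_{k+1}A_k}{4\pi}\ln(\alpha_k\bar\alpha_k)-\omega\alpha_N\bar\alpha_N,$$ and $R_0=H_\Omega-h_0$ is a power series in $(\boldsymbol\beta,\bar{\boldsymbol\beta})$ without constant term ($\beta_i,\bar\beta_i$ treated as independent variables). The Poisson bracket is $$\{F,G\}_{\mathcal S}=\sum_{k=1}^N\frac{i}{A_k\kappa_{k+1}}\left(\partial_{\alpha_k}F\,\partial_{\bar\alpha_k}G-\partial_{\bar\alpha_k}F\,\partial_{\alpha_k}G\right).$$ **Formal canonical transformations.** A generating function $g$, polynomial in $(\boldsymbol\beta,\bar{\boldsymbol\beta})$, defines the Lie transform $\phi_g$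 acting formally by $F\circ\phi_g=\sum_{l\ge0}\frac1{l!}\mathcal L_g^l(F)$, $\mathcal L_g(F)=\{g,F\}_{\mathcal S}$. "Formally" means that $T_n$ is a finite composition of such Lie transforms and all identities hold as formal power series in $(\boldsymbol\beta,\bar{\boldsymbol\beta})$ (apart from $h_0$). **Order and exponents.** Multi-indices are in $\mathbb N^N$ (nonnegative integers). For $f=\sum c_{\boldsymbol K,\boldsymbol L}\boldsymbol\beta^{\boldsymbol K}\bar{\boldsymbol\beta}^{\boldsymbol L}$, $\mathscr E(f)=\{(\boldsymbol K,\boldsymbol L):c_{\boldsymbol K,\boldsymbol L}\ne0\}$ and $\mathrm{ord}(f)=\min\{|\boldsymbol K|+|\boldsymbol L|:(\boldsymbol K,\boldsymbol L)\in\mathscr E(f)\}$. **The sets.** $\mathscr R_0$ is the set of all pairs $(\boldsymbol K,\boldsymbol L)$; $\mathscr R_m=\{(\boldsymbol K,\boldsymbol L)\in\mathscr R_0:K_1=L_1,\dots,K_m=L_m\}$. $\boldsymbol K[1:m]=(K_1,\dots,K_m)$. The support of a (truncated) multi-index is called connected if the indices of its nonzero entries form a set of consecutive integers (the empty support counts as connected). $\mathscr C$ is the set of pairs $(\boldsymbol K,\boldsymbol L)$ such that $supp(\boldsymbol K+\boldsymbol L)$ is connected and either (a) for some $1\le m\le N$, $(\boldsymbol K,\boldsymbol L)\in\mathscr R_{m-1}\setminus\mathscr R_m$, $supp(\boldsymbol K[1:m])$ is connected, and $K_l=L_l\ne1$ for $1\le l\le m-1$; or (b) $(\boldsymbol K,\boldsymbol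 L)\in\mathscr R_N$ and $supp(\boldsymbol K)$ is connected. *)

theory Defs
  imports "HOL-Complex_Analysis.Complex_Analysis" "HOL-Library.Extended_Nat"
    "HOL-Library.Groups_Big_Fun"
begin

text \<open>Vortices, coordinates and multi-indices are indexed by \<open>1, \<dots>, N\<close>; families are functions on
  \<^typ>\<open>nat\<close>, and only their values on \<open>{1..N}\<close> matter.\<close>

section \<open>Green's function\<close>

definition harmonic_on :: "(complex \<Rightarrow> real) \<Rightarrow> complex set \<Rightarrow> bool" where
  "harmonic_on u S \<longleftrightarrow>
    (\<exists>ux uy uxx uxy uyx uyy.
      continuous_on S uxx \<and> continuous_on S uxy \<and> continuous_on S uyx \<and> continuous_on S uyy \<and>
      (\<forall>z\<in>S. (u has_derivative (\<lambda>h. ux z * Re h + uy z * Im h)) (at z) \<and>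
             (ux has_derivative (\<lambda>h. uxx z * Re h + uxy z * Im h)) (at z) \<and>
             (uy has_derivative (\<lambda>h. uyx z * Re h + uyy z * Im h)) (at z) \<and>
             uxx z + uyy z = 0))"

definition green_function :: "(complex \<Rightarrow> complex \<Rightarrow> real) \<Rightarrow> complex \<Rightarrow> complex \<Rightarrow> real" where
  "green_function \<gamma> z1 z2 = 1 / (2 * pi) * ln (cmod (z1 - z2)) + \<gamma> z1 z2"

text \<open>\<open>\<gamma>\<close> is the regular part of the Dirichlet Green's function of \<open>\<Omega>\<close>. The boundary condition is
  that \<open>G(z, w)\<close> tends to \<open>0\<close> as \<open>z\<close> leaves every compact subset of \<open>\<Omega>\<close>: for bounded \<open>\<Omega>\<close> this is
  \<open>z \<rightarrow> \<partial>\<Omega>\<close>, for unbounded \<open>\<Omega>\<close> it also covers \<open>z \<rightarrow> \<infinity>\<close>. It determines \<open>\<gamma>\<close> on \<open>\<Omega> \<times> \<Omega>\<close>.\<close>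

definition green_regular_part :: "complex set \<Rightarrow> (complex \<Rightarrow> complex \<Rightarrow> real) \<Rightarrow> bool" where
  "green_regular_part \<Omega> \<gamma> \<longleftrightarrow>
    (\<forall>w\<in>\<Omega>. harmonic_on (\<lambda>z. \<gamma> z w) \<Omega> \<and>
      (\<forall>\<epsilon>>0. \<exists>C. compact C \<and> C \<subseteq> \<Omega> \<and> (\<forall>z\<in>\<Omega> - C. \<bar>green_function \<gamma> z w\<bar> < \<epsilon>)))"

definition biholomorphic :: "complex set \<Rightarrow> complex set \<Rightarrow> (complex \<Rightarrow> complex) \<Rightarrow> bool" where
  "biholomorphic U V f \<longleftrightarrow>
    f holomorphic_on U \<and> bij_betw f U V \<and> inv_into U f holomorphic_on V"


section \<open>Hamiltonian and coordinates\<close>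

definition partial_strength :: "(nat \<Rightarrow> real) \<Rightarrow> nat \<Rightarrow> real" where
  "partial_strength a k = (\<Sum>l=1..k. a l)"

definition kappa :: "(nat \<Rightarrow> real) \<Rightarrow> nat \<Rightarrow> real" where
  "kappa a k = a k / partial_strength a k"

definition vortex_hamiltonian ::
    "(nat \<Rightarrow> real) \<Rightarrow> nat \<Rightarrow> (complex \<Rightarrow> complex \<Rightarrow> real) \<Rightarrow> (nat \<Rightarrow> complex) \<Rightarrow> real" where
  "vortex_hamiltonian a N \<gamma> z =
    - (\<Sum>k=1..N. \<Sum>l=1..N. a k * a l / 2 * \<gamma> (z k) (z l))
    - (\<Sum>k=1..N. \<Sum>l=1..<k. a k * a l / (2 * pi) * ln (cmod (z k - z l)))"

definition jacobi_coord :: "(nat \<Rightarrow> real) \<Rightarrow> nat \<Rightarrow> (nat \<Rightarrow> complex) \<Rightarrow> nat \<Rightarrow> complex" where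
  "jacobi_coord a N z k =
    (\<Sum>l=1..k. of_real (a l) * z l) / of_real (partial_strength a k)
    - (if k = N then 0 else z (k + 1))"

definition alpha_coord ::
    "(nat \<Rightarrow> real) \<Rightarrow> nat \<Rightarrow> (complex \<Rightarrow> complex) \<Rightarrow> (nat \<Rightarrow> complex) \<Rightarrow> nat \<Rightarrow> complex" where
  "alpha_coord a N S z k =
    (if k = N then S (jacobi_coord a N z N) else jacobi_coord a N z k) / of_real (sqrt 2)"

definition beta_coord ::
    "(nat \<Rightarrow> real) \<Rightarrow> nat \<Rightarrow> (complex \<Rightarrow> complex) \<Rightarrow> (nat \<Rightarrow> complex) \<Rightarrow> nat \<Rightarrow> complex" where
  "beta_coord a N S z i =
    (if i + 2 \<le> N then alpha_coord a N S z i / alpha_coord a N S z (i + 1)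
     else alpha_coord a N S z i)"

definition real_linear_det :: "(complex \<Rightarrow> complex) \<Rightarrow> real" where
  "real_linear_det S = Re (S 1) * Im (S \<i>) - Im (S 1) * Re (S \<i>)"

text \<open>The quadratic (degree two) Taylor part at \<open>0\<close> in direction \<open>v\<close>, i.e. \<open>D\<^sup>2q(0)(v, v) / 2\<close>.\<close>

definition quadratic_part :: "(complex \<Rightarrow> real) \<Rightarrow> complex \<Rightarrow> real" where
  "quadratic_part q v = (deriv ^^ 2) (\<lambda>t::real. q (of_real t * v)) 0 / 2"

definition h0_fun :: "(nat \<Rightarrow> real) \<Rightarrow> nat \<Rightarrow> real \<Rightarrow> (nat \<Rightarrow> complex) \<Rightarrow> real" where
  "h0_fun a N \<omega> \<alpha> =
    - (\<Sum>k=1..N-1. a (k + 1) * partial_strength a k / (4 * pi) * ln ((cmod (\<alpha> k))\<^sup>2))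
    - \<omega> * (cmod (\<alpha> N))\<^sup>2"


section \<open>Formal series\<close>

text \<open>A formal Laurent series in \<open>\<alpha>\<close> and its conjugate, treated as independent variables, is
  given by the coefficients of the monomials with exponent vectors \<open>P\<close> (of \<open>\<alpha>\<close>) and \<open>Q\<close> (of the
  conjugates). A \<^emph>\<open>log series\<close> \<open>(c, f)\<close> stands for
  \<open>\<Sum>k. c k * ln (\<alpha>\<^sub>k * conj \<alpha>\<^sub>k) + f\<close>; the logarithms are needed for \<open>h\<^sub>0\<close> only.\<close>

type_synonym laurent = "(nat \<Rightarrow> int) \<Rightarrow> (nat \<Rightarrow> int) \<Rightarrow> complex"
type_synonym log_series = "(nat \<Rightarrow> complex) \<times> laurent"

definition of_laurent :: "laurent \<Rightarrow> log_series" where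
  "of_laurent f = (\<lambda>_. 0, f)"

definition add_laurent :: "log_series \<Rightarrow> laurent \<Rightarrow> log_series" where
  "add_laurent F f = (fst F, \<lambda>P Q. snd F P Q + f P Q)"

text \<open>Cauchy product. It is meaningful only if one factor has finitely many terms (\<open>Sum_any\<close> is
  \<open>0\<close> on functions with infinite support), which is the case in every use below: generating functions
  are polynomials, and the derivatives of \<open>h\<^sub>0\<close> are single monomials.\<close>

definition laurent_mult :: "laurent \<Rightarrow> laurent \<Rightarrow> laurent" where
  "laurent_mult f g = (\<lambda>P Q. Sum_any (\<lambda>(P', Q').
     f P' Q' * g (\<lambda>i. P i - P' i) (\<lambda>i. Q i - Q' i)))"

definition d_alpha :: "nat \<Rightarrow> log_series \<Rightarrow> laurent" where
  "d_alpha k F = (\<lambda>P Q.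
     (if P = (\<lambda>_. 0)(k := -1) \<and> Q = (\<lambda>_. 0) then fst F k else 0) +
     of_int (P k + 1) * snd F (P(k := P k + 1)) Q)"

definition d_alpha_bar :: "nat \<Rightarrow> log_series \<Rightarrow> laurent" where
  "d_alpha_bar k F = (\<lambda>P Q.
     (if P = (\<lambda>_. 0) \<and> Q = (\<lambda>_. 0)(k := -1) then fst F k else 0) +
     of_int (Q k + 1) * snd F P (Q(k := Q k + 1)))"

text \<open>For \<open>1 \<le> k \<le> N\<close> the index \<open>k mod N + 1\<close> is \<open>k + 1\<close> read modulo \<open>N\<close> in \<open>{1..N}\<close>.\<close>

definition poisson_bracket :: "(nat \<Rightarrow> real) \<Rightarrow> nat \<Rightarrow> log_series \<Rightarrow> log_series \<Rightarrow> laurent" where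
  "poisson_bracket a N F G = (\<lambda>P Q. \<Sum>k=1..N.
     \<i> / of_real (partial_strength a k * kappa a (k mod N + 1)) *
     (laurent_mult (d_alpha k F) (d_alpha_bar k G) P Q -
      laurent_mult (d_alpha_bar k F) (d_alpha k G) P Q))"

definition h0_series :: "(nat \<Rightarrow> real) \<Rightarrow> nat \<Rightarrow> real \<Rightarrow> log_series" where
  "h0_series a N \<omega> =
    ((\<lambda>k. if 1 \<le> k \<and> k \<le> N - 1
          then of_real (- (a (k + 1) * partial_strength a k / (4 * pi))) else 0),
     (\<lambda>P Q. if P = (\<lambda>_. 0)(N := 1) \<and> Q = (\<lambda>_. 0)(N := 1) then of_real (- \<omega>) else 0))"


section \<open>Power series in \<open>\<beta>\<close>\<close>

definition multi_indices :: "nat \<Rightarrow> (nat \<Rightarrow> nat) set" where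
  "multi_indices N = {K. \<forall>i. i \<notin> {1..N} \<longrightarrow> K i = 0}"

text \<open>The exponent of \<open>\<alpha>\<^sub>k\<close> in \<open>\<beta>\<^sub>i\<close>, and in the monomial with \<open>\<beta>\<close>-exponent \<open>K\<close>.\<close>

definition beta_exponent :: "nat \<Rightarrow> nat \<Rightarrow> nat \<Rightarrow> int" where
  "beta_exponent N i k = (if k = i then 1 else if i + 2 \<le> N \<and> k = i + 1 then -1 else 0)"

definition alpha_exponent :: "nat \<Rightarrow> (nat \<Rightarrow> nat) \<Rightarrow> nat \<Rightarrow> int" where
  "alpha_exponent N K k = (\<Sum>i=1..N. int (K i) * beta_exponent N i k)"

definition beta_coeff :: "nat \<Rightarrow> laurent \<Rightarrow> (nat \<Rightarrow> nat) \<Rightarrow> (nat \<Rightarrow> nat) \<Rightarrow> complex" where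
  "beta_coeff N f K L = f (alpha_exponent N K) (alpha_exponent N L)"

definition exponents :: "nat \<Rightarrow> laurent \<Rightarrow> ((nat \<Rightarrow> nat) \<times> (nat \<Rightarrow> nat)) set" where
  "exponents N f = {(K, L) \<in> multi_indices N \<times> multi_indices N. beta_coeff N f K L \<noteq> 0}"

definition beta_series :: "nat \<Rightarrow> laurent \<Rightarrow> bool" where
  "beta_series N f \<longleftrightarrow> (\<forall>P Q. f P Q \<noteq> 0 \<longrightarrow>
     (\<exists>K\<in>multi_indices N. \<exists>L\<in>multi_indices N. P = alpha_exponent N K \<and> Q = alpha_exponent N L))"

definition beta_polynomial :: "nat \<Rightarrow> laurent \<Rightarrow> bool" where
  "beta_polynomial N f \<longleftrightarrow> beta_series N f \<and> finite (exponents N f)"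

text \<open>The zero series has order \<open>\<infinity>\<close>.\<close>

definition series_ord :: "nat \<Rightarrow> laurent \<Rightarrow> enat" where
  "series_ord N f = (INF (K, L)\<in>exponents N f. enat ((\<Sum>i=1..N. K i) + (\<Sum>i=1..N. L i)))"

text \<open>\<open>R\<close> is the power series of \<open>H\<^sub>\<Omega> - h\<^sub>0\<close> in \<open>\<beta>\<close> and its conjugate, where \<open>H\<^sub>\<Omega>\<close> is the vortex
  Hamiltonian with its additive constant \<open>c\<close> dropped. Where \<open>\<alpha>\<^sub>1, \<dots>, \<alpha>\<^bsub>N-1\<^esub>\<close> do not vanish, the
  coordinates \<open>\<beta>\<close> range over all small vectors with nonzero first \<open>N - 1\<close> entries.\<close>

definition perturbation_series ::
    "(nat \<Rightarrow> real) \<Rightarrow> nat \<Rightarrow> (complex \<Rightarrow> complex \<Rightarrow> real) \<Rightarrow> (complex \<Rightarrow> complex) \<Rightarrow> real \<Rightarrow>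
     laurent \<Rightarrow> bool" where
  "perturbation_series a N \<gamma> S \<omega> R \<longleftrightarrow>
    beta_series N R \<and> beta_coeff N R (\<lambda>_. 0) (\<lambda>_. 0) = 0 \<and>
    (\<exists>c. \<exists>\<epsilon>>0. \<forall>z.
      (\<forall>k\<in>{1..N-1}. alpha_coord a N S z k \<noteq> 0) \<and>
      (\<forall>i\<in>{1..N}. cmod (beta_coord a N S z i) < \<epsilon>) \<longrightarrow>
      ((\<lambda>(K, L). beta_coeff N R K L * (\<Prod>i=1..N. beta_coord a N S z i ^ K i)
                                   * (\<Prod>i=1..N. cnj (beta_coord a N S z i) ^ L i))
        has_sum of_real (vortex_hamiltonian a N \<gamma> z - h0_fun a N \<omega> (alpha_coord a N S z) - c))
        (multi_indices N \<times> multi_indices N))"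


section \<open>Formal canonical transformations\<close>

definition lie_derivative ::
    "(nat \<Rightarrow> real) \<Rightarrow> nat \<Rightarrow> laurent \<Rightarrow> log_series \<Rightarrow> log_series" where
  "lie_derivative a N g F = of_laurent (poisson_bracket a N (of_laurent g) F)"

text \<open>\<open>F' = F \<circ> \<phi>\<^sub>g\<close> as an identity of formal power series in \<open>\<beta>\<close> and its conjugate (apart from the
  logarithms): all terms of the Lie series are such power series, each coefficient receives
  finitely many contributions, and the sum is \<open>F'\<close>.\<close>

definition lie_transform ::
    "(nat \<Rightarrow> real) \<Rightarrow> nat \<Rightarrow> laurent \<Rightarrow> log_series \<Rightarrow> log_series \<Rightarrow> bool" where
  "lie_transform a N g F F' \<longleftrightarrow>
    beta_polynomial N g \<and>
    (\<forall>l. beta_series N (snd ((lie_derivative a N g ^^ l) F))) \<and>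
    (\<forall>P Q. finite {l. snd ((lie_derivative a N g ^^ l) F) P Q \<noteq> 0}) \<and>
    F' = (fst F, \<lambda>P Q. Sum_any (\<lambda>l. snd ((lie_derivative a N g ^^ l) F) P Q / fact l))"

text \<open>\<open>F' = F \<circ> T\<close> for \<open>T = \<phi>\<^bsub>g\<^sub>1\<^esub> \<circ> \<dots> \<circ> \<phi>\<^bsub>g\<^sub>r\<^esub>\<close> given by the list of generating functions
  \<open>[g\<^sub>1, \<dots>, g\<^sub>r]\<close>.\<close>

fun canonical_transform ::
    "(nat \<Rightarrow> real) \<Rightarrow> nat \<Rightarrow> laurent list \<Rightarrow> log_series \<Rightarrow> log_series \<Rightarrow> bool" where
  "canonical_transform a N [] F F' \<longleftrightarrow> F' = F"
| "canonical_transform a N (g # gs) F F' \<longleftrightarrow>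
    (\<exists>F1. lie_transform a N g F F1 \<and> canonical_transform a N gs F1 F')"


section \<open>The exponent sets\<close>

definition index_support :: "(nat \<Rightarrow> nat) \<Rightarrow> nat set" where
  "index_support K = {i. K i \<noteq> 0}"

definition truncated_support :: "nat \<Rightarrow> (nat \<Rightarrow> nat) \<Rightarrow> nat set" where
  "truncated_support m K = {i\<in>{1..m}. K i \<noteq> 0}"

definition consecutive :: "nat set \<Rightarrow> bool" where
  "consecutive I \<longleftrightarrow> I = {} \<or> (\<exists>p q. I = {p..q})"

definition resonant_set :: "nat \<Rightarrow> nat \<Rightarrow> ((nat \<Rightarrow> nat) \<times> (nat \<Rightarrow> nat)) set" where
  "resonant_set N m =
    {(K, L) \<in> multi_indices N \<times> multi_indices N. \<forall>i\<in>{1..m}. K i = L i}"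

definition connected_exponents :: "nat \<Rightarrow> ((nat \<Rightarrow> nat) \<times> (nat \<Rightarrow> nat)) set" where
  "connected_exponents N =
    {(K, L) \<in> multi_indices N \<times> multi_indices N.
      consecutive (index_support (\<lambda>i. K i + L i)) \<and>
      ((\<exists>m\<in>{1..N}. (K, L) \<in> resonant_set N (m - 1) - resonant_set N m \<and>
          consecutive (truncated_support m K) \<and>
          (\<forall>l\<in>{1..m-1}. K l = L l \<and> K l \<noteq> 1)) \<or>
       ((K, L) \<in> resonant_set N N \<and> consecutive (index_support K)))}"

end

theory Submission
  imports Defs
begin

text \<open>
  The exponents are put into normal form in stages: stage \<open>s\<close> removes the nonresonant terms of order at most
  \<open>n\<close> whose exponents \<open>K\<close> and \<open>L\<close> differ for the first time at the index \<open>s\<close>. The fastest frequency that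
  such a monomial sees is that of \<open>\<alpha>\<^sub>s\<close>, which is proportional to \<open>1 / \<bar>\<alpha>\<^sub>s\<bar>^2\<close>; hence its product with
  \<open>\<bar>\<alpha>\<^sub>s\<bar>^2\<close> (with a constant for \<open>s = N\<close>) is a generating function that removes it and leaves only terms of
  higher order.

  A bracket divides by \<open>\<bar>\<alpha>\<^sub>k\<bar>^2\<close> and is a power series in \<open>\<beta>\<close> only if enough powers of \<open>\<beta>\<^sub>k, \<dots>\<close> are present.
  This holds because the exponents stay in a set that is smaller than the one of the theorem: the support
  is connected, monomials in \<open>\<beta>\<^sub>N\<close> alone have order at least three, and \<open>(K\<^sub>l, L\<^sub>l)\<close> is \<open>(0, 0)\<close> or has an
  entry \<open>\<ge> 2\<close>. The last condition is required only for \<open>l\<close> up to the first difference once that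
  difference lies before the current stage; such terms have order above \<open>n\<close> and are never normalised again.

  That the exponents of \<open>R\<^sub>0\<close> lie in this set comes from the centre of mass: the power sums
  \<open>\<Sum> a\<^sub>k z\<^sub>k^p\<close>, out of which the Hamiltonian is built, have no terms linear in \<open>w\<^sub>m\<close> when the \<open>w\<^sub>j\<close> with
  \<open>j < m\<close> vanish. The regular part of Green's function is expanded by means of
  \<open>2 \<pi> \<gamma>(z, w) = ln \<bar>(\<phi> z - \<phi> w) / (z - w)\<bar> - ln \<bar>1 - \<phi> z (conj (\<phi> w))\<bar>\<close>.
\<close>

section \<open>Exponents and the Poisson bracket\<close>

text \<open>The obstacle is that every bracket divides by the squared modulus of some
  \<open>\<alpha>\<^sub>k\<close>. The extra factor of a generator at stage s turns this into a
  quotient of squared moduli: for s < k < N it multiplies by the squared moduli of the \<beta> with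
  index from s to k - 1, for k < s it divides by such a product. Generator entries at least 2
  survive one division without shrinking the support, but the product may then violate the gap
  condition; this explains why less is asked once the first difference has passed. For k = N two
  powers of \<open>\<beta>\<^sub>N\<close> are lost: cubic pure monomials still gain a degree,
  quadratic ones would not. For the initial exponents, each m has its own regrouping of the
  Hamiltonian in which the terms linear in \<open>u\<^sub>m\<close> cancel. The same function is
  thus represented once for every m, and uniqueness of the coefficients intersects the resulting
  restrictions. The given series is tied to the Hamiltonian only at nonzero
  \<open>\<beta>\<^sub>i\<close> with i < N, so uniqueness is proved from such points; the identity
  then extends to vanishing \<beta>, where the pure terms of degree one and two are read
  off.\<close>

text \<open>The exponent of \<open>\<beta>\<^sub>i\<close> in the monomial with \<open>\<alpha>\<close>-exponents \<open>P\<close>, as a linear function of \<open>P\<close>.\<close>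

definition beta_exp :: "nat \<Rightarrow> (nat \<Rightarrow> int) \<Rightarrow> nat \<Rightarrow> int" where
  "beta_exp N P i = (if i < N then (\<Sum>j=1..i. P j) else if i = N then P N else 0)"

text \<open>By \<open>admissible_iff\<close> these are exactly the exponent vectors of monomials in
  \<beta>. Stating it by linear inequalities in \<open>P\<close> leaves no witness to carry through
  the brackets.\<close>

definition admissible :: "nat \<Rightarrow> (nat \<Rightarrow> int) \<Rightarrow> bool" where
  "admissible N P \<longleftrightarrow> (\<forall>i. i \<notin> {1..N} \<longrightarrow> P i = 0) \<and> (\<forall>i. 0 \<le> beta_exp N P i)"

lemma beta_exp_0 [simp]: "0 < N \<Longrightarrow> beta_exp N P 0 = 0"
  by (simp add: beta_exp_def)

lemma beta_exp_outside: "i \<notin> {1..N} \<Longrightarrow> 0 < N \<Longrightarrow> beta_exp N P i = 0"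
  by (auto simp: beta_exp_def)

lemma exponent_eq_beta_exp:
  assumes "1 \<le> k" "k \<le> N"
  shows "P k = (if k < N then beta_exp N P k - beta_exp N P (k - 1) else beta_exp N P N)"
proof -
  obtain m where "k = Suc m" using assms by (cases k) auto
  then show ?thesis using assms by (auto simp: beta_exp_def)
qed

text \<open>For 1 < k < N the variable \<open>\<alpha>\<^sub>k\<close> occurs in two of the \<beta>,
  once inverted, so its exponent is a discrete difference; this is why the prefix sum
  \<open>beta_exp\<close> inverts it by telescoping. The index N stands apart because
  \<open>\<beta>\<^sub>N\<close> is \<open>\<alpha>\<^sub>N\<close> itself.\<close>

lemma alpha_exponent_eq:
  assumes K: "K \<in> multi_indices N" and N: "N \<ge> 2"
  shows "alpha_exponent N K k =
    (if k = 0 \<or> k > N then 0 else if k < N then int (K k) - int (K (k - 1)) else int (K N))"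
proof -
  have "alpha_exponent N K k = (\<Sum>i=1..N. (if i = k then int (K k) else 0)
      - (if k < N \<and> k \<ge> 1 \<and> i = k - 1 then int (K (k - 1)) else 0))"
    unfolding alpha_exponent_def beta_exponent_def by (rule sum.cong) (auto split: if_splits)
  also have "\<dots> = (\<Sum>i=1..N. (if i = k then int (K k) else 0)) -
      (\<Sum>i=1..N. (if k < N \<and> k \<ge> 1 \<and> i = k - 1 then int (K (k - 1)) else 0))"
    by (rule sum_subtractf)
  also have "(\<Sum>i=1..N. (if i = k then int (K k) else 0)) = (if k \<in> {1..N} then int (K k) else 0)"
    by simp
  also have "(\<Sum>i=1..N. (if k < N \<and> k \<ge> 1 \<and> i = k - 1 then int (K (k - 1)) else 0)) =
      (if k < N \<and> k \<ge> 1 then int (K (k - 1)) else 0)"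
  proof (cases "k < N \<and> k \<ge> 1")
    case True
    then have "(\<Sum>i=1..N. (if k < N \<and> k \<ge> 1 \<and> i = k - 1 then int (K (k - 1)) else 0)) =
       (\<Sum>i=1..N. (if i = k - 1 then int (K (k - 1)) else 0))" by simp
    also have "\<dots> = (if k - 1 \<in> {1..N} then int (K (k - 1)) else 0)" by simp
    also have "\<dots> = int (K (k - 1))" using K by (auto simp: multi_indices_def)
    finally show ?thesis using True by simp
  qed auto
  finally show ?thesis using K N by (auto simp: multi_indices_def)
qed

lemma beta_exp_alpha_exponent:
  assumes K: "K \<in> multi_indices N" and N: "N \<ge> 2"
  shows "beta_exp N (alpha_exponent N K) i = int (K i)"
proof -
  have "(\<Sum>j=1..i. alpha_exponent N K j) = int (K i)" if "i < N" for i
    using that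
  proof (induction i)
    case 0
    then show ?case using K by (auto simp: multi_indices_def)
  next
    case (Suc i)
    then show ?case using alpha_exponent_eq[OF K N, of "Suc i"] by simp
  qed
  then show ?thesis
    using alpha_exponent_eq[OF K N, of N] K N by (auto simp: beta_exp_def multi_indices_def)
qed

lemma admissible_alpha_exponent:
  assumes K: "K \<in> multi_indices N" and N: "N \<ge> 2"
  shows "admissible N (alpha_exponent N K)"
  using beta_exp_alpha_exponent[OF assms] alpha_exponent_eq[OF assms] by (auto simp: admissible_def)

lemma beta_exp_inject:
  assumes "admissible N P" "admissible N Q" "\<And>i. beta_exp N P i = beta_exp N Q i"
  shows "P = Q"
proof
  fix k
  show "P k = Q k"
    using assms exponent_eq_beta_exp[of k N P] exponent_eq_beta_exp[of k N Q]
    by (cases "k \<in> {1..N}") (auto simp: admissible_def)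
qed

lemma admissible_iff:
  assumes N: "N \<ge> 2"
  shows "admissible N P \<longleftrightarrow> (\<exists>K\<in>multi_indices N. P = alpha_exponent N K)"
proof
  assume P: "admissible N P"
  define K where "K = (\<lambda>i. nat (beta_exp N P i))"
  have K: "K \<in> multi_indices N"
    using N by (auto simp: K_def multi_indices_def beta_exp_outside)
  have "P = alpha_exponent N K"
    using P admissible_alpha_exponent[OF K N]
  proof (rule beta_exp_inject)
    show "beta_exp N P i = beta_exp N (alpha_exponent N K) i" for i
      using P unfolding beta_exp_alpha_exponent[OF K N] by (simp add: K_def admissible_def)
  qed
  then show "\<exists>K\<in>multi_indices N. P = alpha_exponent N K" using K by blast
qed (auto simp: admissible_alpha_exponent N)

lemma alpha_exponent_inject:
  assumes "K \<in> multi_indices N" "K' \<in> multi_indices N" "N \<ge> 2" "alpha_exponent N K = alpha_exponent N K'"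
  shows "K = K'"
  using beta_exp_alpha_exponent[OF assms(1,3)] beta_exp_alpha_exponent[OF assms(2,3)] assms(4)
  by (metis of_nat_eq_iff ext)

lemma beta_series_iff:
  assumes "N \<ge> 2"
  shows "beta_series N f \<longleftrightarrow> (\<forall>P Q. f P Q \<noteq> 0 \<longrightarrow> admissible N P \<and> admissible N Q)"
  unfolding beta_series_def admissible_iff[OF assms] by blast

definition total_degree :: "nat \<Rightarrow> (nat \<Rightarrow> int) \<Rightarrow> (nat \<Rightarrow> int) \<Rightarrow> int" where
  "total_degree N P Q = (\<Sum>i=1..N. beta_exp N P i + beta_exp N Q i)"

lemma finite_multi_indices_bounded: "finite {K \<in> multi_indices N. \<forall>i. K i \<le> n}"
proof -
  have "finite {f. \<forall>x. (x \<in> {1..N} \<longrightarrow> f x \<in> {0..n}) \<and> (x \<notin> {1..N} \<longrightarrow> f x = (0::nat))}"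
    by (rule finite_set_of_finite_funs) auto
  then show ?thesis by (rule finite_subset[rotated]) (auto simp: multi_indices_def)
qed

lemma finite_total_degree_le:
  assumes N: "N \<ge> 2"
  shows "finite {(P, Q). admissible N P \<and> admissible N Q \<and> total_degree N P Q \<le> int n}"
proof -
  let ?M = "{K \<in> multi_indices N. \<forall>i. K i \<le> n}"
  have "{(P, Q). admissible N P \<and> admissible N Q \<and> total_degree N P Q \<le> int n}
      \<subseteq> (alpha_exponent N ` ?M) \<times> (alpha_exponent N ` ?M)"
  proof (rule subrelI)
    fix P Q assume "(P, Q) \<in> {(P, Q). admissible N P \<and> admissible N Q \<and> total_degree N P Q \<le> int n}"
    then have *: "admissible N P" "admissible N Q" "total_degree N P Q \<le> int n" by auto
    obtain K L where KL: "K \<in> multi_indices N" "L \<in> multi_indices N"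
      "P = alpha_exponent N K" "Q = alpha_exponent N L"
      using * by (auto simp: admissible_iff[OF N])
    have "K i + L i \<le> n" for i
    proof (cases "i \<in> {1..N}")
      case True
      then have "int (K i + L i) \<le> (\<Sum>i=1..N. int (K i + L i))"
        by (intro member_le_sum) auto
      also have "\<dots> \<le> int n"
        using *(3) KL N by (simp add: total_degree_def beta_exp_alpha_exponent)
      finally show ?thesis by simp
    next
      case False
      then show ?thesis using KL by (auto simp: multi_indices_def)
    qed
    then have "K i \<le> n" "L i \<le> n" for i by (meson add_leD1 add_leD2)+
    then show "(P, Q) \<in> (alpha_exponent N ` ?M) \<times> (alpha_exponent N ` ?M)"
      using KL by auto
  qed
  then show ?thesis
    by (rule finite_subset) (intro finite_cartesian_product finite_imageI finite_multi_indices_bounded)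
qed

section \<open>Coefficients of the Poisson bracket\<close>

text \<open>Lowering the k-th exponent is injective, so the sum over monomials of the derivative can
  be taken over those of \<open>g\<close> instead. The finite set \<open>A\<close> turns
  \<open>Sum_any\<close> into an ordinary finite sum.\<close>

lemma laurent_mult_d_alpha:
  assumes A: "finite A" "{(P, Q). g P Q \<noteq> 0} \<subseteq> A"
  shows "laurent_mult (d_alpha k (of_laurent g)) G P Q =
    (\<Sum>(P1, Q1)\<in>A. of_int (P1 k) * g P1 Q1 *
       G (\<lambda>i. P i - P1 i + (if i = k then 1 else 0)) (\<lambda>i. Q i - Q1 i))"
proof -
  let ?s = "\<lambda>(P1, Q1). (P1(k := P1 k - 1), Q1) :: (nat \<Rightarrow> int) \<times> (nat \<Rightarrow> int)"
  let ?h = "\<lambda>(P', Q'). d_alpha k (of_laurent g) P' Q' * G (\<lambda>i. P i - P' i) (\<lambda>i. Q i - Q' i)"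
  have inj: "inj_on ?s A"
    by (rule inj_on_inverseI[where g = "\<lambda>(P1, Q1). (P1(k := P1 k + 1), Q1)"]) auto
  have sub: "{x. ?h x \<noteq> 0} \<subseteq> ?s ` A"
  proof clarify
    fix P' Q' assume "d_alpha k (of_laurent g) P' Q' * G (\<lambda>i. P i - P' i) (\<lambda>i. Q i - Q' i) \<noteq> 0"
    then have "(P'(k := P' k + 1), Q') \<in> A"
      using A(2) by (auto simp: d_alpha_def of_laurent_def split: if_splits)
    then show "(P', Q') \<in> ?s ` A" by (force intro!: image_eqI[where x = "(P'(k := P' k + 1), Q')"])
  qed
  have "laurent_mult (d_alpha k (of_laurent g)) G P Q = sum ?h (?s ` A)"
    unfolding laurent_mult_def by (rule Sum_any.expand_superset) (use A sub in auto)
  also have "\<dots> = sum (?h \<circ> ?s) A" by (rule sum.reindex[OF inj])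
  also have "\<dots> = (\<Sum>(P1, Q1)\<in>A. of_int (P1 k) * g P1 Q1 *
       G (\<lambda>i. P i - P1 i + (if i = k then 1 else 0)) (\<lambda>i. Q i - Q1 i))"
    by (rule sum.cong) (auto simp: d_alpha_def of_laurent_def fun_eq_iff intro!: arg_cong2[where f = G])
  finally show ?thesis .
qed

lemma laurent_mult_d_alpha_bar:
  assumes A: "finite A" "{(P, Q). g P Q \<noteq> 0} \<subseteq> A"
  shows "laurent_mult (d_alpha_bar k (of_laurent g)) G P Q =
    (\<Sum>(P1, Q1)\<in>A. of_int (Q1 k) * g P1 Q1 *
       G (\<lambda>i. P i - P1 i) (\<lambda>i. Q i - Q1 i + (if i = k then 1 else 0)))"
proof -
  let ?s = "\<lambda>(P1, Q1). (P1, Q1(k := Q1 k - 1)) :: (nat \<Rightarrow> int) \<times> (nat \<Rightarrow> int)"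
  let ?h = "\<lambda>(P', Q'). d_alpha_bar k (of_laurent g) P' Q' * G (\<lambda>i. P i - P' i) (\<lambda>i. Q i - Q' i)"
  have inj: "inj_on ?s A"
    by (rule inj_on_inverseI[where g = "\<lambda>(P1, Q1). (P1, Q1(k := Q1 k + 1))"]) auto
  have sub: "{x. ?h x \<noteq> 0} \<subseteq> ?s ` A"
  proof clarify
    fix P' Q' assume "d_alpha_bar k (of_laurent g) P' Q' * G (\<lambda>i. P i - P' i) (\<lambda>i. Q i - Q' i) \<noteq> 0"
    then have "(P', Q'(k := Q' k + 1)) \<in> A"
      using A(2) by (auto simp: d_alpha_bar_def of_laurent_def split: if_splits)
    then show "(P', Q') \<in> ?s ` A" by (force intro!: image_eqI[where x = "(P', Q'(k := Q' k + 1))"])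
  qed
  have "laurent_mult (d_alpha_bar k (of_laurent g)) G P Q = sum ?h (?s ` A)"
    unfolding laurent_mult_def by (rule Sum_any.expand_superset) (use A sub in auto)
  also have "\<dots> = sum (?h \<circ> ?s) A" by (rule sum.reindex[OF inj])
  also have "\<dots> = (\<Sum>(P1, Q1)\<in>A. of_int (Q1 k) * g P1 Q1 *
       G (\<lambda>i. P i - P1 i) (\<lambda>i. Q i - Q1 i + (if i = k then 1 else 0)))"
    by (rule sum.cong) (auto simp: d_alpha_bar_def of_laurent_def fun_eq_iff intro!: arg_cong2[where f = G])
  finally show ?thesis .
qed

text \<open>When \<open>P1\<close> comes from the first factor of the k-th bracket term and
  \<open>P\<close> is the result, this is what the second factor must have: together the two
  derivatives remove one power of \<open>\<alpha>\<^sub>k\<close> and one of its conjugate.\<close>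

definition cofactor :: "nat \<Rightarrow> (nat \<Rightarrow> int) \<Rightarrow> (nat \<Rightarrow> int) \<Rightarrow> nat \<Rightarrow> int" where
  "cofactor k P P1 = (\<lambda>i. P i - P1 i + (if i = k then 1 else 0))"

definition bracket_weight :: "(nat \<Rightarrow> real) \<Rightarrow> nat \<Rightarrow> nat \<Rightarrow> complex" where
  "bracket_weight a N k = \<i> / of_real (partial_strength a k * kappa a (k mod N + 1))"

text \<open>The two products in a bracket term shift exponents in the same way, so their
  coefficients combine to a determinant of exponents. The derivative of a logarithm is a single
  monomial and therefore picks out one coefficient of \<open>g\<close>.\<close>

lemma poisson_bracket_eq:
  assumes A: "finite A" "{(P, Q). g P Q \<noteq> 0} \<subseteq> A"
  shows "poisson_bracket a N (of_laurent g) (c, f) P Q =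
    (\<Sum>k=1..N. bracket_weight a N k *
      (c k * of_int (P k - Q k) * g (P(k := P k + 1)) (Q(k := Q k + 1)) +
       (\<Sum>(P1, Q1)\<in>A. g P1 Q1 * f (cofactor k P P1) (cofactor k Q Q1) *
          of_int (P1 k * cofactor k Q Q1 k - Q1 k * cofactor k P P1 k))))"
proof -
  have "laurent_mult (d_alpha k (of_laurent g)) (d_alpha_bar k (c, f)) P Q -
        laurent_mult (d_alpha_bar k (of_laurent g)) (d_alpha k (c, f)) P Q =
      c k * of_int (P k - Q k) * g (P(k := P k + 1)) (Q(k := Q k + 1)) +
       (\<Sum>(P1, Q1)\<in>A. g P1 Q1 * f (cofactor k P P1) (cofactor k Q Q1) *
          of_int (P1 k * cofactor k Q Q1 k - Q1 k * cofactor k P P1 k))" for k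
  proof -
    let ?S = "(P(k := P k + 1), Q(k := Q k + 1))"
    have e1: "P1 = P(k := P k + 1)" if "(\<lambda>i. P i - P1 i + (if i = k then 1 else 0)) = (\<lambda>_. 0)" for P P1 :: "nat \<Rightarrow> int"
    proof
      fix i show "P1 i = (P(k := P k + 1)) i" using fun_cong[OF that, of i] by (auto split: if_splits)
    qed
    have e2: "P1 = P(k := P k + 1)" if "(\<lambda>i. P i - P1 i) = (\<lambda>_. 0)(k := - 1)" for P P1 :: "nat \<Rightarrow> int"
    proof
      fix i show "P1 i = (P(k := P k + 1)) i" using fun_cong[OF that, of i] by (auto split: if_splits)
    qed
    have e3: "(\<lambda>i. Q i - Q1 i)(k := Q k - Q1 k + 1) = cofactor k Q Q1" for Q Q1 :: "nat \<Rightarrow> int"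
      by (auto simp: cofactor_def)
    have e4: "cofactor k Q Q1 k = Q k - Q1 k + 1" for Q Q1
      by (simp add: cofactor_def)
    have 1: "laurent_mult (d_alpha k (of_laurent g)) (d_alpha_bar k (c, f)) P Q =
       (\<Sum>x\<in>A. (if x = ?S then of_int (P k + 1) * g (fst ?S) (snd ?S) * c k else 0) +
         (case x of (P1, Q1) \<Rightarrow> of_int (P1 k * cofactor k Q Q1 k) * g P1 Q1 * f (cofactor k P P1) (cofactor k Q Q1)))"
    proof (rule trans[OF laurent_mult_d_alpha[OF A]], rule sum.cong[OF refl], unfold split_paired_all prod.case)
      fix P1 Q1
      have "((\<lambda>i. P i - P1 i + (if i = k then 1 else 0)) = (\<lambda>_. 0) \<and> (\<lambda>i. Q i - Q1 i) = (\<lambda>_. 0)(k := - 1))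
        \<longleftrightarrow> (P1, Q1) = ?S"
        using e1 e2 by (auto simp: fun_eq_iff)
      then show "of_int (P1 k) * g P1 Q1 * d_alpha_bar k (c, f) (\<lambda>i. P i - P1 i + (if i = k then 1 else 0)) (\<lambda>i. Q i - Q1 i) =
         (if (P1, Q1) = ?S then of_int (P k + 1) * g (fst ?S) (snd ?S) * c k else 0) +
         of_int (P1 k * cofactor k Q Q1 k) * g P1 Q1 * f (cofactor k P P1) (cofactor k Q Q1)"
        unfolding d_alpha_bar_def snd_conv fst_conv e3 cofactor_def[symmetric]
        by (auto simp: e4 algebra_simps)
    qed
    have 2: "laurent_mult (d_alpha_bar k (of_laurent g)) (d_alpha k (c, f)) P Q =
       (\<Sum>x\<in>A. (if x = ?S then of_int (Q k + 1) * g (fst ?S) (snd ?S) * c k else 0) +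
         (case x of (P1, Q1) \<Rightarrow> of_int (Q1 k * cofactor k P P1 k) * g P1 Q1 * f (cofactor k P P1) (cofactor k Q Q1)))"
    proof (rule trans[OF laurent_mult_d_alpha_bar[OF A]], rule sum.cong[OF refl], unfold split_paired_all prod.case)
      fix P1 Q1
      have "((\<lambda>i. P i - P1 i) = (\<lambda>_. 0)(k := - 1) \<and> (\<lambda>i. Q i - Q1 i + (if i = k then 1 else 0)) = (\<lambda>_. 0))
        \<longleftrightarrow> (P1, Q1) = ?S"
        using e1 e2 by (auto simp: fun_eq_iff)
      then show "of_int (Q1 k) * g P1 Q1 * d_alpha k (c, f) (\<lambda>i. P i - P1 i) (\<lambda>i. Q i - Q1 i + (if i = k then 1 else 0)) =
         (if (P1, Q1) = ?S then of_int (Q k + 1) * g (fst ?S) (snd ?S) * c k else 0) +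
         of_int (Q1 k * cofactor k P P1 k) * g P1 Q1 * f (cofactor k P P1) (cofactor k Q Q1)"
        unfolding d_alpha_def snd_conv fst_conv e3 cofactor_def[symmetric]
        by (auto simp: e4 algebra_simps)
    qed
    \<comment> \<open>\<open>?S\<close> may lie outside \<open>A\<close>; its coefficient is then
      zero, and the delta sum below is still correct.\<close>
    have "?S \<in> A \<or> g (fst ?S) (snd ?S) = 0" using A(2) by auto
    then have 3: "(\<Sum>x\<in>A. (if x = ?S then t * g (fst ?S) (snd ?S) * c k else 0)) = t * g (fst ?S) (snd ?S) * c k" for t
      using A(1) by (auto simp: sum.delta)
    show ?thesis
      unfolding 1 2 sum.distrib 3
      by (simp add: case_prod_unfold sum_subtractf[symmetric] algebra_simps)
  qed
  then show ?thesis unfolding poisson_bracket_def bracket_weight_def by simp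
qed

section \<open>Exponent pairs preserved by the normalisation\<close>

definition interval_like :: "(nat \<Rightarrow> bool) \<Rightarrow> bool" where
  "interval_like S \<longleftrightarrow> (\<forall>i j l. i \<le> j \<longrightarrow> j \<le> l \<longrightarrow> S i \<longrightarrow> S l \<longrightarrow> S j)"

lemma interval_likeD: "interval_like S \<Longrightarrow> S i \<Longrightarrow> S l \<Longrightarrow> i \<le> j \<Longrightarrow> j \<le> l \<Longrightarrow> S j"
  unfolding interval_like_def by blast

text \<open>Both sets meet \<open>{k - 1, k}\<close>. Between a point of one and a larger point of
  the other there is no hole: the set of the left point covers everything up to
  \<open>k - 1\<close>, that of the right point everything from \<open>k\<close> on. In this way two
  monomials that see \<open>\<alpha>\<^sub>k\<close> have a product with connected support.\<close>

lemma interval_like_Un: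
  assumes S: "interval_like S" and T: "interval_like T"
    and "S k \<or> S (k - 1)" "T k \<or> T (k - 1)"
  shows "interval_like (\<lambda>i. S i \<or> T i)"
proof -
  have *: "S j \<or> T j" if S: "interval_like S" and T: "interval_like T"
    and "S k \<or> S (k - 1)" "T k \<or> T (k - 1)" "S i" "T l" "i \<le> j" "j \<le> l" for S T i j l
  proof (cases "j \<le> k - 1")
    case True
    then have "S j" using that(3,5,7) interval_likeD[OF S, of i _ j] by fastforce
    then show ?thesis ..
  next
    case False
    then have "T j" using that(4,6,8) interval_likeD[OF T, of _ l j] by fastforce
    then show ?thesis ..
  qed
  show ?thesis unfolding interval_like_def
    using *[of S T] *[of T S] assms interval_likeD[OF S] interval_likeD[OF T] by meson
qed

text \<open>The theorem only excludes the pair (1, 1) below the first difference, but that is not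
  stable under products: (1, 0) and (0, 1) add up to it. Excluding all nonzero pairs with entries at
  most one is stable.\<close>

definition gap_pair :: "int \<Rightarrow> int \<Rightarrow> bool" where
  "gap_pair x y \<longleftrightarrow> x = 0 \<and> y = 0 \<or> 2 \<le> x \<or> 2 \<le> y"

lemma gap_pair_add:
  "gap_pair x y \<Longrightarrow> gap_pair x' y' \<Longrightarrow> 0 \<le> x \<Longrightarrow> 0 \<le> y \<Longrightarrow> 0 \<le> x' \<Longrightarrow> 0 \<le> y' \<Longrightarrow> gap_pair (x + x') (y + y')"
  unfolding gap_pair_def by linarith

text \<open>The set of exponents preserved at stage \<open>s\<close>.\<close>

definition good_pair :: "nat \<Rightarrow> nat \<Rightarrow> (nat \<Rightarrow> int) \<Rightarrow> (nat \<Rightarrow> int) \<Rightarrow> bool" where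
  "good_pair N s K L \<longleftrightarrow>
    (\<forall>i. 0 \<le> K i \<and> 0 \<le> L i) \<and> (\<forall>i. i \<notin> {1..N} \<longrightarrow> K i = 0 \<and> L i = 0) \<and>
    interval_like (\<lambda>i. K i \<noteq> 0 \<or> L i \<noteq> 0) \<and>
    (\<forall>l<N. (\<forall>i<s. K i = L i) \<or> (\<forall>i\<le>l. K i = L i) \<longrightarrow> gap_pair (K l) (L l)) \<and>
    ((\<forall>l<N. K l = 0 \<and> L l = 0) \<longrightarrow> 3 \<le> K N + L N)"

lemma good_pairI:
  assumes "\<And>i. 0 \<le> K i" "\<And>i. 0 \<le> L i" "\<And>i. i \<notin> {1..N} \<Longrightarrow> K i = 0 \<and> L i = 0"
    "interval_like (\<lambda>i. K i \<noteq> 0 \<or> L i \<noteq> 0)"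
    "\<And>l. l < N \<Longrightarrow> (\<forall>i<s. K i = L i) \<or> (\<forall>i\<le>l. K i = L i) \<Longrightarrow> gap_pair (K l) (L l)"
    "\<forall>l<N. K l = 0 \<and> L l = 0 \<Longrightarrow> 3 \<le> K N + L N"
  shows "good_pair N s K L"
  unfolding good_pair_def using assms by simp

text \<open>The \<open>\<beta>\<close>-exponents of \<open>\<alpha>\<^sub>k\<close>.\<close>

definition unit_exp :: "nat \<Rightarrow> nat \<Rightarrow> nat \<Rightarrow> int" where
  "unit_exp N k l = (if k < N then of_bool (k \<le> l \<and> l < N) else of_bool (l = k))"

text \<open>The exponent of \<open>\<alpha>\<^sub>k\<close> read off from \<beta>-exponents, that
  is, the inverse of \<open>beta_exp\<close>.\<close>

definition diff_exp :: "nat \<Rightarrow> (nat \<Rightarrow> int) \<Rightarrow> nat \<Rightarrow> int" where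
  "diff_exp N K k = (if k < N then K k - K (k - 1) else K N)"

lemma sum_ge_1:
  fixes f :: "nat \<Rightarrow> int"
  assumes "\<And>l. l \<in> {1..N} \<Longrightarrow> 0 \<le> f l" "j \<in> {1..N}" "1 \<le> f j"
  shows "1 \<le> sum f {1..N}"
  using member_le_sum[of j "{1..N}" f] assms by auto

text \<open>The bracket in \<open>\<alpha>\<^sub>N\<close> may lose one unit of degree at
  \<open>N\<close> on balance; a gain of two elsewhere pays for it.\<close>

lemma sum_ge_1':
  fixes f :: "nat \<Rightarrow> int"
  assumes f: "\<And>l. l \<in> {1..<N} \<Longrightarrow> 0 \<le> f l" and j: "j \<in> {1..<N}" "2 \<le> f j" and N: "-1 \<le> f N"
  shows "1 \<le> sum f {1..N}"
proof -
  have "2 \<le> sum f {1..<N}" using member_le_sum[of j "{1..<N}" f] assms by auto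
  moreover have "{1..N} = insert N {1..<N}" using j by auto
  ultimately show ?thesis using N by simp
qed

text \<open>\<open>(K0, L0)\<close> is the monomial to be removed, so the generator carries it times
  the squared modulus of \<open>\<alpha>\<^sub>s\<close> (if s < N), \<open>(K2, L2)\<close> is a
  monomial of the other factor, and \<open>ne\<close> is the determinant of exponents in the k-th
  bracket term. A nonzero determinant means that both monomials see \<open>\<alpha>\<^sub>k\<close>,
  hence that their supports meet at \<open>k - 1\<close> or \<open>k\<close>. The cases differ in
  the effect of dividing by the squared modulus of \<open>\<alpha>\<^sub>k\<close>.\<close>

lemma good_pair_bracket:
  assumes N: "2 \<le> N" and s: "1 \<le> s" "s \<le> N" and k: "1 \<le> k" "k \<le> N"
    and g0: "good_pair N s K0 L0" "\<forall>i<s. K0 i = L0 i" "K0 s \<noteq> L0 s"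
    and g2: "good_pair N s K2 L2"
    and K: "\<And>l. K l = K0 l + K2 l + (if s < N then unit_exp N s l else 0) - unit_exp N k l"
    and L: "\<And>l. L l = L0 l + L2 l + (if s < N then unit_exp N s l else 0) - unit_exp N k l"
    and ne: "(diff_exp N K0 k + of_bool (k = s \<and> s < N)) * diff_exp N L2 k -
             (diff_exp N L0 k + of_bool (k = s \<and> s < N)) * diff_exp N K2 k \<noteq> 0"
  shows "good_pair N s K L \<and> ((\<forall>i<s. K i = L i) \<longleftrightarrow> (\<forall>i<s. K2 i = L2 i)) \<and>
    (\<Sum>i=1..N. K2 i + L2 i) + 1 \<le> (\<Sum>i=1..N. K i + L i) \<and>
    ((\<forall>i<s. K2 i = L2 i) \<longrightarrow> (\<Sum>i=1..N. K0 i + L0 i) + 1 \<le> (\<Sum>i=1..N. K i + L i))"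
proof -
  let ?S0 = "\<lambda>i. K0 i \<noteq> 0 \<or> L0 i \<noteq> 0" and ?S2 = "\<lambda>i. K2 i \<noteq> 0 \<or> L2 i \<noteq> 0"
  have nn: "0 \<le> K0 i" "0 \<le> L0 i" "0 \<le> K2 i" "0 \<le> L2 i" for i
    using g0(1) g2 by (auto simp: good_pair_def)
  have out: "K0 i = 0" "L0 i = 0" "K2 i = 0" "L2 i = 0" if "i \<notin> {1..N}" for i
    using g0(1) g2 that by (auto simp: good_pair_def)
  have c0: "interval_like ?S0" and c2: "interval_like ?S2"
    using g0(1) g2 by (auto simp: good_pair_def)
  have gap0: "gap_pair (K0 l) (L0 l)" if "l < N" for l
    using g0(1,2) that by (auto simp: good_pair_def)
  have gap2: "gap_pair (K2 l) (L2 l)" if "l < N" "(\<forall>i<s. K2 i = L2 i) \<or> (\<forall>i\<le>l. K2 i = L2 i)" for l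
    using g2 that by (auto simp: good_pair_def)
  have pure0: "3 \<le> K0 N + L0 N" if "\<forall>l<N. K0 l = 0 \<and> L0 l = 0"
    using g0(1) that by (auto simp: good_pair_def)
  have pure2: "3 \<le> K2 N + L2 N" if "\<forall>l<N. K2 l = 0 \<and> L2 l = 0"
    using g2 that by (auto simp: good_pair_def)
  have S0s: "?S0 s" using g0(3) by auto
  have S2k: "?S2 k \<or> ?S2 (k - 1)"
    using ne k by (auto simp: diff_exp_def split: if_splits)
  have eq_iff: "(K i = L i) \<longleftrightarrow> (K2 i = L2 i)" if "i < s" for i
    using g0(2) that by (simp add: K L)
  then have eq_below_iff: "(\<forall>i<s. K i = L i) \<longleftrightarrow> (\<forall>i<s. K2 i = L2 i)" by auto
  consider (A) "k < s" | (B) "s \<le> k" "k < N" | (C) "k = N" using k by linarith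
  then show ?thesis
  proof cases
    case A
    then have kN: "k < N" "k \<noteq> s" using s by auto
    have "K0 k = L0 k" "K0 (k - 1) = L0 (k - 1)" using A g0(2) by auto
    then have x: "diff_exp N K0 k = diff_exp N L0 k" using kN by (simp add: diff_exp_def)
    have "diff_exp N K0 k * (diff_exp N L2 k - diff_exp N K2 k) \<noteq> 0"
      using ne kN x by (simp add: algebra_simps)
    then have x0: "K0 k \<noteq> K0 (k - 1)" and x2: "K2 k \<noteq> L2 k \<or> K2 (k - 1) \<noteq> L2 (k - 1)"
      using kN by (auto simp: diff_exp_def)
    \<comment> \<open>If \<open>K0 k\<close> were zero, \<open>K0 (k - 1)\<close> would not be, and
      the support between \<open>k - 1\<close> and \<open>s\<close> would have a hole at
      \<open>k\<close>.\<close>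
    have S0k: "?S0 k" using x0 interval_likeD[OF c0, of "k - 1" s k] S0s A by fastforce
    \<comment> \<open>The bracket divides by the squared moduli of the \<beta> with index from k to
      s - 1. There the generator has equal nonzero exponents, so the gap condition makes both at
      least 2 and something remains after the division.\<close>
    have two: "K0 j = L0 j \<and> 2 \<le> K0 j" if "k \<le> j" "j < s" for j
    proof -
      have "?S0 j" using interval_likeD[OF c0 S0k S0s] that by auto
      then show ?thesis using gap0[of j] g0(2) that s by (auto simp: gap_pair_def)
    qed
    have Kl: "K l = K0 l + K2 l - of_bool (k \<le> l \<and> l < s)" "L l = L0 l + L2 l - of_bool (k \<le> l \<and> l < s)" for l
      using A kN s by (auto simp: K L unit_exp_def)
    have nneg: "0 \<le> K l" "0 \<le> L l" for l
      using two[of l] nn[of l] by (auto simp: Kl)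
    have S: "(K l \<noteq> 0 \<or> L l \<noteq> 0) \<longleftrightarrow> (?S0 l \<or> ?S2 l)" for l
      using two[of l] nn[of l] by (auto simp: Kl)
    \<comment> \<open>The generator has equal exponents of \<open>\<alpha>\<^sub>k\<close> and its
      conjugate, so the second factor must distinguish them, which puts its first difference before
      \<open>s\<close>.\<close>
    have neq: "\<not> (\<forall>i<s. K2 i = L2 i)" using x2 A
      by (metis less_imp_diff_less)
    have conn: "interval_like (\<lambda>l. K l \<noteq> 0 \<or> L l \<noteq> 0)"
      unfolding S by (rule interval_like_Un[OF c0 c2, of k]) (use S0k S2k in auto)
    \<comment> \<open>Only indices up to the first difference count. That difference comes at
      \<open>k\<close> at the latest, and below \<open>k\<close> nothing has been divided
      out.\<close>
    have gap: "gap_pair (K l) (L l)" if l: "l < N" and h: "(\<forall>i<s. K i = L i) \<or> (\<forall>i\<le>l. K i = L i)" for l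
    proof -
      have 1: "\<forall>i\<le>l. K i = L i" using h neq eq_iff by blast
      have "l < k"
      proof (rule ccontr)
        assume "\<not> l < k"
        then have "K k = L k" "K (k - 1) = L (k - 1)" using 1 by auto
        then show False using x2 eq_iff A by auto
      qed
      then have "\<forall>i\<le>l. K2 i = L2 i" using 1 eq_iff A by auto
      then have "gap_pair (K2 l) (L2 l)" using gap2 l by blast
      then have "gap_pair (K0 l + K2 l) (L0 l + L2 l)"
        by (rule gap_pair_add[OF gap0[OF l] _ nn(1) nn(2) nn(3) nn(4)])
      then show ?thesis using \<open>l < k\<close> by (simp add: Kl)
    qed
    have np: "\<not> (\<forall>l<N. K l = 0 \<and> L l = 0)" using S S0k kN by blast
    have "1 \<le> (\<Sum>i=1..N. (K i + L i) - (K2 i + L2 i))"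
    proof (rule sum_ge_1)
      show "0 \<le> K l + L l - (K2 l + L2 l)" if "l \<in> {1..N}" for l
        using two[of l] nn[of l] by (auto simp: Kl)
      show "s \<in> {1..N}" using s by auto
      show "1 \<le> K s + L s - (K2 s + L2 s)" using S0s nn[of s] by (auto simp: Kl)
    qed
    then have d: "(\<Sum>i=1..N. K2 i + L2 i) + 1 \<le> (\<Sum>i=1..N. K i + L i)"
      by (simp add: sum_subtractf)
    have "K i = 0 \<and> L i = 0" if "i \<notin> {1..N}" for i
      using out[OF that] that A kN s k by (auto simp: Kl)
    note outK = this
    have "good_pair N s K L"
    proof (rule good_pairI)
      show "3 \<le> K N + L N" if "\<forall>l<N. K l = 0 \<and> L l = 0" using np that by contradiction
    qed (fact nneg outK conn gap)+
    then show ?thesis using d neq eq_below_iff by blast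
  next
    case B
    have S0k: "?S0 k \<or> ?S0 (k - 1)"
      using ne B S0s by (auto simp: diff_exp_def split: if_splits)
    \<comment> \<open>The additional factors sit at indices where the generator is supported and has
      an entry at least 2, so they harm neither connectedness nor the gap condition.\<close>
    have mid: "?S0 j" if "s \<le> j" "j < k" for j
      using S0k interval_likeD[OF c0 S0s, of k j] interval_likeD[OF c0 S0s, of "k - 1" j] that by fastforce
    have Kl: "K l = K0 l + K2 l + of_bool (s \<le> l \<and> l < k)" "L l = L0 l + L2 l + of_bool (s \<le> l \<and> l < k)" for l
      using B by (auto simp: K L unit_exp_def)
    have nneg: "0 \<le> K l" "0 \<le> L l" for l
      using nn[of l] by (auto simp: Kl)
    have S: "(K l \<noteq> 0 \<or> L l \<noteq> 0) \<longleftrightarrow> (?S0 l \<or> ?S2 l)" for l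
      using mid[of l] nn[of l] by (auto simp: Kl)
    have conn: "interval_like (\<lambda>l. K l \<noteq> 0 \<or> L l \<noteq> 0)"
      unfolding S by (rule interval_like_Un[OF c0 c2, of k]) (use S0k S2k in auto)
    have gap: "gap_pair (K l) (L l)" if l: "l < N" and h: "(\<forall>i<s. K i = L i) \<or> (\<forall>i\<le>l. K i = L i)" for l
    proof -
      have "(\<forall>i<s. K2 i = L2 i) \<or> (\<forall>i\<le>l. K2 i = L2 i)"
      proof (cases "\<forall>i<s. K i = L i")
        case True
        then show ?thesis using eq_below_iff by simp
      next
        case False
        then have le: "\<forall>i\<le>l. K i = L i" using h by blast
        have "l < s"
        proof (rule ccontr)
          assume "\<not> l < s"
          then have "\<forall>i<s. K i = L i" using le by auto
          then show False using False by contradiction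
        qed
        then have "\<forall>i\<le>l. K2 i = L2 i" using le eq_iff by auto
        then show ?thesis ..
      qed
      then have "gap_pair (K2 l) (L2 l)" using gap2 l by blast
      then show ?thesis
        using gap0[OF l] mid[of l] nn[of l] by (auto simp: Kl gap_pair_def)
    qed
    have np: "\<not> (\<forall>l<N. K l = 0 \<and> L l = 0)" using S S0s B by (meson le_less_trans)
    have d2: "1 \<le> (\<Sum>i=1..N. (K i + L i) - (K2 i + L2 i))"
    proof (rule sum_ge_1)
      show "0 \<le> K l + L l - (K2 l + L2 l)" if "l \<in> {1..N}" for l
        using nn[of l] by (auto simp: Kl)
      show "s \<in> {1..N}" using s by auto
      show "1 \<le> K s + L s - (K2 s + L2 s)" using S0s nn[of s] by (auto simp: Kl)
    qed
    obtain j where j: "?S2 j" using S2k by blast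
    have d0: "1 \<le> (\<Sum>i=1..N. (K i + L i) - (K0 i + L0 i))"
    proof (rule sum_ge_1)
      show "0 \<le> K l + L l - (K0 l + L0 l)" if "l \<in> {1..N}" for l
        using nn[of l] by (auto simp: Kl)
      show "j \<in> {1..N}" using j out by blast
      show "1 \<le> K j + L j - (K0 j + L0 j)" using j nn[of j] by (auto simp: Kl)
    qed
    have d: "(\<Sum>i=1..N. K2 i + L2 i) + 1 \<le> (\<Sum>i=1..N. K i + L i)"
      "(\<Sum>i=1..N. K0 i + L0 i) + 1 \<le> (\<Sum>i=1..N. K i + L i)"
      using d0 d2 by (simp_all add: sum_subtractf)
    have "K i = 0 \<and> L i = 0" if "i \<notin> {1..N}" for i
      using out[OF that] that B s k by (auto simp: Kl)
    note outK = this
    have "good_pair N s K L"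
    proof (rule good_pairI)
      show "3 \<le> K N + L N" if "\<forall>l<N. K l = 0 \<and> L l = 0" using np that by contradiction
    qed (fact nneg outK conn gap)+
    then show ?thesis using d eq_below_iff by blast
  next
    case C
    have ne': "K0 N * L2 N - L0 N * K2 N \<noteq> 0"
      using ne C by (cases "N = s") (auto simp: diff_exp_def)
    \<comment> \<open>No row and no column of a nonzero determinant vanishes. By rows, both
      monomials contain \<open>\<beta>\<^sub>N\<close> or its conjugate; by columns, their product
      contains both, so that one power of each can be divided out.\<close>
    then have S0N: "?S0 N" and S2N: "?S2 N" and AC: "K0 N \<noteq> 0 \<or> K2 N \<noteq> 0" "L0 N \<noteq> 0 \<or> L2 N \<noteq> 0"
      by auto
    have mid: "?S0 j" if "s \<le> j" "j < N" for j
      using interval_likeD[OF c0 S0s S0N] that by auto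
    have Kl: "K l = K0 l + K2 l + of_bool (s \<le> l \<and> l < N) - of_bool (l = N)"
      "L l = L0 l + L2 l + of_bool (s \<le> l \<and> l < N) - of_bool (l = N)" for l
      using C s by (auto simp: K L unit_exp_def)
    have nneg: "0 \<le> K l" "0 \<le> L l" for l
      using AC nn[of l] by (auto simp: Kl)
    have S: "(K l \<noteq> 0 \<or> L l \<noteq> 0) \<longleftrightarrow> (?S0 l \<or> ?S2 l)" if "l \<noteq> N" for l
      using mid[of l] nn[of l] that by (auto simp: Kl)
    have un: "interval_like (\<lambda>l. ?S0 l \<or> ?S2 l)"
      by (rule interval_like_Un[OF c0 c2, of k]) (use S0N S2N C in auto)
    \<comment> \<open>\<open>N\<close> may drop out of the support, but being the last index it
      leaves no hole.\<close>
    have conn: "interval_like (\<lambda>l. K l \<noteq> 0 \<or> L l \<noteq> 0)"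
      unfolding interval_like_def
    proof (intro allI impI)
      fix i j l assume ij: "i \<le> j" "j \<le> l" and i: "K i \<noteq> 0 \<or> L i \<noteq> 0" and l: "K l \<noteq> 0 \<or> L l \<noteq> 0"
      have "l \<le> N"
      proof (rule ccontr)
        assume "\<not> l \<le> N"
        then show False using l out[of l] by (simp add: Kl)
      qed
      show "K j \<noteq> 0 \<or> L j \<noteq> 0"
      proof (cases "j = l")
        case False
        then have jN: "j \<noteq> N" "i \<noteq> N" using ij \<open>l \<le> N\<close> by auto
        have "?S0 l \<or> ?S2 l" using S[of l] l S0N by (cases "l = N") auto
        moreover have "?S0 i \<or> ?S2 i" using S[of i] i jN by auto
        ultimately have "?S0 j \<or> ?S2 j" using interval_likeD[OF un _ _ ij] by blast
        then show ?thesis using S[of j] jN by auto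
      qed (use l in auto)
    qed
    have gap: "gap_pair (K l) (L l)" if l: "l < N" and h: "(\<forall>i<s. K i = L i) \<or> (\<forall>i\<le>l. K i = L i)" for l
    proof -
      have "(\<forall>i<s. K2 i = L2 i) \<or> (\<forall>i\<le>l. K2 i = L2 i)"
      proof (cases "\<forall>i<s. K i = L i")
        case True
        then show ?thesis using eq_below_iff by simp
      next
        case False
        then have le: "\<forall>i\<le>l. K i = L i" using h by blast
        have "l < s"
        proof (rule ccontr)
          assume "\<not> l < s"
          then have "\<forall>i<s. K i = L i" using le by auto
          then show False using False by contradiction
        qed
        then have "\<forall>i\<le>l. K2 i = L2 i" using le eq_iff by auto
        then show ?thesis ..
      qed
      then have "gap_pair (K2 l) (L2 l)" using gap2 l by blast
      then show ?thesis
        using gap0[OF l] mid[of l] nn[of l] l by (auto simp: Kl gap_pair_def)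
    qed
    \<comment> \<open>Two pure factors of degree at least 3 lose two powers, which leaves degree at
      least 4.\<close>
    have pure: "3 \<le> K N + L N" if "\<forall>l<N. K l = 0 \<and> L l = 0"
    proof -
      have "?S0 l \<or> ?S2 l \<Longrightarrow> False" if "l < N" for l
        using S[of l] that \<open>\<forall>l<N. K l = 0 \<and> L l = 0\<close> by auto
      then have "3 \<le> K0 N + L0 N" "3 \<le> K2 N + L2 N" using pure0 pure2 by blast+
      then show ?thesis by (simp add: Kl)
    qed
    \<comment> \<open>A pure generator contributes its degree minus 2. Any other one has an entry at
      least 2 at some \<open>j < N\<close>, against a net loss of at most one at
      \<open>N\<close>.\<close>
    have d2: "1 \<le> (\<Sum>i=1..N. (K i + L i) - (K2 i + L2 i))"
    proof (cases "\<forall>l<N. K0 l = 0 \<and> L0 l = 0")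
      case True
      show ?thesis
      proof (rule sum_ge_1)
        show "0 \<le> K l + L l - (K2 l + L2 l)" if "l \<in> {1..N}" for l
          using nn[of l] pure0[OF True] by (auto simp: Kl)
        show "N \<in> {1..N}" using N by auto
        show "1 \<le> K N + L N - (K2 N + L2 N)" using pure0[OF True] by (auto simp: Kl)
      qed
    next
      case False
      then obtain j where j: "j < N" "?S0 j" by auto
      then have j1: "1 \<le> j" using out(1,2)[of j] by force
      show ?thesis
      proof (rule sum_ge_1')
        show "0 \<le> K l + L l - (K2 l + L2 l)" if "l \<in> {1..<N}" for l
          using nn[of l] that by (auto simp: Kl)
        show "j \<in> {1..<N}" using j j1 by auto
        show "2 \<le> K j + L j - (K2 j + L2 j)"
          using j nn[of j] gap0[of j] by (auto simp: Kl gap_pair_def)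
        show "-1 \<le> K N + L N - (K2 N + L2 N)" using S0N nn[of N] by (auto simp: Kl)
      qed
    qed
    \<comment> \<open>The same count with the roles exchanged. The gap condition of the second
      factor at \<open>j\<close> is available when its exponents agree below
      \<open>s\<close>.\<close>
    have d0: "1 \<le> (\<Sum>i=1..N. (K i + L i) - (K0 i + L0 i))" if e2: "\<forall>i<s. K2 i = L2 i"
    proof (cases "\<forall>l<N. K2 l = 0 \<and> L2 l = 0")
      case True
      show ?thesis
      proof (rule sum_ge_1)
        show "0 \<le> K l + L l - (K0 l + L0 l)" if "l \<in> {1..N}" for l
          using nn[of l] pure2[OF True] by (auto simp: Kl)
        show "N \<in> {1..N}" using N by auto
        show "1 \<le> K N + L N - (K0 N + L0 N)" using pure2[OF True] by (auto simp: Kl)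
      qed
    next
      case False
      then obtain j where j: "j < N" "?S2 j" by auto
      then have j1: "1 \<le> j" using out(3,4)[of j] by force
      show ?thesis
      proof (rule sum_ge_1')
        show "0 \<le> K l + L l - (K0 l + L0 l)" if "l \<in> {1..<N}" for l
          using nn[of l] that by (auto simp: Kl)
        show "j \<in> {1..<N}" using j j1 by auto
        show "2 \<le> K j + L j - (K0 j + L0 j)"
          using j nn[of j] gap2[of j] e2 by (auto simp: Kl gap_pair_def)
        show "-1 \<le> K N + L N - (K0 N + L0 N)" using S2N nn[of N] by (auto simp: Kl)
      qed
    qed
    have d: "(\<Sum>i=1..N. K2 i + L2 i) + 1 \<le> (\<Sum>i=1..N. K i + L i)"
      using d2 by (simp add: sum_subtractf)
    have d': "(\<Sum>i=1..N. K0 i + L0 i) + 1 \<le> (\<Sum>i=1..N. K i + L i)" if "\<forall>i<s. K2 i = L2 i"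
      using d0[OF that] by (simp add: sum_subtractf)
    have "K i = 0 \<and> L i = 0" if "i \<notin> {1..N}" for i
      using out[OF that] that s k N by (auto simp: Kl)
    note outK = this
    have "good_pair N s K L"
      by (rule good_pairI) (fact nneg outK conn gap pure)+
    then show ?thesis using d d' eq_below_iff by blast
  qed
qed

text \<open>Treats what the bracket with \<open>h0\<close> produces besides the removed term. For k
  > s the frequency of \<open>\<alpha>\<^sub>k\<close> is slower than that of
  \<open>\<alpha>\<^sub>s\<close>, so this part keeps the squared modulus of
  \<open>\<alpha>\<^sub>s\<close> over that of \<open>\<alpha>\<^sub>k\<close> (for k = N the
  numerator alone) as a factor of positive degree.\<close>

lemma good_pair_shift:
  assumes s: "1 \<le> s" "s < k" "k \<le> N"
    and g0: "good_pair N s K0 L0" "\<forall>i<s. K0 i = L0 i" "K0 s \<noteq> L0 s"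
    and K: "\<And>l. K l = K0 l + of_bool (s \<le> l \<and> l < k)"
    and L: "\<And>l. L l = L0 l + of_bool (s \<le> l \<and> l < k)"
    and ne: "diff_exp N K0 k \<noteq> diff_exp N L0 k"
  shows "good_pair N s K L \<and> (\<forall>i<s. K i = L i) \<and>
    (\<Sum>i=1..N. K0 i + L0 i) + 1 \<le> (\<Sum>i=1..N. K i + L i)"
proof -
  let ?S0 = "\<lambda>i. K0 i \<noteq> 0 \<or> L0 i \<noteq> 0"
  have nn: "0 \<le> K0 i" "0 \<le> L0 i" for i
    using g0(1) by (auto simp: good_pair_def)
  have out: "K0 i = 0" "L0 i = 0" if "i \<notin> {1..N}" for i
    using g0(1) that by (auto simp: good_pair_def)
  have c0: "interval_like ?S0" using g0(1) by (auto simp: good_pair_def)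
  have gap0: "gap_pair (K0 l) (L0 l)" if "l < N" for l
    using g0(1,2) that by (auto simp: good_pair_def)
  have S0s: "?S0 s" using g0(3) by auto
  have S0k: "?S0 k \<or> ?S0 (k - 1)"
    using ne s by (auto simp: diff_exp_def split: if_splits)
  have mid: "?S0 j" if "s \<le> j" "j < k" for j
    using S0k interval_likeD[OF c0 S0s, of k j] interval_likeD[OF c0 S0s, of "k - 1" j] that by fastforce
  have S: "(K l \<noteq> 0 \<or> L l \<noteq> 0) \<longleftrightarrow> ?S0 l" for l
    using mid[of l] nn[of l] by (auto simp: K L)
  have conn: "interval_like (\<lambda>l. K l \<noteq> 0 \<or> L l \<noteq> 0)" unfolding S by (rule c0)
  have gap: "gap_pair (K l) (L l)" if l: "l < N" for l
    using gap0[OF l] mid[of l] nn[of l] by (auto simp: K L gap_pair_def)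
  have np: "\<not> (\<forall>l<N. K l = 0 \<and> L l = 0)" using S S0s s by (meson less_le_trans)
  have d0: "1 \<le> (\<Sum>i=1..N. (K i + L i) - (K0 i + L0 i))"
    by (rule sum_ge_1[of N _ s]) (use s in \<open>auto simp: K L\<close>)
  have "K i = 0 \<and> L i = 0" if "i \<notin> {1..N}" for i
    using out[OF that] that s by (auto simp: K L)
  note outK = this
  have nneg: "0 \<le> K i" "0 \<le> L i" for i using nn[of i] by (auto simp: K L)
  have "good_pair N s K L"
  proof (rule good_pairI)
    show "3 \<le> K N + L N" if "\<forall>l<N. K l = 0 \<and> L l = 0" using np that by contradiction
    show "gap_pair (K l) (L l)" if "l < N" for l by (rule gap[OF that])
  qed (fact nneg outK conn)+
  moreover have "\<forall>i<s. K i = L i" using g0(2) by (auto simp: K L)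
  ultimately show ?thesis using d0 by (simp add: sum_subtractf)
qed

section \<open>From exponents in \<beta> back to monomials in \<alpha>\<close>

text \<open>Applied to both exponent vectors this multiplies by the squared modulus of
  \<open>\<alpha>\<^sub>k\<close>, up to a constant the inverse of the k-th frequency of
  \<open>h0\<close>. The last frequency is constant, hence no shift at \<open>N\<close>.\<close>

definition raise_exp :: "nat \<Rightarrow> nat \<Rightarrow> (nat \<Rightarrow> int) \<Rightarrow> nat \<Rightarrow> int" where
  "raise_exp N k P = (if k < N then P(k := P k + 1) else P)"

definition lower_exp :: "nat \<Rightarrow> nat \<Rightarrow> (nat \<Rightarrow> int) \<Rightarrow> nat \<Rightarrow> int" where
  "lower_exp N k P = (if k < N then P(k := P k - 1) else P)"

lemma lower_raise_exp [simp]: "lower_exp N k (raise_exp N k P) = P" "raise_exp N k (lower_exp N k P) = P"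
  by (auto simp: lower_exp_def raise_exp_def)

definition eq_below :: "nat \<Rightarrow> nat \<Rightarrow> (nat \<Rightarrow> int) \<Rightarrow> (nat \<Rightarrow> int) \<Rightarrow> bool" where
  "eq_below N s P Q \<longleftrightarrow> (\<forall>i<s. beta_exp N P i = beta_exp N Q i)"

definition first_diff :: "nat \<Rightarrow> nat \<Rightarrow> (nat \<Rightarrow> int) \<Rightarrow> (nat \<Rightarrow> int) \<Rightarrow> bool" where
  "first_diff N s P Q \<longleftrightarrow> eq_below N s P Q \<and> beta_exp N P s \<noteq> beta_exp N Q s"

definition good_exponent :: "nat \<Rightarrow> nat \<Rightarrow> (nat \<Rightarrow> int) \<Rightarrow> (nat \<Rightarrow> int) \<Rightarrow> bool" where
  "good_exponent N s P Q \<longleftrightarrow>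
    (\<forall>i. i \<notin> {1..N} \<longrightarrow> P i = 0 \<and> Q i = 0) \<and> good_pair N s (beta_exp N P) (beta_exp N Q)"

lemma good_exponent_admissible:
  "good_exponent N s P Q \<Longrightarrow> admissible N P \<and> admissible N Q"
  by (simp add: good_exponent_def admissible_def good_pair_def)

lemma total_degree_nonneg: "good_exponent N s P Q \<Longrightarrow> 0 \<le> total_degree N P Q"
  by (auto simp: good_exponent_def good_pair_def total_degree_def intro!: sum_nonneg)

lemma exponent_diff_exp:
  assumes "1 \<le> k" "k \<le> N"
  shows "P k = diff_exp N (beta_exp N P) k"
  using exponent_eq_beta_exp[OF assms, of P] assms by (auto simp: diff_exp_def)

lemma beta_exp_delta:
  assumes "1 \<le> k" "k \<le> N"
  shows "beta_exp N (\<lambda>i. if i = k then 1 else 0) l = unit_exp N k l"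
  using assms by (auto simp: beta_exp_def unit_exp_def)

lemma beta_exp_add: "beta_exp N (\<lambda>i. P i + Q i) l = beta_exp N P l + beta_exp N Q l"
  by (simp add: beta_exp_def sum.distrib)

lemma beta_exp_diff: "beta_exp N (\<lambda>i. P i - Q i) l = beta_exp N P l - beta_exp N Q l"
  by (simp add: beta_exp_def sum_subtractf)

lemma beta_exp_raise:
  assumes "1 \<le> k" "k \<le> N"
  shows "beta_exp N (raise_exp N k P) l = beta_exp N P l + (if k < N then unit_exp N k l else 0)"
proof (cases "k < N")
  case True
  have "raise_exp N k P = (\<lambda>i. P i + (if i = k then 1 else 0))"
    using True by (auto simp: raise_exp_def)
  then show ?thesis using True by (simp add: beta_exp_add beta_exp_delta[OF assms])
qed (simp add: raise_exp_def)

text \<open>For \<open>s < N\<close> the prefix sums agree up to \<open>s - 1\<close> and differ at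
  \<open>s\<close>. The difference is the divisor of the homological equation at stage
  \<open>s\<close>: a nonzero integer, so small divisors cannot occur.\<close>

lemma first_diff_exponent:
  assumes "first_diff N s P Q" "1 \<le> s" "s \<le> N"
  shows "P s \<noteq> Q s"
proof -
  have "beta_exp N P (s - 1) = beta_exp N Q (s - 1)"
    using assms by (auto simp: first_diff_def eq_below_def)
  then show ?thesis
    using assms unfolding exponent_diff_exp[OF assms(2,3), of P] exponent_diff_exp[OF assms(2,3), of Q]
    by (auto simp: first_diff_def diff_exp_def)
qed

text \<open>Up to the shift \<open>raise_exp\<close>, the k-th part of the bracket with
  \<open>h0\<close> acts diagonally on monomials; its eigenvalues are this weight times the
  difference of the exponents of \<open>\<alpha>\<^sub>k\<close> and its conjugate.\<close>

definition homological_weight :: "(nat \<Rightarrow> real) \<Rightarrow> nat \<Rightarrow> real \<Rightarrow> nat \<Rightarrow> complex" where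
  "homological_weight a N \<omega> k =
    bracket_weight a N k * (if k < N then fst (h0_series a N \<omega>) k else - of_real \<omega>)"

lemma poisson_bracket_h0:
  assumes A: "finite {(P, Q). g P Q \<noteq> 0}" and N: "2 \<le> N"
  shows "poisson_bracket a N (of_laurent g) (add_laurent (h0_series a N \<omega>) R) P Q =
    (\<Sum>k=1..N. homological_weight a N \<omega> k * of_int (P k - Q k) * g (raise_exp N k P) (raise_exp N k Q)) +
    poisson_bracket a N (of_laurent g) (of_laurent R) P Q"
proof -
  let ?A = "{(P, Q). g P Q \<noteq> 0}"
  let ?f = "snd (h0_series a N \<omega>)"
  note eq = poisson_bracket_eq[OF A subset_refl]
  have e: "P1 = P" if "cofactor N P P1 = (\<lambda>_. 0)(N := 1)" for P P1 :: "nat \<Rightarrow> int"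
  proof
    fix i show "P1 i = P i" using fun_cong[OF that, of i] by (auto simp: cofactor_def split: if_splits)
  qed
  have s: "(\<Sum>(P1, Q1)\<in>?A. g P1 Q1 * (?f (cofactor k P P1) (cofactor k Q Q1) + R (cofactor k P P1) (cofactor k Q Q1)) *
          of_int (P1 k * cofactor k Q Q1 k - Q1 k * cofactor k P P1 k)) =
     (if k = N then - of_real \<omega> * of_int (P k - Q k) * g P Q else 0) +
     (\<Sum>(P1, Q1)\<in>?A. g P1 Q1 * R (cofactor k P P1) (cofactor k Q Q1) *
          of_int (P1 k * cofactor k Q Q1 k - Q1 k * cofactor k P P1 k))" (is "?l = _ + ?r") for k
  proof -
    have "?l = (\<Sum>x\<in>?A. (if x = (P, Q) then (if k = N then - of_real \<omega> * of_int (P k - Q k) * g P Q else 0) else 0) +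
      (case x of (P1, Q1) \<Rightarrow> g P1 Q1 * R (cofactor k P P1) (cofactor k Q Q1) *
          of_int (P1 k * cofactor k Q Q1 k - Q1 k * cofactor k P P1 k)))"
    proof (rule sum.cong[OF refl], unfold split_paired_all prod.case)
      fix P1 Q1
      have "g P1 Q1 * ?f (cofactor k P P1) (cofactor k Q Q1) *
          of_int (P1 k * cofactor k Q Q1 k - Q1 k * cofactor k P P1 k) =
          (if (P1, Q1) = (P, Q) then (if k = N then - of_real \<omega> * of_int (P k - Q k) * g P Q else 0) else 0)"
      proof (cases "cofactor k P P1 = (\<lambda>_. 0)(N := 1) \<and> cofactor k Q Q1 = (\<lambda>_. 0)(N := 1)")
        case True
        show ?thesis
        proof (cases "k = N")
          case True': True
          then show ?thesis using True e[of P P1] e[of Q Q1] by (auto simp: h0_series_def)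
        next
          case False
          \<comment> \<open>The only monomial of \<open>h0\<close> does not contain
            \<open>\<alpha>\<^sub>k\<close>, so the determinant of exponents vanishes.\<close>
          then have "cofactor k P P1 k = 0" "cofactor k Q Q1 k = 0" using True by auto
          then show ?thesis using False by simp
        qed
      next
        case False
        moreover have "\<not> (k = N \<and> P1 = P \<and> Q1 = Q)"
        proof
          assume "k = N \<and> P1 = P \<and> Q1 = Q"
          then have "cofactor k P P1 = (\<lambda>_. 0)(N := 1) \<and> cofactor k Q Q1 = (\<lambda>_. 0)(N := 1)"
            by (auto simp: cofactor_def)
          then show False using False by blast
        qed
        ultimately show ?thesis by (auto simp: h0_series_def)
      qed
      then show "g P1 Q1 * (?f (cofactor k P P1) (cofactor k Q Q1) + R (cofactor k P P1) (cofactor k Q Q1)) *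
          of_int (P1 k * cofactor k Q Q1 k - Q1 k * cofactor k P P1 k) =
        (if (P1, Q1) = (P, Q) then (if k = N then - of_real \<omega> * of_int (P k - Q k) * g P Q else 0) else 0) +
        g P1 Q1 * R (cofactor k P P1) (cofactor k Q Q1) *
          of_int (P1 k * cofactor k Q Q1 k - Q1 k * cofactor k P P1 k)"
        by (simp add: distrib_left distrib_right)
    qed
    also have "\<dots> = (if k = N then - of_real \<omega> * of_int (P k - Q k) * g P Q else 0) + ?r"
      using A by (simp add: sum.distrib sum.delta)
    finally show ?thesis .
  qed
  have "poisson_bracket a N (of_laurent g) (add_laurent (h0_series a N \<omega>) R) P Q =
    (\<Sum>k=1..N. bracket_weight a N k *
      (fst (h0_series a N \<omega>) k * of_int (P k - Q k) * g (P(k := P k + 1)) (Q(k := Q k + 1)) +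
       (if k = N then - of_real \<omega> * of_int (P k - Q k) * g P Q else 0))) +
    (\<Sum>k=1..N. bracket_weight a N k * (\<Sum>(P1, Q1)\<in>?A. g P1 Q1 * R (cofactor k P P1) (cofactor k Q Q1) *
          of_int (P1 k * cofactor k Q Q1 k - Q1 k * cofactor k P P1 k)))"
    unfolding add_laurent_def eq s by (simp add: sum.distrib distrib_left add.assoc)
  also have "(\<Sum>k=1..N. bracket_weight a N k * (\<Sum>(P1, Q1)\<in>?A. g P1 Q1 * R (cofactor k P P1) (cofactor k Q Q1) *
          of_int (P1 k * cofactor k Q Q1 k - Q1 k * cofactor k P P1 k))) =
     poisson_bracket a N (of_laurent g) (of_laurent R) P Q"
    unfolding of_laurent_def[of R] eq by simp
  also have "(\<Sum>k=1..N. bracket_weight a N k *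
      (fst (h0_series a N \<omega>) k * of_int (P k - Q k) * g (P(k := P k + 1)) (Q(k := Q k + 1)) +
       (if k = N then - of_real \<omega> * of_int (P k - Q k) * g P Q else 0))) =
     (\<Sum>k=1..N. homological_weight a N \<omega> k * of_int (P k - Q k) * g (raise_exp N k P) (raise_exp N k Q))"
    using N by (intro sum.cong) (auto simp: homological_weight_def raise_exp_def h0_series_def)
  finally show ?thesis .
qed

lemma poisson_bracket_support:
  assumes A: "finite {(P, Q). g P Q \<noteq> 0}"
    and ne: "poisson_bracket a N (of_laurent g) (of_laurent f) P Q \<noteq> 0"
  obtains k P1 Q1 P2 Q2 where "1 \<le> k" "k \<le> N" "g P1 Q1 \<noteq> 0" "f P2 Q2 \<noteq> 0"
    "P = (\<lambda>i. P1 i + P2 i - (if i = k then 1 else 0))" "Q = (\<lambda>i. Q1 i + Q2 i - (if i = k then 1 else 0))"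
    "P1 k * Q2 k - Q1 k * P2 k \<noteq> 0"
proof -
  let ?A = "{(P, Q). g P Q \<noteq> 0}"
  note eq = poisson_bracket_eq[OF A subset_refl]
  define T where "T k x = (case x of (P1, Q1) \<Rightarrow> g P1 Q1 * f (cofactor k P P1) (cofactor k Q Q1) *
          of_int (P1 k * cofactor k Q Q1 k - Q1 k * cofactor k P P1 k))" for k x
  have "(\<Sum>k=1..N. bracket_weight a N k * sum (T k) ?A) \<noteq> 0"
    using ne unfolding of_laurent_def[of f] eq T_def by simp
  then obtain k where k: "k \<in> {1..N}" and "bracket_weight a N k * sum (T k) ?A \<noteq> 0"
    by (rule sum.not_neutral_contains_not_neutral)
  then have "sum (T k) ?A \<noteq> 0" by simp
  then obtain x where "x \<in> ?A" "T k x \<noteq> 0"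
    by (rule sum.not_neutral_contains_not_neutral)
  then obtain P1 Q1 where "T k (P1, Q1) \<noteq> 0" by (cases x) auto
  then have PQ: "g P1 Q1 \<noteq> 0" "f (cofactor k P P1) (cofactor k Q Q1) \<noteq> 0"
    "of_int (P1 k * cofactor k Q Q1 k - Q1 k * cofactor k P P1 k) \<noteq> (0::complex)"
    unfolding T_def by auto
  show ?thesis
  proof (rule that[of k P1 Q1 "cofactor k P P1" "cofactor k Q Q1"])
    show "P1 k * cofactor k Q Q1 k - Q1 k * cofactor k P P1 k \<noteq> 0"
      using PQ(3) by (metis of_int_0)
  qed (use k PQ in \<open>auto simp: cofactor_def\<close>)
qed

text \<open>The combinatorial estimate for whole series. The generator is indexed by the monomials
  that it removes; \<open>lower_exp\<close> strips off the additional factor.\<close>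

lemma bracket_good_exponent:
  assumes N: "2 \<le> N" and s: "1 \<le> s" "s \<le> N"
    and g: "finite {(P, Q). g P Q \<noteq> 0}"
      "\<forall>P Q. g (raise_exp N s P) (raise_exp N s Q) \<noteq> 0 \<longrightarrow>
        good_exponent N s P Q \<and> first_diff N s P Q \<and> total_degree N P Q = d"
    and f: "\<forall>P Q. f P Q \<noteq> 0 \<longrightarrow> good_exponent N s P Q"
    and ne: "poisson_bracket a N (of_laurent g) (of_laurent f) P Q \<noteq> 0"
  obtains P2 Q2 where "f P2 Q2 \<noteq> 0" "good_exponent N s P Q"
    "eq_below N s P Q \<longleftrightarrow> eq_below N s P2 Q2"
    "total_degree N P2 Q2 + 1 \<le> total_degree N P Q"
    "eq_below N s P2 Q2 \<Longrightarrow> d + 1 \<le> total_degree N P Q"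
proof -
  obtain k P1 Q1 P2 Q2 where k: "1 \<le> k" "k \<le> N" and g1: "g P1 Q1 \<noteq> 0" and f2: "f P2 Q2 \<noteq> 0"
    and PQ: "P = (\<lambda>i. P1 i + P2 i - (if i = k then 1 else 0))" "Q = (\<lambda>i. Q1 i + Q2 i - (if i = k then 1 else 0))"
    and ne': "P1 k * Q2 k - Q1 k * P2 k \<noteq> 0"
    by (rule poisson_bracket_support[OF g(1) ne])
  define P0 Q0 where "P0 = lower_exp N s P1" and "Q0 = lower_exp N s Q1"
  have PQ1: "P1 = raise_exp N s P0" "Q1 = raise_exp N s Q0" by (simp_all add: P0_def Q0_def)
  have g0: "good_exponent N s P0 Q0" "first_diff N s P0 Q0" "total_degree N P0 Q0 = d"
    using g(2)[rule_format, of P0 Q0] g1 PQ1 by auto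
  have K: "beta_exp N P l = beta_exp N P0 l + beta_exp N P2 l + (if s < N then unit_exp N s l else 0) - unit_exp N k l"
    and L: "beta_exp N Q l = beta_exp N Q0 l + beta_exp N Q2 l + (if s < N then unit_exp N s l else 0) - unit_exp N k l" for l
    unfolding PQ beta_exp_diff beta_exp_add beta_exp_delta[OF k] PQ1 beta_exp_raise[OF s] by auto
  have dP: "P1 k = diff_exp N (beta_exp N P0) k + of_bool (k = s \<and> s < N)"
    "Q1 k = diff_exp N (beta_exp N Q0) k + of_bool (k = s \<and> s < N)"
    unfolding PQ1 exponent_diff_exp[OF k, symmetric] by (auto simp: raise_exp_def)
  have "good_pair N s (beta_exp N P) (beta_exp N Q) \<and>
    ((\<forall>i<s. beta_exp N P i = beta_exp N Q i) \<longleftrightarrow> (\<forall>i<s. beta_exp N P2 i = beta_exp N Q2 i)) \<and>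
    (\<Sum>i=1..N. beta_exp N P2 i + beta_exp N Q2 i) + 1 \<le> (\<Sum>i=1..N. beta_exp N P i + beta_exp N Q i) \<and>
    ((\<forall>i<s. beta_exp N P2 i = beta_exp N Q2 i) \<longrightarrow>
      (\<Sum>i=1..N. beta_exp N P0 i + beta_exp N Q0 i) + 1 \<le> (\<Sum>i=1..N. beta_exp N P i + beta_exp N Q i))"
    by (rule good_pair_bracket[OF N s k _ _ _ _ K L])
      (use g0 f[rule_format, OF f2] ne' in \<open>auto simp: dP good_exponent_def first_diff_def eq_below_def
        exponent_diff_exp[OF k, symmetric]\<close>)
  moreover have "\<forall>i. i \<notin> {1..N} \<longrightarrow> P i = 0 \<and> Q i = 0"
    using g0(1) f[rule_format, OF f2] k s by (auto simp: PQ PQ1 raise_exp_def good_exponent_def)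
  ultimately show ?thesis
    using g0(3) by (intro that[OF f2]) (auto simp: good_exponent_def eq_below_def total_degree_def)
qed

section \<open>Normalisation\<close>

lemma bracket_weight_nz:
  assumes "2 \<le> N" "\<And>k. k \<in> {1..N} \<Longrightarrow> a k \<noteq> 0" "\<And>k. k \<in> {1..N} \<Longrightarrow> partial_strength a k \<noteq> 0" "k \<in> {1..N}"
  shows "bracket_weight a N k \<noteq> 0"
proof -
  have "k mod N + 1 \<in> {1..N}"
    using assms(1,4) by (auto simp: Suc_le_eq)
  then show ?thesis using assms by (simp add: bracket_weight_def kappa_def)
qed

lemma homological_weight_nz:
  assumes "2 \<le> N" "\<And>k. k \<in> {1..N} \<Longrightarrow> a k \<noteq> 0" "\<And>k. k \<in> {1..N} \<Longrightarrow> partial_strength a k \<noteq> 0" "k \<in> {1..N}" "0 < \<omega>"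
  shows "homological_weight a N \<omega> k \<noteq> 0"
  using bracket_weight_nz[OF assms(1-4)] assms by (auto simp: homological_weight_def h0_series_def)

lemma homological_good_exponent:
  assumes s: "1 \<le> s" "s \<le> N"
    and g: "\<forall>P Q. g (raise_exp N s P) (raise_exp N s Q) \<noteq> 0 \<longrightarrow>
        good_exponent N s P Q \<and> first_diff N s P Q \<and> total_degree N P Q = d"
    and k: "1 \<le> k" "k \<le> N" "k \<noteq> s"
    and ne: "P k \<noteq> Q k" "g (raise_exp N k P) (raise_exp N k Q) \<noteq> 0"
  shows "good_exponent N s P Q \<and> eq_below N s P Q \<and> d + 1 \<le> total_degree N P Q"
proof -
  define P0 Q0 where "P0 = lower_exp N s (raise_exp N k P)" and "Q0 = lower_exp N s (raise_exp N k Q)"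
  have PQ0: "raise_exp N s P0 = raise_exp N k P" "raise_exp N s Q0 = raise_exp N k Q"
    by (simp_all add: P0_def Q0_def)
  have g0: "good_exponent N s P0 Q0" "first_diff N s P0 Q0" "total_degree N P0 Q0 = d"
    using g[rule_format, of P0 Q0] ne(2) PQ0 by auto
  have dk: "P0 k \<noteq> Q0 k"
    using fun_cong[OF PQ0(1), of k] fun_cong[OF PQ0(2), of k] k ne(1)
    by (auto simp: raise_exp_def split: if_splits)
  have ne0: "diff_exp N (beta_exp N P0) k \<noteq> diff_exp N (beta_exp N Q0) k"
    using dk unfolding exponent_diff_exp[OF k(1,2), of P0] exponent_diff_exp[OF k(1,2), of Q0] .
  \<comment> \<open>For \<open>k < s\<close> the exponents of \<open>\<alpha>\<^sub>k\<close> and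
    its conjugate agree, so the faster frequencies do not act on the generator.\<close>
  have sk: "s < k"
  proof (rule ccontr)
    assume "\<not> s < k"
    then have "k < s" using k by simp
    then show False
      using ne0 g0(2) s by (auto simp: diff_exp_def first_diff_def eq_below_def)
  qed
  have K: "beta_exp N P l = beta_exp N P0 l + of_bool (s \<le> l \<and> l < k)"
    and L: "beta_exp N Q l = beta_exp N Q0 l + of_bool (s \<le> l \<and> l < k)" for l
    using arg_cong[OF PQ0(1), of "\<lambda>P. beta_exp N P l"] arg_cong[OF PQ0(2), of "\<lambda>P. beta_exp N P l"] sk k
    unfolding beta_exp_raise[OF s] beta_exp_raise[OF k(1,2)]
    by (auto simp: unit_exp_def split: if_splits)
  have "good_pair N s (beta_exp N P) (beta_exp N Q) \<and> (\<forall>i<s. beta_exp N P i = beta_exp N Q i) \<and>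
    (\<Sum>i=1..N. beta_exp N P0 i + beta_exp N Q0 i) + 1 \<le> (\<Sum>i=1..N. beta_exp N P i + beta_exp N Q i)"
    by (rule good_pair_shift[OF s(1) sk k(2) _ _ _ K L ne0])
      (use g0 in \<open>auto simp: good_exponent_def first_diff_def eq_below_def\<close>)
  moreover have "P i = 0 \<and> Q i = 0" if "i \<notin> {1..N}" for i
    using g0(1) that fun_cong[OF PQ0(1), of i] fun_cong[OF PQ0(2), of i] k s
    by (auto simp: good_exponent_def raise_exp_def split: if_splits)
  ultimately show ?thesis using g0(3)
    by (auto simp: good_exponent_def eq_below_def total_degree_def)
qed

section \<open>Removal of nonresonant terms, stage by stage and degree by degree\<close>

text \<open>Loop invariant. The second clause records that all stages before \<open>s\<close> are
  finished up to degree \<open>n\<close>, the third that stage \<open>s\<close> is finished below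
  degree \<open>d\<close>.\<close>

definition stage_series :: "nat \<Rightarrow> nat \<Rightarrow> nat \<Rightarrow> int \<Rightarrow> laurent \<Rightarrow> bool" where
  "stage_series N n s d R \<longleftrightarrow> (\<forall>P Q. R P Q \<noteq> 0 \<longrightarrow> good_exponent N s P Q \<and>
     (\<not> eq_below N s P Q \<longrightarrow> int n < total_degree N P Q) \<and>
     (first_diff N s P Q \<longrightarrow> d \<le> total_degree N P Q))"

lemma exponents_finite:
  assumes "finite {(P, Q). g P Q \<noteq> 0}" "2 \<le> N"
  shows "finite (exponents N g)"
proof -
  let ?h = "\<lambda>(K, L). (alpha_exponent N K, alpha_exponent N L)"
  have "inj_on ?h (exponents N g)"
    by (intro inj_onI) (auto simp: exponents_def dest: alpha_exponent_inject[OF _ _ assms(2)])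
  moreover have "?h ` exponents N g \<subseteq> {(P, Q). g P Q \<noteq> 0}"
    by (auto simp: exponents_def beta_coeff_def)
  ultimately show ?thesis using assms(1) by (metis finite_imageD finite_subset)
qed

lemma Sum_any_nat_split:
  fixes h :: "nat \<Rightarrow> complex"
  assumes "finite {l. h (Suc l) \<noteq> 0}"
  shows "finite {l. h l \<noteq> 0}" "Sum_any h = h 0 + Sum_any (\<lambda>l. h (Suc l))"
proof -
  have sub: "{l. h l \<noteq> 0} \<subseteq> insert 0 (Suc ` {l. h (Suc l) \<noteq> 0})"
  proof
    fix l assume "l \<in> {l. h l \<noteq> 0}"
    then show "l \<in> insert 0 (Suc ` {l. h (Suc l) \<noteq> 0})" by (cases l) auto
  qed
  then show "finite {l. h l \<noteq> 0}" by (rule finite_subset) (use assms in auto)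
  have "Sum_any h = sum h (insert 0 (Suc ` {l. h (Suc l) \<noteq> 0}))"
    using assms sub by (intro Sum_any.expand_superset) auto
  also have "\<dots> = h 0 + sum h (Suc ` {l. h (Suc l) \<noteq> 0})"
    using assms by (subst sum.insert) auto
  also have "sum h (Suc ` {l. h (Suc l) \<noteq> 0}) = sum (\<lambda>l. h (Suc l)) {l. h (Suc l) \<noteq> 0}"
    by (subst sum.reindex) auto
  also have "\<dots> = Sum_any (\<lambda>l. h (Suc l))" by (simp add: Sum_any.expand_set)
  finally show "Sum_any h = h 0 + Sum_any (\<lambda>l. h (Suc l))" .
qed

lemma normalisation_step:
  assumes N: "2 \<le> N" and a: "\<And>k. k \<in> {1..N} \<Longrightarrow> a k \<noteq> 0"
    and A: "\<And>k. k \<in> {1..N} \<Longrightarrow> partial_strength a k \<noteq> 0" and \<omega>: "0 < \<omega>"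
    and s: "1 \<le> s" "s \<le> N" and R: "stage_series N n s d R"
  obtains g R' where
    "lie_transform a N g (add_laurent (h0_series a N \<omega>) R) (add_laurent (h0_series a N \<omega>) R')"
    "stage_series N n s (d + 1) R'"
proof -
  define F where "F = add_laurent (h0_series a N \<omega>) R"
  \<comment> \<open>A single degree is removed at a time, because the Lie transform may create new
    terms of this stage in degree \<open>d + 1\<close>.\<close>
  define target where "target P Q \<longleftrightarrow> first_diff N s P Q \<and> total_degree N P Q = d" for P Q
  \<comment> \<open>Solution of the homological equation for the frequency of
    \<open>\<alpha>\<^sub>s\<close> alone. The additional factor enters through
    \<open>lower_exp\<close>: the coefficient at a raised exponent is the one belonging to the
    target.\<close>
  define g :: laurent where "g = (\<lambda>P Q. let P0 = lower_exp N s P; Q0 = lower_exp N s Q in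
    if target P0 Q0 then - R P0 Q0 / (homological_weight a N \<omega> s * of_int (P0 s - Q0 s)) else 0)"
  have g_raise: "g (raise_exp N s P) (raise_exp N s Q) =
      (if target P Q then - R P Q / (homological_weight a N \<omega> s * of_int (P s - Q s)) else 0)" for P Q
    by (simp add: g_def)
  have R_good: "\<forall>P Q. R P Q \<noteq> 0 \<longrightarrow> good_exponent N s P Q"
    using R by (simp add: stage_series_def)
  have g_prop: "\<forall>P Q. g (raise_exp N s P) (raise_exp N s Q) \<noteq> 0 \<longrightarrow>
      good_exponent N s P Q \<and> first_diff N s P Q \<and> total_degree N P Q = d"
    unfolding g_raise using R_good by (auto simp: target_def)
  have g_fin: "finite {(P, Q). g P Q \<noteq> 0}"
  proof (rule finite_subset)
    let ?T = "{(P, Q). admissible N P \<and> admissible N Q \<and> total_degree N P Q \<le> int (nat d)}"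
    show "finite ((\<lambda>(P, Q). (raise_exp N s P, raise_exp N s Q)) ` ?T)"
      using finite_total_degree_le[OF N] by (rule finite_imageI)
    show "{(P, Q). g P Q \<noteq> 0} \<subseteq> (\<lambda>(P, Q). (raise_exp N s P, raise_exp N s Q)) ` ?T"
    proof (rule subrelI)
      fix P Q assume "(P, Q) \<in> {(P, Q). g P Q \<noteq> 0}"
      then have "g (raise_exp N s (lower_exp N s P)) (raise_exp N s (lower_exp N s Q)) \<noteq> 0" by simp
      from g_prop[rule_format, OF this] good_exponent_admissible
      have "(lower_exp N s P, lower_exp N s Q) \<in> ?T" by auto
      then show "(P, Q) \<in> (\<lambda>(P, Q). (raise_exp N s P, raise_exp N s Q)) ` ?T"
        by (rule rev_image_eqI) simp
    qed
  qed
  have g_series: "beta_series N g"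
    unfolding beta_series_iff[OF N]
  proof (intro allI impI)
    fix P Q assume "g P Q \<noteq> 0"
    then have "g (raise_exp N s (lower_exp N s P)) (raise_exp N s (lower_exp N s Q)) \<noteq> 0" by simp
    from g_prop[rule_format, OF this] have ge: "good_exponent N s (lower_exp N s P) (lower_exp N s Q)" by simp
    have "admissible N (raise_exp N s P0)" if "admissible N P0" for P0
      using that s unfolding admissible_def beta_exp_raise[OF s]
      by (auto simp: raise_exp_def unit_exp_def)
    from this[of "lower_exp N s P"] this[of "lower_exp N s Q"] good_exponent_admissible[OF ge]
    show "admissible N P \<and> admissible N Q" by simp
  qed
  have g_poly: "beta_polynomial N g"
    using g_series exponents_finite[OF g_fin N] by (simp add: beta_polynomial_def)
  \<comment> \<open>\<open>f l\<close> is the Lie derivative of order \<open>l + 1\<close>. After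
    one bracket the logarithms have disappeared, so the iteration can stay among Laurent
    series.\<close>
  define f where "f = rec_nat (poisson_bracket a N (of_laurent g) F)
    (\<lambda>_ h. poisson_bracket a N (of_laurent g) (of_laurent h))"
  have f_0: "f 0 = poisson_bracket a N (of_laurent g) F"
    and f_Suc: "f (Suc l) = poisson_bracket a N (of_laurent g) (of_laurent (f l))" for l
    by (simp_all add: f_def)
  have lie: "(lie_derivative a N g ^^ Suc l) F = of_laurent (f l)" for l
    by (induction l) (simp_all add: lie_derivative_def f_0 f_Suc)
  define H where "H P Q = (\<Sum>k=1..N. homological_weight a N \<omega> k * of_int (P k - Q k) *
      g (raise_exp N k P) (raise_exp N k Q))" for P Q
  have f_0_eq: "f 0 P Q = H P Q + poisson_bracket a N (of_laurent g) (of_laurent R) P Q" for P Q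
    unfolding f_0 F_def H_def by (rule poisson_bracket_h0[OF g_fin N])
  \<comment> \<open>Slower frequencies contribute to \<open>H\<close> only at exponents of the
    excluded kind, good ones of degree above \<open>d\<close>. Everywhere else \<open>H\<close> is
    the negative of the target.\<close>
  have H_eq: "H P Q = - (if target P Q then R P Q else 0)"
    if "\<not> (good_exponent N s P Q \<and> eq_below N s P Q \<and> d + 1 \<le> total_degree N P Q)" for P Q
  proof -
    have "H P Q = (\<Sum>k=1..N. if k = s then homological_weight a N \<omega> s * of_int (P s - Q s) *
      g (raise_exp N s P) (raise_exp N s Q) else 0)"
      unfolding H_def
    proof (rule sum.cong[OF refl])
      fix k assume k: "k \<in> {1..N}"
      show "homological_weight a N \<omega> k * of_int (P k - Q k) * g (raise_exp N k P) (raise_exp N k Q) =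
        (if k = s then homological_weight a N \<omega> s * of_int (P s - Q s) * g (raise_exp N s P) (raise_exp N s Q) else 0)"
      proof (cases "k = s")
        case False
        then have "P k = Q k \<or> g (raise_exp N k P) (raise_exp N k Q) = 0"
          using homological_good_exponent[OF s g_prop, where k = k and P = P and Q = Q] that k by auto
        then show ?thesis using False by auto
      qed simp
    qed
    also have "\<dots> = homological_weight a N \<omega> s * of_int (P s - Q s) * g (raise_exp N s P) (raise_exp N s Q)"
      using s by simp
    also have "\<dots> = - (if target P Q then R P Q else 0)"
    proof (cases "target P Q")
      case True
      then have "P s \<noteq> Q s" using first_diff_exponent s by (auto simp: target_def)
      moreover have "homological_weight a N \<omega> s \<noteq> 0"
        by (rule homological_weight_nz[OF N]) (use a A \<omega> s in auto)
      ultimately show ?thesis using True by (simp add: g_raise)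
    qed (simp add: g_raise)
    finally show ?thesis .
  qed
  note br = bracket_good_exponent[OF N s g_fin g_prop]
  \<comment> \<open>The bound of the degree by \<open>l\<close> makes each coefficient of the Lie
    series a finite sum.\<close>
  have f_prop: "good_exponent N s P Q \<and> (\<not> eq_below N s P Q \<longrightarrow> int n < total_degree N P Q) \<and>
      (eq_below N s P Q \<longrightarrow> d \<le> total_degree N P Q) \<and> int l \<le> total_degree N P Q"
    if "f l P Q \<noteq> 0" for l P Q
    using that
  proof (induction l arbitrary: P Q)
    case 0
    show ?case
    proof (cases "H P Q = 0")
      case True
      then have "poisson_bracket a N (of_laurent g) (of_laurent R) P Q \<noteq> 0"
        using 0 by (simp add: f_0_eq)
      from br[OF R_good this] obtain P2 Q2 where *: "R P2 Q2 \<noteq> 0" "good_exponent N s P Q"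
        "eq_below N s P Q \<longleftrightarrow> eq_below N s P2 Q2"
        "total_degree N P2 Q2 + 1 \<le> total_degree N P Q"
        "eq_below N s P2 Q2 \<Longrightarrow> d + 1 \<le> total_degree N P Q" by metis
      moreover have "\<not> eq_below N s P2 Q2 \<longrightarrow> int n < total_degree N P2 Q2"
        using R *(1) by (simp add: stage_series_def)
      ultimately show ?thesis
        using total_degree_nonneg[OF *(2)] by auto
    next
      case False
      have "good_exponent N s P Q \<and> eq_below N s P Q \<and> d \<le> total_degree N P Q"
      proof (rule ccontr)
        assume nh: "\<not> (good_exponent N s P Q \<and> eq_below N s P Q \<and> d \<le> total_degree N P Q)"
        then have "H P Q = - (if target P Q then R P Q else 0)" by (intro H_eq) auto
        then have "target P Q" "R P Q \<noteq> 0" using False by (auto split: if_splits)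
        then show False
          using nh R_good by (auto simp: target_def first_diff_def)
      qed
      then show ?thesis using total_degree_nonneg by auto
    qed
  next
    case (Suc l)
    have "\<forall>P Q. f l P Q \<noteq> 0 \<longrightarrow> good_exponent N s P Q" using Suc.IH by simp
    from br[OF this Suc.prems[unfolded f_Suc]] obtain P2 Q2 where *: "f l P2 Q2 \<noteq> 0"
        "good_exponent N s P Q"
        "eq_below N s P Q \<longleftrightarrow> eq_below N s P2 Q2"
        "total_degree N P2 Q2 + 1 \<le> total_degree N P Q"
        "eq_below N s P2 Q2 \<Longrightarrow> d + 1 \<le> total_degree N P Q" by metis
    show ?case using Suc.IH[OF *(1)] *(2-5) by auto
  qed
  have f_good: "\<forall>P Q. f l P Q \<noteq> 0 \<longrightarrow> good_exponent N s P Q" for l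
    using f_prop by simp
  \<comment> \<open>In this stage and up to degree \<open>d\<close>, brackets with the remainder and
    iterated brackets are silent, so the cancellation of the target is not disturbed.\<close>
  have f_high: "f l P Q = (if l = 0 \<and> target P Q then - R P Q else 0)"
    if "first_diff N s P Q" "total_degree N P Q \<le> d" for l P Q
  proof (cases l)
    case 0
    have "poisson_bracket a N (of_laurent g) (of_laurent R) P Q = 0"
    proof (rule ccontr)
      assume "poisson_bracket a N (of_laurent g) (of_laurent R) P Q \<noteq> 0"
      from br[OF R_good this] have "d + 1 \<le> total_degree N P Q"
        using that(1) by (auto simp: first_diff_def)
      then show False using that by simp
    qed
    moreover have "H P Q = - (if target P Q then R P Q else 0)"
      using that by (intro H_eq) auto
    ultimately show ?thesis using 0 by (simp add: f_0_eq)
  next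
    case (Suc l')
    have "f l P Q = 0"
    proof (rule ccontr)
      assume "f l P Q \<noteq> 0"
      then have "poisson_bracket a N (of_laurent g) (of_laurent (f l')) P Q \<noteq> 0"
        by (simp add: Suc f_Suc)
      from br[OF f_good[of l'] this] have "d + 1 \<le> total_degree N P Q"
        using that(1) by (auto simp: first_diff_def)
      then show False using that by simp
    qed
    then show ?thesis using Suc by simp
  qed
  have f_fin: "finite {l. f l P Q \<noteq> 0}" for P Q
  proof (rule finite_subset)
    show "{l. f l P Q \<noteq> 0} \<subseteq> {..nat (total_degree N P Q)}" using f_prop by force
  qed auto
  define R' where "R' P Q = R P Q + Sum_any (\<lambda>l. f l P Q / fact (Suc l))" for P Q
  have fin': "finite {l. snd ((lie_derivative a N g ^^ Suc l) F) P Q \<noteq> 0}" for P Q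
    using f_fin[of P Q] unfolding lie by (simp add: of_laurent_def)
  have fin'': "finite {l. snd ((lie_derivative a N g ^^ l) F) P Q \<noteq> 0}" for P Q
    by (rule Sum_any_nat_split(1)) (rule fin')
  have sum: "Sum_any (\<lambda>l. snd ((lie_derivative a N g ^^ l) F) P Q / fact l) =
      snd F P Q + Sum_any (\<lambda>l. f l P Q / fact (Suc l))" for P Q
  proof -
    have "Sum_any (\<lambda>l. snd ((lie_derivative a N g ^^ l) F) P Q / fact l) =
      snd ((lie_derivative a N g ^^ 0) F) P Q / fact 0 +
      Sum_any (\<lambda>l. snd ((lie_derivative a N g ^^ Suc l) F) P Q / fact (Suc l))"
      by (rule Sum_any_nat_split(2)) (use fin'[of P Q] in simp)
    then show ?thesis unfolding lie by (simp add: of_laurent_def)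
  qed
  have "beta_series N (snd ((lie_derivative a N g ^^ l) F))" for l
  proof (cases l)
    case 0
    have u: "admissible N ((\<lambda>_. 0)(N := 1))"
      using N by (auto simp: admissible_def beta_exp_def)
    have "admissible N P \<and> admissible N Q" if "R P Q \<noteq> 0" for P Q
      using R_good that good_exponent_admissible by blast
    then show ?thesis
      using u unfolding beta_series_iff[OF N] 0
      by (auto simp: F_def add_laurent_def h0_series_def split: if_splits)
  next
    case (Suc l')
    have "admissible N P \<and> admissible N Q" if "f l' P Q \<noteq> 0" for P Q
      using f_good that good_exponent_admissible by blast
    then show ?thesis unfolding beta_series_iff[OF N] Suc lie by (simp add: of_laurent_def)
  qed
  moreover have "add_laurent (h0_series a N \<omega>) R' =
      (fst F, \<lambda>P Q. Sum_any (\<lambda>l. snd ((lie_derivative a N g ^^ l) F) P Q / fact l))"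
    unfolding sum by (simp add: R'_def[abs_def] F_def add_laurent_def add.assoc)
  ultimately have "lie_transform a N g F (add_laurent (h0_series a N \<omega>) R')"
    unfolding lie_transform_def using g_poly fin'' by simp
  moreover have "stage_series N n s (d + 1) R'"
    unfolding stage_series_def
  proof (intro allI impI)
    fix P Q assume ne: "R' P Q \<noteq> 0"
    have "R P Q \<noteq> 0 \<or> (\<exists>l. f l P Q \<noteq> 0)"
    proof (rule ccontr)
      assume "\<not> ?thesis"
      then have "R' P Q = 0" by (simp add: R'_def)
      then show False using ne by simp
    qed
    then have 1: "good_exponent N s P Q \<and> (\<not> eq_below N s P Q \<longrightarrow> int n < total_degree N P Q) \<and>
        (first_diff N s P Q \<longrightarrow> d \<le> total_degree N P Q)"
      using R f_prop by (auto simp: stage_series_def first_diff_def)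
    moreover have "d + 1 \<le> total_degree N P Q" if fd: "first_diff N s P Q"
    proof (rule ccontr)
      assume "\<not> ?thesis"
      then have deg: "total_degree N P Q \<le> d" by simp
      then have t: "target P Q" using 1 fd by (auto simp: target_def)
      have "Sum_any (\<lambda>l. f l P Q / fact (Suc l)) = sum (\<lambda>l. f l P Q / fact (Suc l)) {0}"
        by (rule Sum_any.expand_superset) (auto simp: f_high[OF fd deg])
      then have "R' P Q = 0" using t by (simp add: R'_def f_high[OF fd deg])
      then show False using ne by simp
    qed
    ultimately show "good_exponent N s P Q \<and> (\<not> eq_below N s P Q \<longrightarrow> int n < total_degree N P Q) \<and>
        (first_diff N s P Q \<longrightarrow> d + 1 \<le> total_degree N P Q)" by blast
  qed
  ultimately show ?thesis using that by (simp add: F_def)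
qed

lemma canonical_transform_append:
  "canonical_transform a N gs F G \<Longrightarrow> canonical_transform a N hs G H \<Longrightarrow> canonical_transform a N (gs @ hs) F H"
  by (induction gs arbitrary: F) auto

lemma normalisation_stage:
  assumes N: "2 \<le> N" and a: "\<And>k. k \<in> {1..N} \<Longrightarrow> a k \<noteq> 0"
    and A: "\<And>k. k \<in> {1..N} \<Longrightarrow> partial_strength a k \<noteq> 0" and \<omega>: "0 < \<omega>"
    and s: "1 \<le> s" "s \<le> N" and R: "stage_series N n s 0 R"
  shows "\<exists>gs R'. canonical_transform a N gs (add_laurent (h0_series a N \<omega>) R) (add_laurent (h0_series a N \<omega>) R')
    \<and> stage_series N n s (int m) R'"
proof (induction m)
  case 0
  have "canonical_transform a N [] (add_laurent (h0_series a N \<omega>) R) (add_laurent (h0_series a N \<omega>) R)"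
    by simp
  then show ?case using R by (metis of_nat_0)
next
  case (Suc m)
  then obtain gs R' where 1: "canonical_transform a N gs (add_laurent (h0_series a N \<omega>) R) (add_laurent (h0_series a N \<omega>) R')"
    "stage_series N n s (int m) R'" by blast
  obtain g R'' where
    "lie_transform a N g (add_laurent (h0_series a N \<omega>) R') (add_laurent (h0_series a N \<omega>) R'')"
    "stage_series N n s (int m + 1) R''"
    by (rule normalisation_step[OF N a A \<omega> s 1(2)])
  then have g: "canonical_transform a N [g] (add_laurent (h0_series a N \<omega>) R') (add_laurent (h0_series a N \<omega>) R'')"
    and st: "stage_series N n s (int (Suc m)) R''"
    by (auto simp del: split_paired_Ex simp: add.commute)
  show ?case using canonical_transform_append[OF 1(1) g] st by blast
qed

text \<open>The stage enters only through the premise of the gap clause, which gets stronger as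
  \<open>s\<close> grows; passing to the next stage only forgets information.\<close>

lemma good_exponent_Suc: "good_exponent N s P Q \<Longrightarrow> good_exponent N (Suc s) P Q"
  by (auto simp: good_exponent_def good_pair_def less_Suc_eq)

lemma eq_below_Suc: "eq_below N (Suc s) P Q \<longleftrightarrow> eq_below N s P Q \<and> beta_exp N P s = beta_exp N Q s"
  by (auto simp: eq_below_def less_Suc_eq)

text \<open>Once degree \<open>n\<close> is passed, the terms that first differ at \<open>s\<close>
  can join those of the earlier stages, and the next stage starts again from degree zero.\<close>

lemma stage_series_Suc:
  assumes "stage_series N n s (int (Suc n)) R"
  shows "stage_series N n (Suc s) 0 R"
  unfolding stage_series_def
proof (intro allI impI)
  fix P Q assume "R P Q \<noteq> 0"
  then have *: "good_exponent N s P Q \<and> (\<not> eq_below N s P Q \<longrightarrow> int n < total_degree N P Q) \<and>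
     (first_diff N s P Q \<longrightarrow> int (Suc n) \<le> total_degree N P Q)"
    using assms by (simp add: stage_series_def)
  then show "good_exponent N (Suc s) P Q \<and> (\<not> eq_below N (Suc s) P Q \<longrightarrow> int n < total_degree N P Q) \<and>
     (first_diff N (Suc s) P Q \<longrightarrow> 0 \<le> total_degree N P Q)"
    using total_degree_nonneg[of N s P Q] good_exponent_Suc[of N s P Q]
    by (auto simp: eq_below_Suc first_diff_def)
qed

lemma normalisation:
  assumes N: "2 \<le> N" and a: "\<And>k. k \<in> {1..N} \<Longrightarrow> a k \<noteq> 0"
    and A: "\<And>k. k \<in> {1..N} \<Longrightarrow> partial_strength a k \<noteq> 0" and \<omega>: "0 < \<omega>"
    and s: "s \<le> N" and R: "stage_series N n 1 0 R"
  shows "\<exists>gs R'. canonical_transform a N gs (add_laurent (h0_series a N \<omega>) R) (add_laurent (h0_series a N \<omega>) R')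
    \<and> stage_series N n (Suc s) 0 R'"
  using s
proof (induction s)
  case 0
  have "canonical_transform a N [] (add_laurent (h0_series a N \<omega>) R) (add_laurent (h0_series a N \<omega>) R)"
    by simp
  then show ?case using R by (metis One_nat_def)
next
  case (Suc s)
  then obtain gs R' where 1: "canonical_transform a N gs (add_laurent (h0_series a N \<omega>) R) (add_laurent (h0_series a N \<omega>) R')"
    "stage_series N n (Suc s) 0 R'" by auto
  from normalisation_stage[OF N a A \<omega> _ Suc.prems 1(2), of "Suc n"]
  obtain hs R'' where 2: "canonical_transform a N hs (add_laurent (h0_series a N \<omega>) R') (add_laurent (h0_series a N \<omega>) R'')"
    "stage_series N n (Suc s) (int (Suc n)) R''" by auto
  from canonical_transform_append[OF 1(1) 2(1)] stage_series_Suc[OF 2(2)] show ?case by blast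
qed

section \<open>From the preserved exponents to the normal form\<close>

lemma interval_like_consecutive:
  assumes "finite I" "interval_like (\<lambda>i. i \<in> I)"
  shows "consecutive I"
proof (cases "I = {}")
  case False
  have "I = {Min I..Max I}"
  proof
    show "{Min I..Max I} \<subseteq> I"
    proof
      fix j assume "j \<in> {Min I..Max I}"
      then have "Min I \<le> j" "j \<le> Max I" by auto
      then show "j \<in> I"
        by (rule interval_likeD[OF assms(2) Min_in[OF assms(1) False] Max_in[OF assms(1) False]])
    qed
  qed (use assms(1) in auto)
  then show ?thesis unfolding consecutive_def by blast
qed (simp add: consecutive_def)

text \<open>For \<open>m\<close> take the first index at which the exponents differ. Below
  \<open>m\<close> the entries are equal, and the alternative of the gap clause that survives all
  stages makes them 0 or at least 2. Up to \<open>m\<close> the support of \<open>K\<close> differs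
  from that of \<open>K + L\<close> at most in \<open>m\<close> itself, which is an end
  point.\<close>

lemma good_exponent_connected:
  assumes N: "2 \<le> N" and K: "K \<in> multi_indices N" and L: "L \<in> multi_indices N"
    and good: "good_exponent N s (alpha_exponent N K) (alpha_exponent N L)"
  shows "(K, L) \<in> connected_exponents N"
proof -
  note eq = beta_exp_alpha_exponent[OF K N] beta_exp_alpha_exponent[OF L N]
  have "good_pair N s (\<lambda>i. int (K i)) (\<lambda>i. int (L i))"
    using good unfolding good_exponent_def eq by (simp add: eq[abs_def])
  then have conn: "interval_like (\<lambda>i. K i \<noteq> 0 \<or> L i \<noteq> 0)"
    and gap: "\<And>l. l < N \<Longrightarrow> (\<forall>i\<le>l. K i = L i) \<Longrightarrow> gap_pair (int (K l)) (int (L l))"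
    by (simp_all add: good_pair_def)
  have out: "K i = 0" "L i = 0" if "i \<notin> {1..N}" for i
    using K L that by (auto simp: multi_indices_def)
  have fin: "finite {i. P i}" if "\<And>i. P i \<Longrightarrow> K i \<noteq> 0 \<or> L i \<noteq> 0" for P
    by (rule finite_subset[of _ "{1..N}"]) (use that out in blast, simp)
  have 1: "consecutive (index_support (\<lambda>i. K i + L i))"
    unfolding index_support_def using conn
    by (intro interval_like_consecutive fin) simp_all
  show ?thesis
  proof (cases "K = L")
    case True
    then have "(K, L) \<in> resonant_set N N" "consecutive (index_support K)"
      using 1 K by (auto simp: resonant_set_def index_support_def)
    then show ?thesis using 1 K L by (auto simp: connected_exponents_def)
  next
    case False
    then have ex: "\<exists>i. K i \<noteq> L i" by auto
    define m where "m = (LEAST i. K i \<noteq> L i)"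
    have m: "K m \<noteq> L m" unfolding m_def by (rule LeastI_ex[OF ex])
    have below: "K i = L i" if "i < m" for i
      using not_less_Least[of i "\<lambda>i. K i \<noteq> L i"] that unfolding m_def by blast
    have mN: "m \<in> {1..N}" using m out by force
    have "(K, L) \<in> resonant_set N (m - 1) - resonant_set N m"
      using K L m mN below by (auto simp: resonant_set_def)
    moreover have "consecutive (truncated_support m K)"
      unfolding truncated_support_def
    proof (rule interval_like_consecutive)
      show "interval_like (\<lambda>i. i \<in> {i \<in> {1..m}. K i \<noteq> 0})"
        unfolding interval_like_def
      proof (intro allI impI)
        fix i j l assume *: "i \<le> j" "j \<le> l" "i \<in> {i \<in> {1..m}. K i \<noteq> 0}" "l \<in> {i \<in> {1..m}. K i \<noteq> 0}"
        show "j \<in> {i \<in> {1..m}. K i \<noteq> 0}"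
        proof (cases "j = l")
          case False
          then have "j < m" using * by auto
          moreover have "K j \<noteq> 0 \<or> L j \<noteq> 0" using interval_likeD[OF conn, of i l j] * by auto
          ultimately show ?thesis using below[of j] * by auto
        qed (use * in auto)
      qed
    qed simp
    moreover have "\<forall>l\<in>{1..m-1}. K l = L l \<and> K l \<noteq> 1"
    proof
      fix l assume that: "l \<in> {1..m-1}"
      have "l < m" "l < N" using that mN by auto
      then show "K l = L l \<and> K l \<noteq> 1" using gap[of l] below by (auto simp: gap_pair_def)
    qed
    ultimately have "\<exists>m\<in>{1..N}. (K, L) \<in> resonant_set N (m - 1) - resonant_set N m \<and>
          consecutive (truncated_support m K) \<and> (\<forall>l\<in>{1..m-1}. K l = L l \<and> K l \<noteq> 1)"
      using mN by blast
    then show ?thesis using 1 K L unfolding connected_exponents_def by blast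
  qed
qed

theorem normal_form:
  assumes N: "2 \<le> N" and a: "\<And>k. k \<in> {1..N} \<Longrightarrow> a k \<noteq> 0"
    and A: "\<And>k. k \<in> {1..N} \<Longrightarrow> partial_strength a k \<noteq> 0" and \<omega>: "0 < \<omega>"
    and R0: "\<And>P Q. R0 P Q \<noteq> 0 \<Longrightarrow> good_exponent N 1 P Q"
  shows "\<exists>gs Z R.
    canonical_transform a N gs
      (add_laurent (h0_series a N \<omega>) R0)
      (add_laurent (add_laurent (h0_series a N \<omega>) Z) R) \<and>
    beta_series N Z \<and> beta_series N R \<and>
    poisson_bracket a N (of_laurent Z) (h0_series a N \<omega>) = (\<lambda>P Q. 0) \<and>
    series_ord N R \<ge> enat (n + 1) \<and>
    exponents N Z \<subseteq> connected_exponents N \<and>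
    exponents N R \<subseteq> connected_exponents N"
proof -
  have "0 \<le> total_degree N P Q" if "R0 P Q \<noteq> 0" for P Q
    using R0[OF that] by (rule total_degree_nonneg)
  then have "stage_series N n 1 0 R0"
    using R0 N by (simp add: stage_series_def eq_below_def)
  from normalisation[OF N a A \<omega> order_refl this] obtain gs R' where
    gs: "canonical_transform a N gs (add_laurent (h0_series a N \<omega>) R0) (add_laurent (h0_series a N \<omega>) R')"
    and R': "stage_series N n (Suc N) 0 R'" by blast
  \<comment> \<open>Agreement at all indices up to \<open>N\<close> means \<open>P = Q\<close>: such
    monomials depend on moduli only and commute with \<open>h0\<close>. The bound on the degree
    keeps \<open>Z\<close> a polynomial, for which the bracket is meaningful, and all other terms
    have degree above \<open>n\<close>.\<close>
  define low where "low P Q \<longleftrightarrow> eq_below N (Suc N) P Q \<and> total_degree N P Q \<le> int n" for P Q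
  define Z :: laurent where "Z = (\<lambda>P Q. if low P Q then R' P Q else 0)"
  define R :: laurent where "R = (\<lambda>P Q. if low P Q then 0 else R' P Q)"
  have R'_good: "good_exponent N (Suc N) P Q" if "R' P Q \<noteq> 0" for P Q
    using R' that by (simp add: stage_series_def)
  have Z_good: "good_exponent N (Suc N) P Q \<and> low P Q" if "Z P Q \<noteq> 0" for P Q
    using R'_good[of P Q] that by (auto simp: Z_def split: if_splits)
  have R_good: "good_exponent N (Suc N) P Q \<and> int n < total_degree N P Q" if "R P Q \<noteq> 0" for P Q
    using R' that by (auto simp: R_def low_def stage_series_def split: if_splits)
  have sum: "add_laurent (add_laurent (h0_series a N \<omega>) Z) R = add_laurent (h0_series a N \<omega>) R'"
    by (auto simp: add_laurent_def Z_def R_def fun_eq_iff)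
  have sZ: "beta_series N Z"
    unfolding beta_series_iff[OF N] using Z_good good_exponent_admissible by blast
  have sR: "beta_series N R"
    unfolding beta_series_iff[OF N] using R_good good_exponent_admissible by blast
  have Z_eq: "P = Q" if "Z P Q \<noteq> 0" for P Q
  proof (rule beta_exp_inject[of N])
    show "admissible N P" "admissible N Q" using Z_good[OF that] good_exponent_admissible by blast+
    show "beta_exp N P i = beta_exp N Q i" for i
      using Z_good[OF that] N by (cases "i \<le> N") (auto simp: low_def eq_below_def beta_exp_outside)
  qed
  have Z_fin: "finite {(P, Q). Z P Q \<noteq> 0}"
    by (rule finite_subset[OF _ finite_total_degree_le[OF N, of n]])
      (use Z_good good_exponent_admissible low_def in blast)
  have br: "poisson_bracket a N (of_laurent Z) (h0_series a N \<omega>) = (\<lambda>P Q. 0)"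
  proof (intro ext)
    fix P Q
    have "poisson_bracket a N (of_laurent Z) (of_laurent (\<lambda>_ _. 0)) P Q = 0"
      by (rule ccontr, erule poisson_bracket_support[OF Z_fin]) simp
    moreover have z: "of_int (P k - Q k) * Z (raise_exp N k P) (raise_exp N k Q) = 0" for k
    proof (cases "Z (raise_exp N k P) (raise_exp N k Q) = 0")
      case False
      then have "raise_exp N k P k = raise_exp N k Q k" using Z_eq by metis
      then show ?thesis by (auto simp: raise_exp_def split: if_splits)
    qed simp
    moreover have "h0_series a N \<omega> = add_laurent (h0_series a N \<omega>) (\<lambda>_ _. 0)"
      by (simp add: add_laurent_def)
    ultimately show "poisson_bracket a N (of_laurent Z) (h0_series a N \<omega>) P Q = 0"
      using poisson_bracket_h0[OF Z_fin N, of a \<omega> "\<lambda>_ _. 0" P Q]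
      by (simp only: mult.assoc z mult_zero_right sum.neutral_const add_0)
  qed
  have ord: "enat (n + 1) \<le> series_ord N R"
    unfolding series_ord_def
  proof (rule INF_greatest, clarify)
    fix K L assume KL: "(K, L) \<in> exponents N R"
    then have MI: "K \<in> multi_indices N" "L \<in> multi_indices N" and
      "R (alpha_exponent N K) (alpha_exponent N L) \<noteq> 0" by (auto simp: exponents_def beta_coeff_def)
    from R_good[OF this(3)] have "int n < (\<Sum>i=1..N. int (K i) + int (L i))"
      by (simp add: total_degree_def beta_exp_alpha_exponent[OF MI(1) N] beta_exp_alpha_exponent[OF MI(2) N])
    also have "\<dots> = int ((\<Sum>i=1..N. K i) + (\<Sum>i=1..N. L i))" by (simp add: sum.distrib)
    finally have "int n < int ((\<Sum>i=1..N. K i) + (\<Sum>i=1..N. L i))" .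
    then have "n + 1 \<le> (\<Sum>i=1..N. K i) + (\<Sum>i=1..N. L i)" by linarith
    then show "enat (n + 1) \<le> enat ((\<Sum>i=1..N. K i) + (\<Sum>i=1..N. L i))" by simp
  qed
  have ex: "exponents N Z \<subseteq> connected_exponents N" "exponents N R \<subseteq> connected_exponents N"
    unfolding exponents_def beta_coeff_def
    using Z_good[THEN conjunct1, THEN good_exponent_connected[OF N, rotated 2]]
      R_good[THEN conjunct1, THEN good_exponent_connected[OF N, rotated 2]] by auto
  have "canonical_transform a N gs (add_laurent (h0_series a N \<omega>) R0)
      (add_laurent (add_laurent (h0_series a N \<omega>) Z) R)"
    unfolding sum by (rule gs)
  then show ?thesis
    by (intro exI[of _ gs] exI[of _ Z] exI[of _ R] conjI sZ sR br ord ex)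
qed

section \<open>Absolutely convergent series\<close>

type_synonym exponent_pair = "(nat \<Rightarrow> nat) \<times> (nat \<Rightarrow> nat)"

definition monomial :: "nat \<Rightarrow> (nat \<Rightarrow> complex) \<Rightarrow> exponent_pair \<Rightarrow> complex" where
  "monomial N \<beta> x = (\<Prod>i=1..N. \<beta> i ^ fst x i) * (\<Prod>i=1..N. cnj (\<beta> i) ^ snd x i)"

definition pair_degree :: "nat \<Rightarrow> exponent_pair \<Rightarrow> nat" where
  "pair_degree N x = (\<Sum>i=1..N. fst x i + snd x i)"

definition pair_add :: "exponent_pair \<Rightarrow> exponent_pair \<Rightarrow> exponent_pair" where
  "pair_add x y = (\<lambda>i. fst x i + fst y i, \<lambda>i. snd x i + snd y i)"

definition pair_swap :: "exponent_pair \<Rightarrow> exponent_pair" where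
  "pair_swap x = (snd x, fst x)"

definition closed_polydisc :: "nat \<Rightarrow> real \<Rightarrow> (nat \<Rightarrow> complex) set" where
  "closed_polydisc N r = {\<beta>. \<forall>i\<in>{1..N}. cmod (\<beta> i) \<le> r}"

lemma monomial_add: "monomial N \<beta> (pair_add x y) = monomial N \<beta> x * monomial N \<beta> y"
  by (simp add: monomial_def pair_add_def power_add prod.distrib)

lemma pair_degree_add: "pair_degree N (pair_add x y) = pair_degree N x + pair_degree N y"
  by (simp add: pair_degree_def pair_add_def sum.distrib)

lemma monomial_swap: "monomial N \<beta> (pair_swap x) = cnj (monomial N \<beta> x)"
  by (simp add: monomial_def pair_swap_def mult.commute)

lemma pair_degree_swap: "pair_degree N (pair_swap x) = pair_degree N x"
  by (simp add: pair_degree_def pair_swap_def add.commute)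

lemma monomial_scale: "monomial N (\<lambda>i. of_real t * \<beta> i) x = of_real t ^ pair_degree N x * monomial N \<beta> x"
  by (simp add: monomial_def pair_degree_def power_mult_distrib prod.distrib power_sum power_add sum.distrib)

lemma norm_monomial_le:
  assumes "\<beta> \<in> closed_polydisc N r"
  shows "cmod (monomial N \<beta> x) \<le> r ^ pair_degree N x"
proof -
  have "cmod (monomial N \<beta> x) = (\<Prod>i=1..N. cmod (\<beta> i) ^ (fst x i + snd x i))"
    by (simp add: monomial_def norm_mult norm_power prod_norm[symmetric] prod.distrib power_add)
  also have "\<dots> \<le> (\<Prod>i=1..N. r ^ (fst x i + snd x i))"
    using assms by (intro prod_mono conjI power_mono) (auto simp: closed_polydisc_def)
  also have "\<dots> = r ^ pair_degree N x" by (simp add: pair_degree_def power_sum)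
  finally show ?thesis .
qed

text \<open>Working with arbitrary families of monomials instead of coefficient functions avoids all
  regrouping of multiple series; the coefficients are collected only once, in \<open>rep_coefficients\<close>.\<close>

definition rep :: "nat \<Rightarrow> real \<Rightarrow> exponent_pair set \<Rightarrow> ((nat \<Rightarrow> complex) \<Rightarrow> complex) \<Rightarrow> real \<Rightarrow> bool" where
  "rep N r X f B \<longleftrightarrow> (\<exists>c E s. (\<forall>n::nat. c n \<noteq> 0 \<longrightarrow> E n \<in> X) \<and> s \<le> B \<and>
     ((\<lambda>n. cmod (c n) * r ^ pair_degree N (E n)) has_sum s) UNIV \<and>
     (\<forall>\<beta>\<in>closed_polydisc N r. ((\<lambda>n. c n * monomial N \<beta> (E n)) has_sum f \<beta>) UNIV))"

lemma rep_mono: "rep N r X f B \<Longrightarrow> X \<subseteq> Y \<Longrightarrow> B \<le> C \<Longrightarrow> rep N r Y f C"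
  unfolding rep_def by (elim exE conjE, intro exI conjI) (assumption | auto)+

lemma rep_cong: "rep N r X f B \<Longrightarrow> (\<And>\<beta>. \<beta> \<in> closed_polydisc N r \<Longrightarrow> f \<beta> = g \<beta>) \<Longrightarrow> rep N r X g B"
  unfolding rep_def by (elim exE conjE, intro exI conjI) (assumption | simp)+

lemma rep_bound:
  assumes "rep N r X f B" "\<beta> \<in> closed_polydisc N r"
  shows "cmod (f \<beta>) \<le> B"
proof -
  obtain c E s where *: "s \<le> B" "((\<lambda>n. cmod (c n) * r ^ pair_degree N (E n)) has_sum s) (UNIV :: nat set)"
     "((\<lambda>n. c n * monomial N \<beta> (E n)) has_sum f \<beta>) UNIV"
    using assms unfolding rep_def by blast
  have "cmod (f \<beta>) \<le> s"
    by (rule norm_infsum_le[OF *(3,2)])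
      (simp add: norm_mult mult_left_mono norm_monomial_le[OF assms(2)])
  then show ?thesis using *(1) by simp
qed

lemma rep_nonneg:
  assumes "rep N r X f B" "0 \<le> r"
  shows "0 \<le> B"
  using rep_bound[OF assms(1), of "\<lambda>_. 0"] assms(2)
  by (auto simp: closed_polydisc_def intro: order_trans[OF norm_ge_zero])

lemma rep_monomial:
  assumes "c \<noteq> 0 \<Longrightarrow> x \<in> X" "0 \<le> r"
  shows "rep N r X (\<lambda>\<beta>. c * monomial N \<beta> x) (cmod c * r ^ pair_degree N x)"
  unfolding rep_def
proof (intro exI conjI ballI)
  let ?c = "\<lambda>n::nat. if n = 0 then c else 0"
  have 1: "(g has_sum g 0) UNIV" if "\<And>n. n \<noteq> 0 \<Longrightarrow> g n = 0" for g :: "nat \<Rightarrow> 'a::{comm_monoid_add,t2_space}"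
  proof -
    have "(g has_sum g 0) {0}" using has_sum_finite[of "{0}" g] by simp
    then show ?thesis by (subst (asm) has_sum_cong_neutral[of UNIV _ g g]) (use that in auto)
  qed
  show "((\<lambda>n. cmod (?c n) * r ^ pair_degree N ((\<lambda>_. x) n)) has_sum (cmod c * r ^ pair_degree N x)) UNIV"
    using 1[of "\<lambda>n. cmod (?c n) * r ^ pair_degree N ((\<lambda>_. x) n)"] by simp
  show "((\<lambda>n. ?c n * monomial N \<beta> ((\<lambda>_. x) n)) has_sum c * monomial N \<beta> x) UNIV" for \<beta>
    using 1[of "\<lambda>n. ?c n * monomial N \<beta> ((\<lambda>_. x) n)"] by simp
  show "\<forall>n. ?c n \<noteq> 0 \<longrightarrow> (\<lambda>_. x) n \<in> X" using assms by auto
qed simp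

lemma rep_zero: "0 \<le> r \<Longrightarrow> rep N r X (\<lambda>_. 0) 0"
  using rep_monomial[of 0 undefined X r N] by simp

lemma rep_const:
  assumes "(\<lambda>_. 0, \<lambda>_. 0) \<in> X" "0 \<le> r"
  shows "rep N r X (\<lambda>_. c) (cmod c)"
  using rep_monomial[of c "(\<lambda>_. 0, \<lambda>_. 0)" X r N] assms by (simp add: monomial_def pair_degree_def)

text \<open>A sequence of sequences is a doubly indexed family, flattened by
  \<open>prod_decode\<close>. Summability of the bounds at radius \<open>r\<close> gives absolute
  convergence of the double family and so permits the change of order.\<close>

lemma rep_infsum:
  assumes r: "0 \<le> r" and f: "\<And>p::nat. rep N r X (f p) (B p)" and B: "(B has_sum S) UNIV"
    and F: "\<And>\<beta>. \<beta> \<in> closed_polydisc N r \<Longrightarrow> ((\<lambda>p. f p \<beta>) has_sum F \<beta>) UNIV"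
  shows "rep N r X F S"
proof -
  define Q where "Q p c E s \<longleftrightarrow> (\<forall>n::nat. c n \<noteq> 0 \<longrightarrow> E n \<in> X) \<and> s \<le> B p \<and>
     ((\<lambda>n. cmod (c n) * r ^ pair_degree N (E n)) has_sum s) UNIV \<and>
     (\<forall>\<beta>\<in>closed_polydisc N r. ((\<lambda>n. c n * monomial N \<beta> (E n)) has_sum f p \<beta>) UNIV)" for p c E s
  have "\<exists>c E s. Q p c E s" for p using f[of p] unfolding rep_def Q_def .
  then obtain c E s where Q: "\<And>p. Q p (c p) (E p) (s p)" by metis
  have cX: "c p n \<noteq> 0 \<Longrightarrow> E p n \<in> X" and sB: "s p \<le> B p"
    and s: "((\<lambda>n. cmod (c p n) * r ^ pair_degree N (E p n)) has_sum s p) (UNIV :: nat set)"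
    and fp: "\<beta> \<in> closed_polydisc N r \<Longrightarrow> ((\<lambda>n. c p n * monomial N \<beta> (E p n)) has_sum f p \<beta>) UNIV"
    for p n \<beta> using Q[of p] unfolding Q_def by blast+
  have s0: "0 \<le> s p" for p
    by (rule has_sum_nonneg[OF s]) (use r in auto)
  have "s summable_on UNIV"
    by (rule summable_on_comparison_test[of B]) (use B sB s0 in \<open>auto simp: summable_on_def\<close>)
  then obtain S' where S': "(s has_sum S') UNIV" by (auto simp: summable_on_def)
  have "S' \<le> S" by (rule has_sum_mono[OF S' B]) (use sB in auto)
  let ?T = "Sigma (UNIV :: nat set) (\<lambda>_. UNIV :: nat set)"
  let ?nm = "\<lambda>x. cmod (c (fst x) (snd x)) * r ^ pair_degree N (E (fst x) (snd x))"
  have sm: "?nm summable_on ?T"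
    by (rule summable_on_SigmaI[where g = s]) (use s S' r in \<open>auto simp: summable_on_def\<close>)
  then have nm: "(?nm has_sum S') ?T"
    by (intro has_sum_SigmaI[where g = s]) (use s S' in auto)
  have val: "((\<lambda>x. c (fst x) (snd x) * monomial N \<beta> (E (fst x) (snd x))) has_sum F \<beta>) ?T"
    if \<beta>: "\<beta> \<in> closed_polydisc N r" for \<beta>
  proof (rule has_sum_SigmaI[where g = "\<lambda>p. f p \<beta>"])
    show "((\<lambda>p. f p \<beta>) has_sum F \<beta>) UNIV" by (rule F[OF \<beta>])
    show "((\<lambda>y. c (fst (x, y)) (snd (x, y)) * monomial N \<beta> (E (fst (x, y)) (snd (x, y)))) has_sum f x \<beta>) UNIV" for x
      using fp[OF \<beta>] by simp
    show "(\<lambda>x. c (fst x) (snd x) * monomial N \<beta> (E (fst x) (snd x))) summable_on ?T"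
      by (rule abs_summable_summable, rule Infinite_Sum.abs_summable_on_comparison_test'[OF sm])
        (simp add: norm_mult mult_left_mono norm_monomial_le[OF \<beta>])
  qed
  have bij: "bij_betw prod_decode UNIV ?T"
    using bij_prod_decode by simp
  show ?thesis
    unfolding rep_def
  proof (intro exI conjI ballI)
    let ?c = "\<lambda>n. c (fst (prod_decode n)) (snd (prod_decode n))"
    let ?E = "\<lambda>n. E (fst (prod_decode n)) (snd (prod_decode n))"
    show "\<forall>n. ?c n \<noteq> 0 \<longrightarrow> ?E n \<in> X" using cX by blast
    show "S' \<le> S" by fact
    show "((\<lambda>n. cmod (?c n) * r ^ pair_degree N (?E n)) has_sum S') UNIV"
      using has_sum_reindex_bij_betw[OF bij, of ?nm S'] nm by simp
    show "((\<lambda>n. ?c n * monomial N \<beta> (?E n)) has_sum F \<beta>) UNIV" if "\<beta> \<in> closed_polydisc N r" for \<beta>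
      using has_sum_reindex_bij_betw[OF bij, of "\<lambda>x. c (fst x) (snd x) * monomial N \<beta> (E (fst x) (snd x))" "F \<beta>"]
        val[OF that] by simp
  qed
qed

text \<open>Two functions form a sequence that vanishes from index 2 on, so the interleaving of
  their families comes from the infinite case.\<close>

lemma rep_add:
  assumes r: "0 \<le> r" and f: "rep N r X f B" and g: "rep N r X g C"
  shows "rep N r X (\<lambda>\<beta>. f \<beta> + g \<beta>) (B + C)"
proof (rule rep_infsum[OF r])
  have 1: "(h has_sum h 0 + h (Suc 0)) UNIV" if "\<And>n. n \<noteq> 0 \<Longrightarrow> n \<noteq> Suc 0 \<Longrightarrow> h n = 0" for h :: "nat \<Rightarrow> 'a::{comm_monoid_add,t2_space}"
  proof -
    have "(h has_sum h 0 + h (Suc 0)) {0, Suc 0}" using has_sum_finite[of "{0, Suc 0}" h] by simp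
    then show ?thesis by (subst (asm) has_sum_cong_neutral[of UNIV _ h h]) (use that in auto)
  qed
  let ?h = "\<lambda>p \<beta>. if p = 0 then f \<beta> else if p = Suc 0 then g \<beta> else 0"
  let ?B = "\<lambda>p. if p = 0 then B else if p = Suc 0 then C else 0"
  show "rep N r X (?h p) (?B p)" for p
    using f g rep_zero[OF r] by auto
  show "(?B has_sum B + C) UNIV" using 1[of ?B] by simp
  show "((\<lambda>p. ?h p \<beta>) has_sum f \<beta> + g \<beta>) UNIV" for \<beta> using 1[of "\<lambda>p. ?h p \<beta>"] by simp
qed

lemma rep_monomial_mult:
  assumes f: "rep N r X f B" and y: "c \<noteq> 0 \<Longrightarrow> (\<And>x. x \<in> X \<Longrightarrow> pair_add y x \<in> Z)" and r: "0 \<le> r"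
  shows "rep N r Z (\<lambda>\<beta>. (c * monomial N \<beta> y) * f \<beta>) ((cmod c * r ^ pair_degree N y) * B)"
proof -
  obtain d E s where *: "\<And>n::nat. d n \<noteq> 0 \<Longrightarrow> E n \<in> X" "s \<le> B"
     "((\<lambda>n. cmod (d n) * r ^ pair_degree N (E n)) has_sum s) UNIV"
     "\<And>\<beta>. \<beta>\<in>closed_polydisc N r \<Longrightarrow> ((\<lambda>n. d n * monomial N \<beta> (E n)) has_sum f \<beta>) UNIV"
    using f unfolding rep_def by blast
  show ?thesis
    unfolding rep_def
  proof (intro exI conjI ballI)
    let ?d = "\<lambda>n. c * d n" and ?E = "\<lambda>n. pair_add y (E n)"
    show "\<forall>n. ?d n \<noteq> 0 \<longrightarrow> ?E n \<in> Z" using * y by auto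
    show "(cmod c * r ^ pair_degree N y) * s \<le> (cmod c * r ^ pair_degree N y) * B"
      using *(2) r by (intro mult_left_mono) auto
    show "((\<lambda>n. cmod (?d n) * r ^ pair_degree N (?E n)) has_sum (cmod c * r ^ pair_degree N y) * s) UNIV"
      using has_sum_cmult_right[OF *(3), of "cmod c * r ^ pair_degree N y"]
      by (simp add: norm_mult pair_degree_add power_add mult_ac)
    show "((\<lambda>n. ?d n * monomial N \<beta> (?E n)) has_sum (c * monomial N \<beta> y) * f \<beta>) UNIV"
      if "\<beta> \<in> closed_polydisc N r" for \<beta>
      using has_sum_cmult_right[OF *(4)[OF that], of "c * monomial N \<beta> y"]
      by (simp add: monomial_add mult_ac)
  qed
qed

text \<open>The first factor is expanded and each of its monomials is multiplied into the second;
  the bounds multiply because degrees add.\<close>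

lemma rep_mult:
  assumes r: "0 \<le> r" and f: "rep N r X f B" and g: "rep N r Y g C"
    and XY: "\<And>x y. x \<in> X \<Longrightarrow> y \<in> Y \<Longrightarrow> pair_add x y \<in> Z"
  shows "rep N r Z (\<lambda>\<beta>. f \<beta> * g \<beta>) (B * C)"
proof -
  obtain c E s where *: "\<And>n::nat. c n \<noteq> 0 \<Longrightarrow> E n \<in> X" "s \<le> B"
     "((\<lambda>n. cmod (c n) * r ^ pair_degree N (E n)) has_sum s) UNIV"
     "\<And>\<beta>. \<beta>\<in>closed_polydisc N r \<Longrightarrow> ((\<lambda>n. c n * monomial N \<beta> (E n)) has_sum f \<beta>) UNIV"
    using f unfolding rep_def by blast
  have "rep N r Z (\<lambda>\<beta>. f \<beta> * g \<beta>) (s * C)"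
  proof (rule rep_infsum[OF r])
    show "rep N r Z (\<lambda>\<beta>. (c p * monomial N \<beta> (E p)) * g \<beta>) ((cmod (c p) * r ^ pair_degree N (E p)) * C)" for p
      by (rule rep_monomial_mult[OF g _ r]) (use * XY in auto)
    show "((\<lambda>p. (cmod (c p) * r ^ pair_degree N (E p)) * C) has_sum s * C) UNIV"
      by (rule has_sum_cmult_left[OF *(3)])
    show "((\<lambda>p. (c p * monomial N \<beta> (E p)) * g \<beta>) has_sum f \<beta> * g \<beta>) UNIV"
      if "\<beta> \<in> closed_polydisc N r" for \<beta>
      by (rule has_sum_cmult_left[OF *(4)[OF that]])
  qed
  then show ?thesis
    by (rule rep_mono) (use *(2) rep_nonneg[OF g r] in \<open>auto intro: mult_right_mono\<close>)
qed

lemma rep_cmult: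
  assumes r: "0 \<le> r" and f: "rep N r X f B"
  shows "rep N r X (\<lambda>\<beta>. c * f \<beta>) (cmod c * B)"
proof -
  have "rep N r {(\<lambda>_. 0, \<lambda>_. 0)} (\<lambda>_. c) (cmod c)" by (rule rep_const) (use r in auto)
  from rep_mult[OF r this f] show ?thesis by (auto simp: pair_add_def)
qed

lemma rep_minus: "0 \<le> r \<Longrightarrow> rep N r X f B \<Longrightarrow> rep N r X (\<lambda>\<beta>. - f \<beta>) B"
  using rep_cmult[of r N X f B "-1"] by simp

lemma rep_diff: "0 \<le> r \<Longrightarrow> rep N r X f B \<Longrightarrow> rep N r X g C \<Longrightarrow> rep N r X (\<lambda>\<beta>. f \<beta> - g \<beta>) (B + C)"
  using rep_add[of r N X f B "\<lambda>\<beta>. - g \<beta>" C] rep_minus[of r N X g C] by simp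

lemma rep_sum:
  assumes "0 \<le> r" "finite A" "\<And>a. a \<in> A \<Longrightarrow> rep N r X (f a) (B a)"
  shows "rep N r X (\<lambda>\<beta>. \<Sum>a\<in>A. f a \<beta>) (\<Sum>a\<in>A. B a)"
  using assms(2,3) by (induction A rule: finite_induct) (simp_all add: rep_add rep_zero assms(1))

lemma rep_cnj:
  assumes f: "rep N r X f B"
  shows "rep N r (pair_swap ` X) (\<lambda>\<beta>. cnj (f \<beta>)) B"
proof -
  obtain c E s where *: "\<And>n::nat. c n \<noteq> 0 \<Longrightarrow> E n \<in> X" "s \<le> B"
     "((\<lambda>n. cmod (c n) * r ^ pair_degree N (E n)) has_sum s) UNIV"
     "\<And>\<beta>. \<beta>\<in>closed_polydisc N r \<Longrightarrow> ((\<lambda>n. c n * monomial N \<beta> (E n)) has_sum f \<beta>) UNIV"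
    using f unfolding rep_def by blast
  show ?thesis
    unfolding rep_def
  proof (intro exI conjI ballI)
    show "\<forall>n. cnj (c n) \<noteq> 0 \<longrightarrow> pair_swap (E n) \<in> pair_swap ` X" using *(1) by auto
    show "s \<le> B" by fact
    show "((\<lambda>n. cmod (cnj (c n)) * r ^ pair_degree N (pair_swap (E n))) has_sum s) UNIV"
      using *(3) by (simp add: pair_degree_swap)
    show "((\<lambda>n. cnj (c n) * monomial N \<beta> (pair_swap (E n))) has_sum cnj (f \<beta>)) UNIV"
      if "\<beta> \<in> closed_polydisc N r" for \<beta>
      using *(4)[OF that] has_sum_cnj_iff[where f = "\<lambda>n. c n * monomial N \<beta> (E n)" and a = "f \<beta>" and M = UNIV]
      by (simp add: monomial_swap)
  qed
qed

lemma rep_Re: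
  assumes r: "0 \<le> r" and f: "rep N r X f B"
  shows "rep N r (X \<union> pair_swap ` X) (\<lambda>\<beta>. of_real (Re (f \<beta>))) B"
proof -
  have "rep N r (X \<union> pair_swap ` X) f B" "rep N r (X \<union> pair_swap ` X) (\<lambda>\<beta>. cnj (f \<beta>)) B"
    using rep_mono[OF f] rep_mono[OF rep_cnj[OF f]] by auto
  from rep_cmult[OF r rep_add[OF r this], of "1/2"]
  show ?thesis by (rule rep_cong[OF rep_mono]) (auto simp: complex_add_cnj)
qed

lemma rep_power_Suc:
  assumes r: "0 \<le> r" and f: "rep N r X f B" and X: "\<And>x y. x \<in> X \<Longrightarrow> y \<in> X \<Longrightarrow> pair_add x y \<in> X"
  shows "rep N r X (\<lambda>\<beta>. f \<beta> ^ Suc n) (B ^ Suc n)"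
proof (induction n)
  case (Suc n)
  from rep_mult[OF r f this X] show ?case by simp
qed (use f in simp)

lemma rep_power:
  assumes r: "0 \<le> r" and f: "rep N r X f B" and X: "\<And>x y. x \<in> X \<Longrightarrow> y \<in> X \<Longrightarrow> pair_add x y \<in> X"
    and 0: "(\<lambda>_. 0, \<lambda>_. 0) \<in> X"
  shows "rep N r X (\<lambda>\<beta>. f \<beta> ^ n) (B ^ n)"
proof (cases n)
  case 0
  then show ?thesis using rep_const[OF \<open>(\<lambda>_. 0, \<lambda>_. 0) \<in> X\<close> r, of N 1] by simp
next
  case (Suc m)
  show ?thesis unfolding Suc by (rule rep_power_Suc[OF r f X])
qed

lemma has_sum_Ln:
  assumes "cmod z < 1"
  shows "((\<lambda>n. (- ((-1) ^ n) / of_nat n) * z ^ n) has_sum Ln (1 + z)) UNIV"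
proof (rule norm_summable_imp_has_sum)
  have e: "(- ((-1) ^ n) / of_nat n) * z ^ n = - ((- z) ^ n) / of_nat n" for n
    by (simp add: power_minus')
  show "(\<lambda>n. (- ((-1) ^ n) / of_nat n) * z ^ n) sums Ln (1 + z)"
    unfolding e by (rule Ln_series'[OF assms])
  show "summable (\<lambda>n. cmod ((- ((-1) ^ n) / of_nat n) * z ^ n))"
  proof (rule summable_comparison_test'[of "\<lambda>n. cmod z ^ n" 0])
    show "summable (\<lambda>n. cmod z ^ n)" using assms by (intro summable_geometric) simp
    show "norm (cmod ((- ((-1) ^ n) / of_nat n) * z ^ n)) \<le> cmod z ^ n" for n
    proof -
      have "cmod (- ((-1) ^ n) / of_nat n) \<le> 1" by (cases n) (simp_all add: norm_divide norm_power del: of_nat_Suc)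
      from mult_right_mono[OF this, of "cmod z ^ n"] show ?thesis
        by (simp only: norm_mult norm_power real_norm_def abs_mult abs_norm_cancel power_abs zero_le_power norm_ge_zero mult_1)
    qed
  qed
qed

lemma has_sum_geometric:
  assumes "0 \<le> B" "B < 1"
  shows "((\<lambda>n. B ^ n) has_sum 1 / (1 - B :: real)) UNIV"
proof (rule norm_summable_imp_has_sum)
  show "summable (\<lambda>n. norm (B ^ n))" using assms by (simp add: norm_power summable_geometric)
  show "(\<lambda>n. B ^ n) sums (1 / (1 - B))" using assms by (intro geometric_sums) simp
qed

lemma rep_Ln:
  assumes r: "0 \<le> r" and f: "rep N r X f B" and X: "\<And>x y. x \<in> X \<Longrightarrow> y \<in> X \<Longrightarrow> pair_add x y \<in> X"
    and B: "B < 1"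
  shows "rep N r X (\<lambda>\<beta>. Ln (1 + f \<beta>)) (1 / (1 - B))"
proof (rule rep_infsum[OF r])
  have B0: "0 \<le> B" by (rule rep_nonneg[OF f r])
  show "rep N r X (\<lambda>\<beta>. (- ((-1) ^ p) / of_nat p) * f \<beta> ^ p) (B ^ p)" for p
  proof (cases p)
    \<comment> \<open>The coefficient is \<open>- 1 / 0 = 0\<close>: there is no constant term, and
      \<open>X\<close> may omit the zero exponent.\<close>
    case 0
    have "rep N r X (\<lambda>_. 0) (B ^ p)" by (rule rep_mono[OF rep_zero[OF r]]) (use 0 in auto)
    then show ?thesis using 0 by simp
  next
    case (Suc n)
    have "cmod (- ((-1) ^ p) / of_nat p) \<le> 1" using Suc by (simp add: norm_divide norm_power del: of_nat_Suc)
    then have le: "cmod (- ((-1) ^ p) / of_nat p) * B ^ p \<le> B ^ p"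
      using B0 mult_right_mono[of _ 1 "B ^ p"] by simp
    have "rep N r X (\<lambda>\<beta>. (- ((-1) ^ p) / of_nat p) * f \<beta> ^ p) (cmod (- ((-1) ^ p) / of_nat p) * B ^ p)"
      unfolding Suc by (rule rep_cmult[OF r rep_power_Suc[OF r f X]])
    then show ?thesis by (rule rep_mono[OF _ order_refl le])
  qed
  show "((\<lambda>n. B ^ n) has_sum 1 / (1 - B)) UNIV" by (rule has_sum_geometric[OF B0 B])
  show "((\<lambda>p. (- ((-1) ^ p) / of_nat p) * f \<beta> ^ p) has_sum Ln (1 + f \<beta>)) UNIV"
    if "\<beta> \<in> closed_polydisc N r" for \<beta>
    using rep_bound[OF f that] B by (intro has_sum_Ln) simp
qed

section \<open>Uniqueness of the coefficients\<close>

text \<open>Several \<open>x\<close> may share an exponent, so the sums over the fibres of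
  \<open>n\<close> are what is determined: they are the coefficients of a polynomial with infinitely
  many roots.\<close>

lemma finite_sum_powers_zero:
  fixes c :: "'a \<Rightarrow> complex"
  assumes A: "finite A" and T: "infinite T" and z: "\<And>t. t \<in> T \<Longrightarrow> (\<Sum>x\<in>A. c x * t ^ n x) = 0"
  shows "(\<Sum>x\<in>{x\<in>A. n x = e}. c x) = 0"
proof -
  define p where "p = (\<Sum>x\<in>A. monom (c x) (n x))"
  have "poly p t = 0" if "t \<in> T" for t
    using z[OF that] by (simp add: p_def poly_sum poly_monom)
  then have "T \<subseteq> {t. poly p t = 0}" by auto
  then have "infinite {t. poly p t = 0}" using T finite_subset by blast
  then have "p = 0" using poly_roots_finite by blast
  then have "coeff p e = 0" by simp
  then have "(\<Sum>x\<in>A. if n x = e then c x else 0) = 0"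
    by (simp add: p_def coeff_sum coeff_monom)
  then show ?thesis using A by (simp add: sum.inter_filter)
qed

lemma digits_unique:
  fixes K K' :: "nat \<Rightarrow> nat"
  assumes "\<forall>i<n. K i < M" "\<forall>i<n. K' i < M" "(\<Sum>i<n. K i * M ^ i) = (\<Sum>i<n. K' i * M ^ i)"
  shows "\<forall>i<n. K i = K' i"
  using assms
proof (induction n arbitrary: K K')
  case (Suc n)
  have e: "(\<Sum>i<Suc n. K i * M ^ i) = K 0 + M * (\<Sum>i<n. K (Suc i) * M ^ i)" for K :: "nat \<Rightarrow> nat"
    unfolding sum.lessThan_Suc_shift by (simp add: sum_distrib_left mult_ac)
  have lt: "K 0 < M" "K' 0 < M" using Suc.prems by auto
  have eq: "K 0 + M * (\<Sum>i<n. K (Suc i) * M ^ i) = K' 0 + M * (\<Sum>i<n. K' (Suc i) * M ^ i)"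
    using Suc.prems(3) unfolding e .
  have 0: "K 0 = K' 0" using arg_cong[OF eq, of "\<lambda>x. x mod M"] lt by simp
  then have "(\<Sum>i<n. K (Suc i) * M ^ i) = (\<Sum>i<n. K' (Suc i) * M ^ i)" using eq lt by simp
  then have "\<forall>i<n. K (Suc i) = K' (Suc i)"
    using Suc.prems by (intro Suc.IH) auto
  then show ?case using 0 by (auto simp: less_Suc_eq_0_disj)
qed simp

lemma finite_pair_degree: "finite {x \<in> multi_indices N \<times> multi_indices N. pair_degree N x = d}"
proof -
  have "fst x i \<le> d \<and> snd x i \<le> d" if "x \<in> multi_indices N \<times> multi_indices N" "pair_degree N x = d" for x i
  proof (cases "i \<in> {1..N}")
    case True
    then have "fst x i + snd x i \<le> pair_degree N x"
      unfolding pair_degree_def by (intro member_le_sum) auto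
    then show ?thesis using that by simp
  next
    case False
    then show ?thesis using that by (auto simp: multi_indices_def)
  qed
  then have "{x \<in> multi_indices N \<times> multi_indices N. pair_degree N x = d} \<subseteq>
      {K \<in> multi_indices N. \<forall>i. K i \<le> d} \<times> {K \<in> multi_indices N. \<forall>i. K i \<le> d}"
    by (auto simp: mem_Times_iff)
  then show ?thesis by (rule finite_subset) (intro finite_cartesian_product finite_multi_indices_bounded)
qed

text \<open>Kronecker substitution \<open>\<beta>\<^sub>i = \<xi>^(M^i)\<close> separates the finitely many monomials of a given degree;
  then the polynomial in \<open>\<xi>\<close> and its conjugate is resolved in polar coordinates.\<close>

lemma homogeneous_unique:
  assumes e: "0 < e"
    and z: "\<And>\<beta>. (\<forall>i\<in>{1..N}. \<beta> i \<noteq> 0 \<and> cmod (\<beta> i) < e) \<Longrightarrow>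
      (\<Sum>x\<in>{x \<in> multi_indices N \<times> multi_indices N. pair_degree N x = d}. D x * monomial N \<beta> x) = 0"
    and x: "x \<in> multi_indices N \<times> multi_indices N" "pair_degree N x = d"
  shows "D x = 0"
proof -
  let ?A = "{x \<in> multi_indices N \<times> multi_indices N. pair_degree N x = d}"
  \<comment> \<open>All exponents are at most the degree \<open>d\<close> and hence are digits in
    base \<open>M\<close>.\<close>
  define M where "M = Suc d"
  define p where "p K = (\<Sum>i=1..N. K i * M ^ i)" for K :: "nat \<Rightarrow> nat"
  have le_d: "fst y i < M \<and> snd y i < M" if "y \<in> ?A" for y i
  proof (cases "i \<in> {1..N}")
    case True
    then have "fst y i + snd y i \<le> pair_degree N y"
      unfolding pair_degree_def by (intro member_le_sum) auto
    then show ?thesis using that by (simp add: M_def)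
  next
    case False
    then show ?thesis using that by (auto simp: multi_indices_def M_def)
  qed
  have p_inj: "K = K'" if "p K = p K'" "K \<in> multi_indices N" "K' \<in> multi_indices N" "\<forall>i. K i < M" "\<forall>i. K' i < M" for K K'
  proof -
    have e: "p K = (\<Sum>i<Suc N. K i * M ^ i)" if "K \<in> multi_indices N" for K
    proof -
      have "{..<Suc N} = insert 0 {1..N}" by auto
      then show ?thesis using that by (simp add: p_def multi_indices_def)
    qed
    have "\<forall>i<Suc N. K i = K' i"
      by (rule digits_unique[of _ _ M]) (use that e in auto)
    moreover have "K i = K' i" if "\<not> i < Suc N" for i
      using that \<open>K \<in> multi_indices N\<close> \<open>K' \<in> multi_indices N\<close> by (simp add: multi_indices_def)
    ultimately show ?thesis by (auto simp: fun_eq_iff)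
  qed
  have fin: "finite ?A" by (rule finite_pair_degree)
  define \<delta> where "\<delta> = min e 1"
  have \<delta>: "0 < \<delta>" "\<delta> \<le> e" "\<delta> \<le> 1" using e by (auto simp: \<delta>_def)
  have sub: "(\<Sum>y\<in>?A. (D y * \<tau> ^ p (fst y) * cnj \<tau> ^ p (snd y)) * t ^ (p (fst y) + p (snd y))) = 0"
    if \<tau>: "cmod \<tau> = 1" and t: "t \<in> of_real ` {0<..<\<delta>}" for \<tau> t
  proof -
    obtain \<rho> where \<rho>: "t = of_real \<rho>" "0 < \<rho>" "\<rho> < \<delta>" using t by auto
    define \<beta> where "\<beta> i = (of_real \<rho> * \<tau>) ^ (M ^ i)" for i :: nat
    have "cmod (\<beta> i) < e \<and> \<beta> i \<noteq> 0" for i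
    proof -
      have "cmod (\<beta> i) = \<rho> ^ (M ^ i)" using \<rho> \<tau> by (simp add: \<beta>_def norm_power norm_mult)
      also have "\<dots> \<le> \<rho> ^ 1" using \<rho> \<delta> by (intro power_decreasing) (auto simp: M_def)
      finally show ?thesis using \<rho> \<delta> \<tau> by (auto simp: \<beta>_def)
    qed
    then have "(\<Sum>y\<in>?A. D y * monomial N \<beta> y) = 0" by (intro z) auto
    moreover have "monomial N \<beta> y = (\<tau> ^ p (fst y) * cnj \<tau> ^ p (snd y)) * t ^ (p (fst y) + p (snd y))" for y
    proof -
      have 1: "(\<Prod>i=1..N. \<beta> i ^ K i) = (of_real \<rho> * \<tau>) ^ p K" for K
        by (simp add: \<beta>_def p_def power_mult[symmetric] power_sum mult.commute)
      have "(\<Prod>i=1..N. cnj (\<beta> i) ^ K i) = cnj ((of_real \<rho> * \<tau>) ^ p K)" for K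
        by (simp add: 1[symmetric])
      then show ?thesis
        unfolding monomial_def 1 by (simp add: \<rho>(1) power_mult_distrib power_add mult_ac)
    qed
    ultimately show ?thesis by (simp add: mult_ac)
  qed
  have inf1: "infinite (of_real ` {0<..<\<delta>} :: complex set)"
    using \<delta> by (subst finite_image_iff) (auto simp: inj_on_def)
  \<comment> \<open>The modulus separates only the sum of the two Kronecker exponents; the phase
    then separates the summands.\<close>
  define k where "k = p (fst x) + p (snd x)"
  have s1: "(\<Sum>y\<in>{y\<in>?A. p (fst y) + p (snd y) = k}. D y * \<tau> ^ p (fst y) * cnj \<tau> ^ p (snd y)) = 0"
    if "cmod \<tau> = 1" for \<tau>
    by (rule finite_sum_powers_zero[OF fin inf1]) (rule sub[OF that])
  let ?A' = "{y\<in>?A. p (fst y) + p (snd y) = k}"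
  \<comment> \<open>On the unit circle multiplication by \<open>\<tau> ^ k\<close> cancels the
    conjugates and leaves a polynomial in \<tau>.\<close>
  have s2: "(\<Sum>y\<in>?A'. D y * \<tau> ^ (2 * p (fst y))) = 0" if \<tau>: "\<tau> \<in> sphere 0 1" for \<tau>
  proof -
    have u: "cnj \<tau> * \<tau> = 1" using \<tau> by (simp add: mult.commute complex_norm_square[symmetric])
    have tk: "D y * \<tau> ^ p (fst y) * cnj \<tau> ^ p (snd y) * \<tau> ^ k = D y * \<tau> ^ (2 * p (fst y))"
      if "p (fst y) + p (snd y) = k" for y
    proof -
      have "cnj \<tau> ^ p (snd y) * \<tau> ^ p (snd y) = 1" using u by (simp add: power_mult_distrib[symmetric])
      then show ?thesis by (simp add: that[symmetric] power_add mult_2 mult_ac)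
    qed
    have "(\<Sum>y\<in>?A'. D y * \<tau> ^ (2 * p (fst y))) = (\<Sum>y\<in>?A'. D y * \<tau> ^ p (fst y) * cnj \<tau> ^ p (snd y)) * \<tau> ^ k"
      unfolding sum_distrib_right by (rule sum.cong[OF refl], rule sym, rule tk) simp
    also have "\<dots> = 0" using s1[of \<tau>] \<tau> by simp
    finally show ?thesis .
  qed
  have fin': "finite ?A'" by (rule finite_subset[OF _ fin]) auto
  have inf2: "infinite (sphere 0 1 :: complex set)"
  proof
    assume "finite (sphere 0 1 :: complex set)"
    moreover have "connected (sphere 0 1 :: complex set)" by (rule connected_sphere) simp
    ultimately obtain u :: complex where "sphere 0 1 \<subseteq> {u}"
      using connected_finite_iff_sing by fastforce
    moreover have "1 \<in> sphere (0::complex) 1" "-1 \<in> sphere (0::complex) 1" by auto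
    ultimately have "1 = u" "-1 = u" by blast+
    then show False by simp
  qed
  have "(\<Sum>y\<in>{y\<in>?A'. 2 * p (fst y) = 2 * p (fst x)}. D y) = 0"
    by (rule finite_sum_powers_zero[OF _ inf2]) (use fin' s2 in auto)
  moreover have "{y\<in>?A'. 2 * p (fst y) = 2 * p (fst x)} = {x}"
  proof
    show "{y\<in>?A'. 2 * p (fst y) = 2 * p (fst x)} \<subseteq> {x}"
    proof
      fix y assume y: "y \<in> {y\<in>?A'. 2 * p (fst y) = 2 * p (fst x)}"
      then have "p (fst y) = p (fst x)" "p (snd y) = p (snd x)" by (auto simp: k_def)
      then have "fst y = fst x" "snd y = snd x"
        using y x le_d[of y] le_d[of x] by (auto intro!: p_inj simp: mem_Times_iff)
      then show "y \<in> {x}" by (simp add: prod_eq_iff)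
    qed
  qed (use x in \<open>auto simp: k_def\<close>)
  ultimately show ?thesis by simp
qed

lemma power_series_zero:
  fixes a :: "nat \<Rightarrow> complex"
  assumes "\<And>t::real. 0 < t \<Longrightarrow> t \<le> 1 \<Longrightarrow> (\<lambda>n. of_real t ^ n * a n) sums 0"
  shows "a n = 0"
proof (rule ccontr)
  assume an: "a n \<noteq> 0"
  \<comment> \<open>The index shift multiplies the series by z, so that it vanishes at 0 and
    \<open>powser_0_nonzero\<close> isolates this zero.\<close>
  define b where "b n = (if n = 0 then 0 else a (n - 1))" for n
  have "summable a" using assms[of 1] by (simp add: sums_iff)
  then have "summable (\<lambda>n. a n * 1 ^ n)" by simp
  then have sm: "summable (\<lambda>n. a n * z ^ n)" if "cmod z < 1" for z
    by (rule powser_inside) (use that in simp)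
  define F where "F z = suminf (\<lambda>n. b n * z ^ n)" for z
  have Fs: "(\<lambda>n. b n * z ^ n) sums (z * suminf (\<lambda>n. a n * z ^ n))" if "cmod z < 1" for z
  proof -
    have "(\<lambda>n. z * (a n * z ^ n)) sums (z * suminf (\<lambda>n. a n * z ^ n))"
      by (rule sums_mult[OF summable_sums[OF sm[OF that]]])
    then have "(\<lambda>n. b (Suc n) * z ^ Suc n) sums (z * suminf (\<lambda>n. a n * z ^ n))"
      by (simp add: b_def mult_ac)
    then show ?thesis by (subst (asm) sums_Suc_iff) (simp add: b_def)
  qed
  have F: "F z = z * suminf (\<lambda>n. a n * z ^ n)" if "cmod z < 1" for z
    using Fs[OF that] by (simp add: F_def sums_iff)
  obtain s where s: "0 < s" "\<And>z. z \<in> cball 0 s - {0} \<Longrightarrow> F z \<noteq> 0"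
  proof (rule powser_0_nonzero[of 1 0 b F "Suc n"])
    show "(\<lambda>n. b n * (z - 0) ^ n) sums F z" if "norm (z - 0) < 1" for z
      using Fs[of z] F[of z] that by simp
    show "F 0 = 0" using F[of 0] by simp
    show "b (Suc n) \<noteq> 0" using an by (simp add: b_def)
  qed auto
  define t where "t = min (s/2) (1/2)"
  have t: "0 < t" "t < 1" "t \<le> s" using s by (auto simp: t_def)
  have "suminf (\<lambda>n. a n * of_real t ^ n) = 0"
    using assms[of t] t by (simp add: sums_iff mult.commute)
  then have "F (of_real t) = 0" using F[of "of_real t"] t by simp
  then show False using s(2)[of "of_real t"] t by simp
qed

lemma has_sum_by_degree:
  assumes "((\<lambda>x. D x * monomial N (\<lambda>i. of_real t * \<beta> i) x) has_sum F) (multi_indices N \<times> multi_indices N)"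
  shows "((\<lambda>d. of_real t ^ d * (\<Sum>x\<in>{x \<in> multi_indices N \<times> multi_indices N. pair_degree N x = d}.
    D x * monomial N \<beta> x)) has_sum F) UNIV"
proof -
  let ?MI = "multi_indices N \<times> multi_indices N"
  let ?A = "\<lambda>d. {x \<in> ?MI. pair_degree N x = d}"
  let ?b = "\<lambda>i. of_real t * \<beta> i"
  have bij: "bij_betw snd (Sigma UNIV ?A) ?MI"
    by (rule bij_betw_byWitness[where f' = "\<lambda>x. (pair_degree N x, x)"]) auto
  have "((\<lambda>y. D (snd y) * monomial N ?b (snd y)) has_sum F) (Sigma UNIV ?A)"
    using assms has_sum_reindex_bij_betw[OF bij, of "\<lambda>x. D x * monomial N ?b x" F] by simp
  then show ?thesis
  proof (rule has_sum_SigmaD)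
    fix d
    show "((\<lambda>x. D (snd (d, x)) * monomial N ?b (snd (d, x))) has_sum
        of_real t ^ d * (\<Sum>x\<in>?A d. D x * monomial N \<beta> x)) (?A d)"
      by (rule has_sum_finiteI[OF finite_pair_degree])
        (auto simp: monomial_scale sum_distrib_left intro!: sum.cong)
  qed
qed

text \<open>On a ray the series is a power series in the parameter whose coefficients are the
  homogeneous parts. Only points with nonzero coordinates are used, because a vanishing
  \<open>\<beta>\<^sub>i\<close> with i < N is a collision of vortices.\<close>

lemma series_unique:
  assumes e: "0 < e"
    and z: "\<And>\<beta>. (\<forall>i\<in>{1..N}. \<beta> i \<noteq> 0 \<and> cmod (\<beta> i) < e) \<Longrightarrow>
      ((\<lambda>x. D x * monomial N \<beta> x) has_sum 0) (multi_indices N \<times> multi_indices N)"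
    and x: "x \<in> multi_indices N \<times> multi_indices N"
  shows "D x = 0"
proof (rule homogeneous_unique[OF e _ x refl])
  fix \<beta> assume \<beta>: "\<forall>i\<in>{1..N}. \<beta> i \<noteq> 0 \<and> cmod (\<beta> i) < e"
  show "(\<Sum>x\<in>{y \<in> multi_indices N \<times> multi_indices N. pair_degree N y = pair_degree N x}. D x * monomial N \<beta> x) = 0"
  proof (rule power_series_zero)
    fix t :: real assume t: "0 < t" "t \<le> 1"
    have "cmod (of_real t * \<beta> i) < e \<and> of_real t * \<beta> i \<noteq> 0" if "i \<in> {1..N}" for i
    proof -
      have "t * cmod (\<beta> i) \<le> 1 * cmod (\<beta> i)" using t by (intro mult_right_mono) auto
      moreover have "cmod (\<beta> i) < e \<and> \<beta> i \<noteq> 0" using \<beta> that by blast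
      ultimately have "t * cmod (\<beta> i) < e" by linarith
      then show ?thesis using \<beta> that t by (simp add: norm_mult)
    qed
    then show "(\<lambda>d. of_real t ^ d * (\<Sum>x\<in>{y \<in> multi_indices N \<times> multi_indices N. pair_degree N y = d}. D x * monomial N \<beta> x)) sums 0"
      by (intro has_sum_imp_sums has_sum_by_degree z) auto
  qed
qed

text \<open>Absolute convergence at the positive radius \<open>r\<close> makes the coefficients
  summable over each fibre of \<open>E\<close>, so a family can be grouped by its monomials.\<close>

lemma rep_coefficients:
  assumes r: "0 < r" and f: "rep N r X f B" and X: "X \<subseteq> multi_indices N \<times> multi_indices N"
  obtains C where "\<And>x. x \<notin> X \<Longrightarrow> C x = 0"
    "\<And>\<beta>. \<beta> \<in> closed_polydisc N r \<Longrightarrow>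
      ((\<lambda>x. C x * monomial N \<beta> x) has_sum f \<beta>) (multi_indices N \<times> multi_indices N)"
proof -
  define T where "T = multi_indices N \<times> multi_indices N"
  have XT: "X \<subseteq> T" using X by (simp add: T_def)
  obtain c E s where cX: "\<And>n::nat. c n \<noteq> 0 \<Longrightarrow> E n \<in> X"
     and s: "((\<lambda>n. cmod (c n) * r ^ pair_degree N (E n)) has_sum s) UNIV"
     and fs: "\<And>\<beta>. \<beta>\<in>closed_polydisc N r \<Longrightarrow> ((\<lambda>n. c n * monomial N \<beta> (E n)) has_sum f \<beta>) UNIV"
    using f unfolding rep_def by blast
  let ?A = "\<lambda>x. {n. c n \<noteq> 0 \<and> E n = x}"
  define C where "C x = infsum c (?A x)" for x
  have C: "(c has_sum C x) (?A x)" for x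
  proof -
    have "(\<lambda>n. cmod (c n) * r ^ pair_degree N (E n)) summable_on ?A x"
      by (rule summable_on_subset_banach[of _ UNIV]) (use s in \<open>auto simp: summable_on_def\<close>)
    then have "(\<lambda>n. cmod (c n) * r ^ pair_degree N x) summable_on ?A x"
      by (rule summable_on_cong[THEN iffD1, rotated]) auto
    then have "(\<lambda>n. (cmod (c n) * r ^ pair_degree N x) * (1 / r ^ pair_degree N x)) summable_on ?A x"
      by (rule summable_on_cmult_left)
    then have "(\<lambda>n. cmod (c n)) summable_on ?A x" using r by simp
    then have "c summable_on ?A x" by (rule abs_summable_summable)
    then show ?thesis unfolding C_def by (rule has_sum_infsum)
  qed
  show ?thesis
  proof (rule that[of C])
    show "C x = 0" if "x \<notin> X" for x
    proof -
      have "?A x = {}" using cX that by auto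
      then show ?thesis unfolding C_def by (simp only: infsum_empty)
    qed
    fix \<beta> assume \<beta>: "\<beta> \<in> closed_polydisc N r"
    have "((\<lambda>n. c n * monomial N \<beta> (E n)) has_sum f \<beta>) {n. c n \<noteq> 0}"
      using fs[OF \<beta>] by (subst has_sum_cong_neutral[of UNIV _ _ "\<lambda>n. c n * monomial N \<beta> (E n)"]) auto
    moreover have bij: "bij_betw snd (Sigma T ?A) {n. c n \<noteq> 0}"
      by (rule bij_betw_byWitness[where f' = "\<lambda>n. (E n, n)"]) (use cX XT in auto)
    ultimately have "((\<lambda>y. c (snd y) * monomial N \<beta> (E (snd y))) has_sum f \<beta>) (Sigma T ?A)"
      using has_sum_reindex_bij_betw[OF bij, of "\<lambda>n. c n * monomial N \<beta> (E n)" "f \<beta>"] by simp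
    then show "((\<lambda>x. C x * monomial N \<beta> x) has_sum f \<beta>) (multi_indices N \<times> multi_indices N)"
      unfolding T_def[symmetric]
    proof (rule has_sum_SigmaD)
      fix x
      have "((\<lambda>n. c n * monomial N \<beta> x) has_sum C x * monomial N \<beta> x) (?A x)"
        by (rule has_sum_cmult_left[OF C])
      then show "((\<lambda>n. c (snd (x, n)) * monomial N \<beta> (E (snd (x, n)))) has_sum C x * monomial N \<beta> x) (?A x)"
        by (rule has_sum_cong[THEN iffD1, rotated]) auto
    qed
  qed
qed

text \<open>A series known at nonzero points only inherits both properties of a representation of
  its sum: the restriction on the exponents, and the value at points where coordinates
  vanish.\<close>

lemma rep_identify:
  assumes r: "0 < r" and f: "rep N r X f B" and X: "X \<subseteq> multi_indices N \<times> multi_indices N"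
    and R: "\<And>\<beta>. (\<forall>i\<in>{1..N}. \<beta> i \<noteq> 0 \<and> cmod (\<beta> i) < r) \<Longrightarrow>
      ((\<lambda>x. R x * monomial N \<beta> x) has_sum f \<beta>) (multi_indices N \<times> multi_indices N)"
  shows "\<And>x. x \<in> multi_indices N \<times> multi_indices N \<Longrightarrow> x \<notin> X \<Longrightarrow> R x = 0"
    "\<And>\<beta>. \<beta> \<in> closed_polydisc N r \<Longrightarrow>
      ((\<lambda>x. R x * monomial N \<beta> x) has_sum f \<beta>) (multi_indices N \<times> multi_indices N)"
proof -
  let ?MI = "multi_indices N \<times> multi_indices N"
  obtain C where C: "\<And>x. x \<notin> X \<Longrightarrow> C x = 0"
    "\<And>\<beta>. \<beta> \<in> closed_polydisc N r \<Longrightarrow> ((\<lambda>x. C x * monomial N \<beta> x) has_sum f \<beta>) ?MI"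
    using rep_coefficients[OF r f X] by metis
  have eq: "R x = C x" if "x \<in> ?MI" for x
  proof -
    have "R x - C x = 0"
    proof (rule series_unique[OF r _ that])
      fix \<beta> assume \<beta>: "\<forall>i\<in>{1..N}. \<beta> i \<noteq> 0 \<and> cmod (\<beta> i) < r"
      then have "\<beta> \<in> closed_polydisc N r" by (auto simp: closed_polydisc_def)
      from has_sum_add[OF R[OF \<beta>] has_sum_cmult_right[OF C(2)[OF this], of "-1"]]
      show "((\<lambda>x. (R x - C x) * monomial N \<beta> x) has_sum 0) ?MI" by (simp add: left_diff_distrib)
    qed
    then show ?thesis by simp
  qed
  show "R x = 0" if "x \<in> ?MI" "x \<notin> X" for x using eq C(1) that by simp
  show "((\<lambda>x. R x * monomial N \<beta> x) has_sum f \<beta>) ?MI" if "\<beta> \<in> closed_polydisc N r" for \<beta>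
    using C(2)[OF that] by (rule has_sum_cong[THEN iffD1, rotated]) (simp add: eq)
qed

section \<open>The regular part of Green's function\<close>

lemma harmonic_onE:
  assumes "harmonic_on u \<Omega>"
  obtains ux uy uxx uxy uyx uyy where
    "continuous_on \<Omega> uxx" "continuous_on \<Omega> uxy" "continuous_on \<Omega> uyx" "continuous_on \<Omega> uyy"
    "\<forall>z\<in>\<Omega>. (u has_derivative (\<lambda>h. ux z * Re h + uy z * Im h)) (at z) \<and>
             (ux has_derivative (\<lambda>h. uxx z * Re h + uxy z * Im h)) (at z) \<and>
             (uy has_derivative (\<lambda>h. uyx z * Re h + uyy z * Im h)) (at z) \<and>
             uxx z + uyy z = 0"
  using assms unfolding harmonic_on_def by (elim exE conjE) (rule that)

lemma has_real_derivative_along_line: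
  fixes f :: "complex \<Rightarrow> real"
  assumes "(f has_derivative (\<lambda>h. a * Re h + b * Im h)) (at (p + c * of_real t))"
  shows "((\<lambda>t. f (p + c * of_real t)) has_real_derivative (a * Re c + b * Im c)) (at t)"
proof -
  have "((\<lambda>t. p + c * complex_of_real t) has_derivative (\<lambda>h. c * of_real h)) (at t)"
    by (auto intro!: derivative_eq_intros)
  from has_derivative_compose[OF this assms] show ?thesis
    unfolding has_field_derivative_def by (rule has_derivative_eq_rhs) (auto simp: algebra_simps)
qed

lemma second_derivative_nonpos_at_max:
  fixes g g' :: "real \<Rightarrow> real"
  assumes d: "0 < d" and g: "\<And>t. \<bar>t\<bar> < d \<Longrightarrow> (g has_real_derivative g' t) (at t)"
    and D: "(g' has_real_derivative D) (at 0)" and max: "\<And>t. \<bar>t\<bar> < d \<Longrightarrow> g t \<le> g 0"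
  shows "D \<le> 0"
proof (rule ccontr)
  assume "\<not> D \<le> 0"
  then obtain e where e: "0 < e" "\<And>h. 0 < h \<Longrightarrow> h < e \<Longrightarrow> g' 0 < g' h"
    using DERIV_pos_inc_right[OF D] by auto
  have g0: "g' 0 = 0"
    by (rule DERIV_local_max[OF g[of 0] d]) (use d max in auto)
  define t where "t = min d e / 2"
  have t: "0 < t" "t < d" "t < e" using d e by (auto simp: t_def)
  obtain z where z: "0 < z" "z < t" "g t - g 0 = (t - 0) * g' z"
    using MVT2[of 0 t g g'] t g by auto
  have "0 < g' z" using e(2)[of z] z t g0 by auto
  then have "0 < (t - 0) * g' z" using t by simp
  then show False using z(3) max[of t] t by auto
qed

text \<open>If a value M were positive, adding a small multiple of the squared modulus would give a
  function with positive Laplacian and an interior maximum; second derivatives in the two coordinate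
  directions contradict this. Smallness outside compact sets replaces any assumption on the
  boundary.\<close>

lemma harmonic_nonpos:
  assumes \<Omega>: "open \<Omega>" and u: "harmonic_on u \<Omega>"
    and bd: "\<And>\<epsilon>. 0 < \<epsilon> \<Longrightarrow> \<exists>C. compact C \<and> C \<subseteq> \<Omega> \<and> (\<forall>z\<in>\<Omega> - C. \<bar>u z\<bar> < \<epsilon>)"
    and z: "z \<in> \<Omega>"
  shows "u z \<le> 0"
proof (rule ccontr)
  assume "\<not> u z \<le> 0"
  then have M: "0 < u z" by simp
  define M where "M = u z"
  obtain C where C: "compact C" "C \<subseteq> \<Omega>" "\<And>y. y \<in> \<Omega> - C \<Longrightarrow> \<bar>u y\<bar> < M / 3"
    using bd[of "M / 3"] M by (auto simp: M_def)
  have zC: "z \<in> C" using C(3)[of z] z M by (auto simp: M_def)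
  obtain b where b: "0 < b" "\<And>y. y \<in> C \<Longrightarrow> cmod y \<le> b"
    using compact_imp_bounded[OF C(1)] by (auto simp: bounded_pos)
  \<comment> \<open>Chosen so that the added term is at most M / 3 on \<open>C\<close>, which keeps
    u above M / 3 at the maximum of v.\<close>
  define \<delta> where "\<delta> = M / (3 * b\<^sup>2)"
  have \<delta>: "0 < \<delta>" using M b by (simp add: \<delta>_def M_def)
  have \<delta>b: "\<delta> * (cmod y)\<^sup>2 \<le> M / 3" if "y \<in> C" for y
  proof -
    have "(cmod y)\<^sup>2 \<le> b\<^sup>2" using b(2)[OF that] by (intro power_mono) auto
    then have "\<delta> * (cmod y)\<^sup>2 \<le> \<delta> * b\<^sup>2" using \<delta> by (intro mult_left_mono) auto
    then show ?thesis using b by (simp add: \<delta>_def)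
  qed
  obtain ux uy uxx uxy uyx uyy where
    d: "\<forall>z\<in>\<Omega>. (u has_derivative (\<lambda>h. ux z * Re h + uy z * Im h)) (at z) \<and>
             (ux has_derivative (\<lambda>h. uxx z * Re h + uxy z * Im h)) (at z) \<and>
             (uy has_derivative (\<lambda>h. uyx z * Re h + uyy z * Im h)) (at z) \<and>
             uxx z + uyy z = 0"
    by (rule harmonic_onE[OF u])
  have du: "(u has_derivative (\<lambda>h. ux y * Re h + uy y * Im h)) (at y)"
    and dux: "(ux has_derivative (\<lambda>h. uxx y * Re h + uxy y * Im h)) (at y)"
    and duy: "(uy has_derivative (\<lambda>h. uyx y * Re h + uyy y * Im h)) (at y)"
    and lap: "uxx y + uyy y = 0" if "y \<in> \<Omega>" for y
    using bspec[OF d that] by simp_all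
  define v where "v y = u y + \<delta> * (cmod y)\<^sup>2" for y
  have "continuous_on \<Omega> u"
    using du has_derivative_continuous by (intro continuous_at_imp_continuous_on) blast
  then have "continuous_on C u" using C(2) by (rule continuous_on_subset)
  then have "continuous_on C v" unfolding v_def by (intro continuous_intros)
  then obtain p where p: "p \<in> C" "\<And>y. y \<in> C \<Longrightarrow> v y \<le> v p"
    using continuous_attains_sup[OF C(1), of v] zC by blast
  have p\<Omega>: "p \<in> \<Omega>" using p C by blast
  have "M \<le> v p" using p(2)[OF zC] \<delta> by (auto simp: v_def M_def intro: order_trans[rotated])
  then have up: "M / 3 < u p" using \<delta>b[OF p(1)] M by (simp add: v_def M_def)
  have "open (\<Omega> \<inter> u -` {M / 3<..})"
    by (rule continuous_open_preimage[OF \<open>continuous_on \<Omega> u\<close> \<Omega>]) simp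
  moreover have "p \<in> \<Omega> \<inter> u -` {M / 3<..}" using up p\<Omega> by simp
  ultimately obtain \<eta> where \<eta>: "0 < \<eta>" "ball p \<eta> \<subseteq> \<Omega> \<inter> u -` {M / 3<..}"
    by (meson openE)
  \<comment> \<open>Outside \<open>C\<close> the function u stays below M / 3, so the whole ball
    lies in \<open>C\<close>, and the maximum over \<open>C\<close> is a local maximum in the
    plane.\<close>
  have vmax: "v y \<le> v p" if "y \<in> ball p \<eta>" for y
  proof -
    have "y \<in> \<Omega>" "M / 3 < u y" using that \<eta> by auto
    then have "y \<in> C" using C(3)[of y] by force
    then show ?thesis by (rule p(2))
  qed
  have v2: "v y = u y + \<delta> * ((Re y)\<^sup>2 + (Im y)\<^sup>2)" for y
    by (simp add: v_def cmod_power2)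
  have "uxx p + 2 * \<delta> \<le> 0"
  proof (rule second_derivative_nonpos_at_max[OF \<eta>(1), where g = "\<lambda>t. v (p + of_real t)"
        and g' = "\<lambda>t. ux (p + of_real t) + 2 * \<delta> * (Re p + t)"])
    fix t :: real assume t: "\<bar>t\<bar> < \<eta>"
    then have in_ball: "p + of_real t \<in> ball p \<eta>" by (simp add: dist_norm)
    then have in\<Omega>: "p + of_real t \<in> \<Omega>" using \<eta> by auto
    have "((\<lambda>t. u (p + of_real t)) has_real_derivative ux (p + of_real t)) (at t)"
      using has_real_derivative_along_line[of u _ _ p 1 t] du[OF in\<Omega>] by fastforce
    then show "((\<lambda>t. v (p + of_real t)) has_real_derivative ux (p + of_real t) + 2 * \<delta> * (Re p + t)) (at t)"
      unfolding v2 by (auto intro!: derivative_eq_intros)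
    show "v (p + of_real t) \<le> v (p + of_real 0)" using vmax[OF in_ball] by simp
  next
    have "((\<lambda>t. ux (p + of_real t)) has_real_derivative uxx p) (at 0)"
      using has_real_derivative_along_line[of ux _ _ p 1 0] dux[OF p\<Omega>] by fastforce
    then show "((\<lambda>t. ux (p + of_real t) + 2 * \<delta> * (Re p + t)) has_real_derivative uxx p + 2 * \<delta>) (at 0)"
      by (auto intro!: derivative_eq_intros)
  qed
  moreover have "uyy p + 2 * \<delta> \<le> 0"
  proof (rule second_derivative_nonpos_at_max[OF \<eta>(1), where g = "\<lambda>t. v (p + \<i> * of_real t)"
        and g' = "\<lambda>t. uy (p + \<i> * of_real t) + 2 * \<delta> * (Im p + t)"])
    fix t :: real assume t: "\<bar>t\<bar> < \<eta>"
    then have in_ball: "p + \<i> * of_real t \<in> ball p \<eta>" by (simp add: dist_norm norm_mult)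
    then have in\<Omega>: "p + \<i> * of_real t \<in> \<Omega>" using \<eta> by auto
    have "((\<lambda>t. u (p + \<i> * of_real t)) has_real_derivative uy (p + \<i> * of_real t)) (at t)"
      using has_real_derivative_along_line[of u _ _ p \<i> t] du[OF in\<Omega>] by fastforce
    then show "((\<lambda>t. v (p + \<i> * of_real t)) has_real_derivative uy (p + \<i> * of_real t) + 2 * \<delta> * (Im p + t)) (at t)"
      unfolding v2 by (auto intro!: derivative_eq_intros)
    show "v (p + \<i> * of_real t) \<le> v (p + \<i> * of_real 0)" using vmax[OF in_ball] by simp
  next
    have "((\<lambda>t. uy (p + \<i> * of_real t)) has_real_derivative uyy p) (at 0)"
      using has_real_derivative_along_line[of uy _ _ p \<i> 0] duy[OF p\<Omega>] by fastforce
    then show "((\<lambda>t. uy (p + \<i> * of_real t) + 2 * \<delta> * (Im p + t)) has_real_derivative uyy p + 2 * \<delta>) (at 0)"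
      by (auto intro!: derivative_eq_intros)
  qed
  ultimately show False using lap[OF p\<Omega>] \<delta> by simp
qed

lemma harmonic_on_minus:
  assumes "harmonic_on u \<Omega>"
  shows "harmonic_on (\<lambda>z. - u z) \<Omega>"
proof -
  obtain ux uy uxx uxy uyx uyy where
    c: "continuous_on \<Omega> uxx" "continuous_on \<Omega> uxy" "continuous_on \<Omega> uyx" "continuous_on \<Omega> uyy"
    and d: "\<forall>z\<in>\<Omega>. (u has_derivative (\<lambda>h. ux z * Re h + uy z * Im h)) (at z) \<and>
             (ux has_derivative (\<lambda>h. uxx z * Re h + uxy z * Im h)) (at z) \<and>
             (uy has_derivative (\<lambda>h. uyx z * Re h + uyy z * Im h)) (at z) \<and>
             uxx z + uyy z = 0"
    by (rule harmonic_onE[OF assms])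
  show ?thesis
    unfolding harmonic_on_def
  proof (intro exI conjI ballI)
    show "continuous_on \<Omega> (\<lambda>z. - uxx z)" "continuous_on \<Omega> (\<lambda>z. - uxy z)"
      "continuous_on \<Omega> (\<lambda>z. - uyx z)" "continuous_on \<Omega> (\<lambda>z. - uyy z)"
      using c by (auto intro!: continuous_intros)
    fix z assume z: "z \<in> \<Omega>"
    have m: "((\<lambda>z. - f z) has_derivative (\<lambda>h. - a * Re h + - b * Im h)) (at z)"
      if "(f has_derivative (\<lambda>h. a * Re h + b * Im h)) (at z)" for f :: "complex \<Rightarrow> real" and a b
      using has_derivative_minus[OF that] by simp
    show "((\<lambda>z. - u z) has_derivative (\<lambda>h. - ux z * Re h + - uy z * Im h)) (at z)"
      "((\<lambda>z. - ux z) has_derivative (\<lambda>h. - uxx z * Re h + - uxy z * Im h)) (at z)"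
      "((\<lambda>z. - uy z) has_derivative (\<lambda>h. - uyx z * Re h + - uyy z * Im h)) (at z)"
      using bspec[OF d z] by (intro m; simp)+
    show "- uxx z + - uyy z = 0" using bspec[OF d z] by simp
  qed
qed

text \<open>By the Cauchy-Riemann equations the partial derivatives of the real part of g are
  \<open>Re (g1 z)\<close> and \<open>- Im (g1 z)\<close>; the same applied to g1 cancels the second
  derivatives.\<close>

lemma harmonic_on_diff_Re:
  assumes u: "harmonic_on u \<Omega>" and \<Omega>: "open \<Omega>" and g: "g holomorphic_on \<Omega>"
  shows "harmonic_on (\<lambda>z. u z - Re (g z)) \<Omega>"
proof -
  obtain ux uy uxx uxy uyx uyy where
    c: "continuous_on \<Omega> uxx" "continuous_on \<Omega> uxy" "continuous_on \<Omega> uyx" "continuous_on \<Omega> uyy"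
    and d: "\<forall>z\<in>\<Omega>. (u has_derivative (\<lambda>h. ux z * Re h + uy z * Im h)) (at z) \<and>
             (ux has_derivative (\<lambda>h. uxx z * Re h + uxy z * Im h)) (at z) \<and>
             (uy has_derivative (\<lambda>h. uyx z * Re h + uyy z * Im h)) (at z) \<and>
             uxx z + uyy z = 0"
    by (rule harmonic_onE[OF u])
  define g1 where "g1 = deriv g"
  define g2 where "g2 = deriv g1"
  have g1: "g1 holomorphic_on \<Omega>" unfolding g1_def by (rule holomorphic_deriv[OF g \<Omega>])
  have "g2 holomorphic_on \<Omega>" unfolding g2_def by (rule holomorphic_deriv[OF g1 \<Omega>])
  then have c2: "continuous_on \<Omega> g2" by (rule holomorphic_on_imp_continuous_on)
  have dg: "(g has_derivative (\<lambda>h. g1 z * h)) (at z)" if "z \<in> \<Omega>" for z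
    using holomorphic_derivI[OF g \<Omega> that] by (simp add: g1_def has_field_derivative_def)
  have dg1: "(g1 has_derivative (\<lambda>h. g2 z * h)) (at z)" if "z \<in> \<Omega>" for z
    using holomorphic_derivI[OF g1 \<Omega> that] by (simp add: g2_def has_field_derivative_def)
  have re: "((\<lambda>z. f z - Re (k z)) has_derivative (\<lambda>h. (a - Re b) * Re h + (a' + Im b) * Im h)) (at z)"
    if "(f has_derivative (\<lambda>h. a * Re h + a' * Im h)) (at z)" "(k has_derivative (\<lambda>h. b * h)) (at z)"
    for f :: "complex \<Rightarrow> real" and k a a' b z
    using has_derivative_diff[OF that(1) has_derivative_Re[OF that(2)]]
    by (rule has_derivative_eq_rhs) (auto simp: algebra_simps)
  have im: "((\<lambda>z. f z + Im (k z)) has_derivative (\<lambda>h. (a + Im b) * Re h + (a' + Re b) * Im h)) (at z)"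
    if "(f has_derivative (\<lambda>h. a * Re h + a' * Im h)) (at z)" "(k has_derivative (\<lambda>h. b * h)) (at z)"
    for f :: "complex \<Rightarrow> real" and k a a' b z
    using has_derivative_add[OF that(1) has_derivative_Im[OF that(2)]]
    by (rule has_derivative_eq_rhs) (auto simp: algebra_simps)
  show ?thesis
    unfolding harmonic_on_def
  proof (intro exI conjI ballI)
    show "continuous_on \<Omega> (\<lambda>z. uxx z - Re (g2 z))" "continuous_on \<Omega> (\<lambda>z. uxy z + Im (g2 z))"
      "continuous_on \<Omega> (\<lambda>z. uyx z + Im (g2 z))" "continuous_on \<Omega> (\<lambda>z. uyy z + Re (g2 z))"
      using c c2 by (auto intro!: continuous_intros)
    fix z assume z: "z \<in> \<Omega>"
    show "((\<lambda>z. u z - Re (g z)) has_derivative (\<lambda>h. (ux z - Re (g1 z)) * Re h + (uy z + Im (g1 z)) * Im h)) (at z)"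
      by (rule re[OF _ dg[OF z]]) (use bspec[OF d z] in simp)
    show "((\<lambda>z. ux z - Re (g1 z)) has_derivative (\<lambda>h. (uxx z - Re (g2 z)) * Re h + (uxy z + Im (g2 z)) * Im h)) (at z)"
      by (rule re[OF _ dg1[OF z]]) (use bspec[OF d z] in simp)
    show "((\<lambda>z. uy z + Im (g1 z)) has_derivative (\<lambda>h. (uyx z + Im (g2 z)) * Re h + (uyy z + Re (g2 z)) * Im h)) (at z)"
      by (rule im[OF _ dg1[OF z]]) (use bspec[OF d z] in simp)
    show "uxx z - Re (g2 z) + (uyy z + Re (g2 z)) = 0" using bspec[OF d z] by simp
  qed
qed

lemma harmonic_zero:
  assumes \<Omega>: "open \<Omega>" and u: "harmonic_on u \<Omega>"
    and bd: "\<And>\<epsilon>. 0 < \<epsilon> \<Longrightarrow> \<exists>C. compact C \<and> C \<subseteq> \<Omega> \<and> (\<forall>z\<in>\<Omega> - C. \<bar>u z\<bar> < \<epsilon>)"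
    and z: "z \<in> \<Omega>"
  shows "u z = 0"
proof -
  have "u z \<le> 0" by (rule harmonic_nonpos[OF \<Omega> u bd z])
  moreover have "- u z \<le> 0"
    by (rule harmonic_nonpos[OF \<Omega> harmonic_on_minus[OF u] _ z]) (use bd in simp)
  ultimately show ?thesis by simp
qed

section \<open>Green's function through the Riemann map\<close>

text \<open>The Blaschke factor has modulus one on the unit circle, so the part of a closed annulus
  where its logarithm is at least \<epsilon> is compact and misses the circle.\<close>

lemma Blaschke_log_small:
  assumes c: "cmod c < 1" and \<epsilon>: "0 < \<epsilon>"
  obtains K where "compact K" "K \<subseteq> ball 0 1" "c \<in> K"
    "\<forall>\<zeta>\<in>ball 0 1 - K. \<bar>ln (cmod ((\<zeta> - c) / (1 - \<zeta> * cnj c)))\<bar> < \<epsilon>"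
proof -
  \<comment> \<open>Any radius between \<open>cmod c\<close> and 1 keeps the zero of the Blaschke
    factor out of the annulus.\<close>
  define \<rho> where "\<rho> = (1 + cmod c) / 2"
  have \<rho>: "cmod c < \<rho>" "\<rho> < 1" using c by (auto simp: \<rho>_def)
  let ?A = "cball 0 1 - ball (0::complex) \<rho>"
  let ?f = "\<lambda>\<zeta>. \<bar>ln (cmod ((\<zeta> - c) / (1 - \<zeta> * cnj c)))\<bar>"
  have nz: "1 - \<zeta> * cnj c \<noteq> 0" if "cmod \<zeta> \<le> 1" for \<zeta>
  proof
    assume "1 - \<zeta> * cnj c = 0"
    then have "\<zeta> * cnj c = 1" by simp
    then have "cmod \<zeta> * cmod c = 1" by (metis complex_mod_cnj norm_mult norm_one)
    moreover have "cmod \<zeta> * cmod c \<le> 1 * cmod c" using that by (intro mult_right_mono) auto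
    ultimately show False using c by simp
  qed
  have nc: "\<zeta> - c \<noteq> 0" if "\<zeta> \<in> ?A" for \<zeta> using that \<rho> by auto
  have cont: "continuous_on ?A ?f"
    by (intro continuous_intros) (use nz nc in auto)
  have cA: "compact ?A" by (intro compact_diff) auto
  define K where "K = cball 0 \<rho> \<union> {\<zeta> \<in> ?A. \<epsilon> \<le> ?f \<zeta>}"
  have "closed {\<zeta> \<in> ?A. \<epsilon> \<le> ?f \<zeta>}"
  proof -
    have "closed (?A \<inter> ?f -` {\<epsilon>..})"
      by (rule continuous_closed_preimage[OF cont compact_imp_closed[OF cA]]) simp
    moreover have "?A \<inter> ?f -` {\<epsilon>..} = {\<zeta> \<in> ?A. \<epsilon> \<le> ?f \<zeta>}" by auto
    ultimately show ?thesis by simp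
  qed
  then have "compact {\<zeta> \<in> ?A. \<epsilon> \<le> ?f \<zeta>}"
    using cA by (metis (no_types, lifting) compact_Int_closed inf.absorb_iff2 mem_Collect_eq subsetI)
  then have "compact K" unfolding K_def by (intro compact_Un) auto
  moreover have "K \<subseteq> ball 0 1"
  proof
    fix \<zeta> assume "\<zeta> \<in> K"
    then show "\<zeta> \<in> ball 0 1"
      unfolding K_def
    proof
      assume *: "\<zeta> \<in> {\<zeta> \<in> ?A. \<epsilon> \<le> ?f \<zeta>}"
      show ?thesis
      proof (rule ccontr)
        assume "\<zeta> \<notin> ball 0 1"
        then have one: "cmod \<zeta> = 1" using * by auto
        then have "\<zeta> * cnj \<zeta> = 1" by (simp add: complex_norm_square[symmetric])
        then have "\<zeta> - c = \<zeta> * cnj (1 - \<zeta> * cnj c)" by (simp add: algebra_simps)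
        then have "cmod (\<zeta> - c) = cmod (1 - \<zeta> * cnj c)" using one by (metis complex_mod_cnj mult_1 norm_mult)
        then have "?f \<zeta> = 0" using nz[of \<zeta>] one by (simp add: norm_divide)
        then show False using * \<epsilon> by simp
      qed
    qed (use \<rho> in auto)
  qed
  moreover have "c \<in> K" using \<rho> by (simp add: K_def)
  moreover have "?f \<zeta> < \<epsilon>" if "\<zeta> \<in> ball 0 1 - K" for \<zeta>
    using that by (auto simp: K_def)
  ultimately show ?thesis using that by blast
qed

text \<open>The difference quotient of \<phi>, continued over the diagonal, divided by
  \<open>1 - \<phi> y * cnj (\<phi> w)\<close> is holomorphic without zeros, hence
  \<open>exp h\<close> on a simply connected domain. Then \<gamma> minus
  \<open>Re h / (2 * pi)\<close> is harmonic. Away from \<open>w\<close> it is Green's function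
  minus the scaled logarithm of a Blaschke factor composed with \<phi>; both become small near the
  boundary, so it vanishes.\<close>

theorem regular_part_formula:
  assumes \<Omega>: "open \<Omega>" "simply_connected \<Omega>" and \<gamma>: "green_regular_part \<Omega> \<gamma>"
    and \<phi>: "biholomorphic \<Omega> (ball 0 1) \<phi>" and w: "w \<in> \<Omega>" and z: "z \<in> \<Omega>"
  shows "\<gamma> z w = 1 / (2 * pi) * (ln (cmod (if z = w then deriv \<phi> w else (\<phi> z - \<phi> w) / (z - w)))
    - ln (cmod (1 - \<phi> z * cnj (\<phi> w))))"
proof -
  have hol: "\<phi> holomorphic_on \<Omega>" and bij: "bij_betw \<phi> \<Omega> (ball 0 1)"
    and inv: "inv_into \<Omega> \<phi> holomorphic_on ball 0 1"
    using \<phi> by (auto simp: biholomorphic_def)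
  have inj: "inj_on \<phi> \<Omega>" using bij by (rule bij_betw_imp_inj_on)
  have b1: "cmod (\<phi> y) < 1" if "y \<in> \<Omega>" for y
    using bij_betwE[OF bij] that by auto
  define q where "q y = (if y = w then deriv \<phi> w else (\<phi> y - \<phi> w) / (y - w))" for y
  define m where "m y = q y / (1 - \<phi> y * cnj (\<phi> w))" for y
  have "(\<lambda>y. \<phi> y - \<phi> w) holomorphic_on \<Omega>" using hol by (intro holomorphic_intros)
  then have q_hol: "q holomorphic_on \<Omega>"
  proof (rule pole_theorem_open_0[OF _ \<Omega>(1), where a = w])
    have "\<phi> field_differentiable at w"
      using hol \<Omega>(1) w holomorphic_on_imp_differentiable_at by blast
    then show "q w = deriv (\<lambda>y. \<phi> y - \<phi> w) w" by (simp add: q_def)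
  qed (auto simp: q_def)
  have nz: "1 - \<phi> y * cnj (\<phi> w) \<noteq> 0" if "y \<in> \<Omega>" for y
  proof
    assume "1 - \<phi> y * cnj (\<phi> w) = 0"
    then have "\<phi> y * cnj (\<phi> w) = 1" by simp
    then have "cmod (\<phi> y) * cmod (\<phi> w) = 1" by (metis complex_mod_cnj norm_mult norm_one)
    moreover have "cmod (\<phi> y) * cmod (\<phi> w) \<le> 1 * cmod (\<phi> w)"
      using b1[OF that] by (intro mult_right_mono) auto
    ultimately show False using b1[OF w] by simp
  qed
  have q_nz: "q y \<noteq> 0" if "y \<in> \<Omega>" for y
    using holomorphic_injective_imp_regular[OF hol \<Omega>(1) inj w] inj_onD[OF inj _ that w]
    by (auto simp: q_def)
  have "m holomorphic_on \<Omega>" unfolding m_def using q_hol hol nz by (intro holomorphic_intros)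
  moreover have m_nz: "\<forall>y\<in>\<Omega>. m y \<noteq> 0" using nz q_nz by (simp add: m_def)
  ultimately obtain h where h: "h holomorphic_on \<Omega>" "\<forall>y\<in>\<Omega>. m y = exp (h y)"
    using \<Omega>(2) simply_connected_eq_holomorphic_log[OF \<Omega>(1)] by blast
  have ln_m: "ln (cmod (m y)) = Re (h y)" if "y \<in> \<Omega>" for y
    using h(2) that by (simp add: norm_exp_eq_Re)
  define u where "u y = \<gamma> y w - Re (h y / (2 * pi))" for y
  have \<gamma>h: "harmonic_on (\<lambda>y. \<gamma> y w) \<Omega>"
    and \<gamma>b: "\<And>\<epsilon>. 0 < \<epsilon> \<Longrightarrow> \<exists>C. compact C \<and> C \<subseteq> \<Omega> \<and> (\<forall>z\<in>\<Omega> - C. \<bar>green_function \<gamma> z w\<bar> < \<epsilon>)"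
    using \<gamma> w by (auto simp: green_regular_part_def)
  have u_h: "harmonic_on u \<Omega>"
    unfolding u_def using h(1) by (intro harmonic_on_diff_Re[OF \<gamma>h \<Omega>(1)] holomorphic_intros) auto
  have "u z = 0"
  proof (rule harmonic_zero[OF \<Omega>(1) u_h _ z])
    fix \<epsilon> :: real assume \<epsilon>: "0 < \<epsilon>"
    obtain C1 where C1: "compact C1" "C1 \<subseteq> \<Omega>" "\<forall>z\<in>\<Omega> - C1. \<bar>green_function \<gamma> z w\<bar> < \<epsilon> / 2"
      using \<gamma>b[of "\<epsilon> / 2"] \<epsilon> by auto
    \<comment> \<open>After division by \<open>2 * pi\<close> this bound leaves half of \<epsilon>;
      Green's function takes the other half.\<close>
    have "0 < pi * \<epsilon>" using \<epsilon> by simp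
    obtain K where K: "compact K" "K \<subseteq> ball 0 1" "\<phi> w \<in> K"
      "\<forall>\<zeta>\<in>ball 0 1 - K. \<bar>ln (cmod ((\<zeta> - \<phi> w) / (1 - \<zeta> * cnj (\<phi> w))))\<bar> < pi * \<epsilon>"
      by (rule Blaschke_log_small[OF b1[OF w] \<open>0 < pi * \<epsilon>\<close>])
    define C2 where "C2 = inv_into \<Omega> \<phi> ` K"
    have "compact C2" unfolding C2_def
      by (rule compact_continuous_image[OF continuous_on_subset[OF holomorphic_on_imp_continuous_on[OF inv] K(2)] K(1)])
    moreover have "C2 \<subseteq> \<Omega>"
      using K(2) bij by (auto simp: C2_def bij_betw_def intro!: inv_into_into)
    moreover have "\<bar>u y\<bar> < \<epsilon>" if y: "y \<in> \<Omega> - (C1 \<union> C2)" for y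
    proof -
      have nK: "\<phi> y \<notin> K"
      proof
        assume "\<phi> y \<in> K"
        then have "inv_into \<Omega> \<phi> (\<phi> y) \<in> C2" unfolding C2_def by (rule imageI)
        then show False using y inj by simp
      qed
      then have yw: "y \<noteq> w" using K(3) by auto
      have L: "\<bar>ln (cmod ((\<phi> y - \<phi> w) / (1 - \<phi> y * cnj (\<phi> w))))\<bar> < pi * \<epsilon>"
        by (rule bspec[OF K(4)]) (use nK b1[of y] y in auto)
      have "(\<phi> y - \<phi> w) / (1 - \<phi> y * cnj (\<phi> w)) = m y * (y - w)"
        using yw by (simp add: m_def q_def)
      then have "ln (cmod ((\<phi> y - \<phi> w) / (1 - \<phi> y * cnj (\<phi> w)))) = Re (h y) + ln (cmod (y - w))"
        using m_nz y yw ln_m[of y] by (simp add: norm_mult ln_mult)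
      then have "u y = green_function \<gamma> y w - ln (cmod ((\<phi> y - \<phi> w) / (1 - \<phi> y * cnj (\<phi> w)))) / (2 * pi)"
        by (simp add: u_def green_function_def field_simps)
      moreover have "\<bar>ln (cmod ((\<phi> y - \<phi> w) / (1 - \<phi> y * cnj (\<phi> w)))) / (2 * pi)\<bar> < \<epsilon> / 2"
        using L by (simp add: field_simps abs_divide)
      moreover have "\<bar>green_function \<gamma> y w\<bar> < \<epsilon> / 2" using C1(3) y by blast
      ultimately show ?thesis by linarith
    qed
    ultimately show "\<exists>C. compact C \<and> C \<subseteq> \<Omega> \<and> (\<forall>z\<in>\<Omega> - C. \<bar>u z\<bar> < \<epsilon>)"
      using C1 by (intro exI[of _ "C1 \<union> C2"]) auto
  qed
  then have "\<gamma> z w = ln (cmod (m z)) / (2 * pi)" using ln_m[OF z] by (simp add: u_def)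
  also have "ln (cmod (m z)) = ln (cmod (q z)) - ln (cmod (1 - \<phi> z * cnj (\<phi> w)))"
    using q_nz[OF z] nz[OF z] by (simp add: m_def norm_divide ln_div)
  finally show ?thesis by (simp add: q_def)
qed

section \<open>Joint power series of the regular part\<close>

lemma rep_var:
  assumes "(\<lambda>j. if j = i then 1 else 0, \<lambda>_. 0) \<in> X" "i \<in> {1..N}" "0 \<le> r"
  shows "rep N r X (\<lambda>\<beta>. \<beta> i) r"
proof -
  let ?x = "(\<lambda>j. if j = i then 1 else 0, \<lambda>_. 0) :: exponent_pair"
  have "(\<Prod>j=1..N. \<beta> j ^ (if j = i then 1 else 0)) = \<beta> i" for \<beta> :: "nat \<Rightarrow> complex"
  proof -
    have "(\<Prod>j=1..N. \<beta> j ^ (if j = i then 1 else 0)) = (\<Prod>j=1..N. if j = i then \<beta> i else 1)"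
      by (rule prod.cong) auto
    then show ?thesis using assms(2) by simp
  qed
  then have "monomial N \<beta> ?x = \<beta> i" for \<beta> by (simp add: monomial_def)
  moreover have "pair_degree N ?x = 1" using assms(2) by (simp add: pair_degree_def)
  ultimately show ?thesis using rep_monomial[of 1 ?x X r N] assms by simp
qed

text \<open>In neither of the two variables do a power and a power of its conjugate occur together.
  This makes sums over vortices factor into pure power sums.\<close>

definition harmonic_exponents :: "exponent_pair set" where
  "harmonic_exponents = {x. (fst x 1 = 0 \<or> snd x 1 = 0) \<and> (fst x 2 = 0 \<or> snd x 2 = 0)}"

text \<open>Both logarithms have the form \<open>Ln (1 + small)\<close>: the difference quotient
  divided by \<phi>'(0) is \<open>1 + Q\<close> with Q holomorphic in both variables, and the other
  argument depends on the first variable and the conjugate of the second. Taking real parts adds the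
  swapped exponents, which keeps \<open>harmonic_exponents\<close>.\<close>

lemma regular_part_rep:
  assumes \<Omega>: "open \<Omega>" "simply_connected \<Omega>" "0 \<in> \<Omega>" and \<gamma>: "green_regular_part \<Omega> \<gamma>"
    and \<phi>: "biholomorphic \<Omega> (ball 0 1) \<phi>" "\<phi> 0 = 0"
  obtains r B where "0 < r" "cball 0 r \<subseteq> \<Omega>"
    "rep 2 r harmonic_exponents (\<lambda>\<beta>. of_real (\<gamma> (\<beta> 1) (\<beta> 2))) B"
proof -
  obtain \<rho> where \<rho>: "0 < \<rho>" "ball 0 \<rho> \<subseteq> \<Omega>" using \<Omega> by (meson openE)
  have hol\<Omega>: "\<phi> holomorphic_on \<Omega>" using \<phi> by (simp add: biholomorphic_def)
  have hol: "\<phi> holomorphic_on ball 0 \<rho>" using hol\<Omega> \<rho> by (meson holomorphic_on_subset)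
  have hol': "deriv \<phi> holomorphic_on ball 0 \<rho>" by (rule holomorphic_deriv[OF hol]) simp
  define f where "f n = (deriv ^^ n) \<phi> 0 / fact n" for n
  have f0: "f 0 = 0" using \<phi>(2) by (simp add: f_def)
  have "inj_on \<phi> \<Omega>" using \<phi>(1) by (auto simp: biholomorphic_def bij_betw_def)
  then have f1: "f 1 \<noteq> 0"
    using holomorphic_injective_imp_regular[OF hol\<Omega> \<Omega>(1) _ \<Omega>(3)] by (simp add: f_def)
  have \<phi>_sums: "(\<lambda>n. f n * z ^ n) sums \<phi> z" if "cmod z < \<rho>" for z
    using holomorphic_power_series[OF hol, of z] that by (simp add: f_def)
  have d\<phi>_sums: "(\<lambda>n. of_nat (Suc n) * f (Suc n) * z ^ n) sums deriv \<phi> z" if "cmod z < \<rho>" for z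
  proof -
    have "(\<lambda>n. (deriv ^^ n) (deriv \<phi>) 0 / fact n * (z - 0) ^ n) sums deriv \<phi> z"
      by (rule holomorphic_power_series[OF hol']) (use that in simp)
    moreover have "(deriv ^^ n) (deriv \<phi>) 0 / fact n = of_nat (Suc n) * f (Suc n)" for n
      by (simp add: f_def funpow_swap1 del: of_nat_Suc)
    ultimately show ?thesis by simp
  qed
  define R where "R = \<rho> / 2"
  have R: "0 < R" "R < \<rho>" using \<rho> by (auto simp: R_def)
  have fR: "summable (\<lambda>n. cmod (f n) * R ^ n)"
  proof -
    define x :: complex where "x = of_real ((R + \<rho>) / 2)"
    have x: "cmod x = (R + \<rho>) / 2" using R by (simp add: x_def norm_of_real del: of_real_add of_real_divide)
    have "summable (\<lambda>n. f n * x ^ n)"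
      using \<phi>_sums[of x] R x by (simp add: sums_iff)
    then have "summable (\<lambda>n. norm (f n * of_real R ^ n))"
      by (rule powser_insidea) (use R x in simp)
    then show ?thesis using R by (simp add: norm_mult norm_power)
  qed
  define S where "S = (suminf (\<lambda>n. cmod (f n) * R ^ n))"
  have S: "((\<lambda>n. cmod (f n) * R ^ n) has_sum S) UNIV"
    by (rule norm_summable_imp_has_sum) (use fR R in \<open>auto simp: S_def abs_mult\<close>)
  have S0: "0 \<le> S" by (rule has_sum_nonneg[OF S]) (use R in auto)
  \<comment> \<open>The two entries bring \<open>r / R * S\<close> and
    \<open>2 * r / (R\<^sup>2 * cmod (f 1)) * S\<close>, the bounds of \<phi> and Q, below
    one.\<close>
  define c where "c = max (2 * (S + 1) / R) (4 * (S + 1) / (R\<^sup>2 * cmod (f 1)))"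
  define r where "r = min (R / 4) (1 / c)"
  have c: "0 < c" using S0 R by (auto simp: c_def less_max_iff_disj)
  have r: "0 < r" "r \<le> R / 4" "r * c \<le> 1" "2 * r \<le> R"
    using R c by (auto simp: r_def min_def field_simps)
  have r1: "r / R * S < 1"
  proof -
    have "r * (2 * (S + 1) / R) \<le> r * c" using r by (intro mult_left_mono) (auto simp: c_def)
    then have "r * (2 * (S + 1)) / R \<le> 1" using r(3) by simp
    then have "r * (2 * (S + 1)) \<le> R" using R by (simp add: divide_le_eq)
    moreover have "r * S < r * (2 * (S + 1))" using r S0 by simp
    ultimately have "r * S < R" by linarith
    then show ?thesis using R by (simp add: field_simps)
  qed
  have r2: "2 * r / (R\<^sup>2 * cmod (f 1)) * S < 1"
  proof -
    have "r * (4 * (S + 1) / (R\<^sup>2 * cmod (f 1))) \<le> r * c" using r by (intro mult_left_mono) (auto simp: c_def)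
    then have "r * (4 * (S + 1)) / (R\<^sup>2 * cmod (f 1)) \<le> 1" using r(3) by simp
    then have "r * (4 * (S + 1)) \<le> R\<^sup>2 * cmod (f 1)" using R f1 by (simp add: divide_le_eq)
    moreover have "2 * r * S < r * (4 * (S + 1))" using r S0 by simp
    ultimately have "2 * r * S < R\<^sup>2 * cmod (f 1)" by linarith
    then show ?thesis using R f1 by (simp add: divide_less_eq)
  qed
  have r0: "0 \<le> r" using r by simp
  \<comment> \<open>\<open>?Xh\<close> belongs to functions holomorphic in both variables,
    \<open>?X1\<close> to functions of the first variable and the conjugate of the second,
    \<open>?X2\<close> to its swap.\<close>
  let ?Xh = "{x::exponent_pair. snd x 1 = 0 \<and> snd x 2 = 0}"
  let ?X1 = "{x::exponent_pair. snd x 1 = 0 \<and> fst x 2 = 0}"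
  let ?X2 = "{x::exponent_pair. snd x 2 = 0 \<and> fst x 1 = 0}"
  have \<phi>_rep: "rep 2 r X (\<lambda>\<beta>. \<phi> (\<beta> i)) (r / R * S)"
    if X: "(\<lambda>j. if j = i then 1 else 0, \<lambda>_. 0) \<in> X" "\<And>x y. x \<in> X \<Longrightarrow> y \<in> X \<Longrightarrow> pair_add x y \<in> X"
      and i: "i \<in> {1..2}" for X i
  proof (rule rep_infsum[OF r0])
    have v: "rep 2 r X (\<lambda>\<beta>. \<beta> i) r" by (rule rep_var[OF X(1) i r0])
    show "rep 2 r X (\<lambda>\<beta>. f n * \<beta> i ^ n) (r / R * (cmod (f n) * R ^ n))" for n
    proof (cases n)
      case 0
      then show ?thesis using rep_zero[OF r0] f0 by simp
    next
      case (Suc k)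
      have "r ^ k \<le> R ^ k" using r by (intro power_mono) auto
      then have "r * r ^ k \<le> r * R ^ k" using r by (intro mult_left_mono) auto
      then have "cmod (f n) * (r * r ^ k) \<le> cmod (f n) * (r * R ^ k)" by (rule mult_left_mono) simp
      also have "\<dots> = r / R * (cmod (f n) * R ^ n)" using R by (simp add: Suc)
      finally have le: "cmod (f n) * r ^ Suc k \<le> r / R * (cmod (f n) * R ^ n)" by simp
      show ?thesis unfolding Suc
        by (rule rep_mono[OF rep_cmult[OF r0 rep_power_Suc[OF r0 v X(2)]] order_refl]) (use le Suc in auto)
    qed
    show "((\<lambda>n. r / R * (cmod (f n) * R ^ n)) has_sum r / R * S) UNIV"
      by (rule has_sum_cmult_right[OF S])
    show "((\<lambda>n. f n * \<beta> i ^ n) has_sum \<phi> (\<beta> i)) UNIV" if \<beta>: "\<beta> \<in> closed_polydisc 2 r" for \<beta>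
    proof (rule norm_summable_imp_has_sum)
      have "cmod (\<beta> i) \<le> r" using \<beta> i by (simp add: closed_polydisc_def)
      then have bi: "cmod (\<beta> i) \<le> R" using r by linarith
      show "summable (\<lambda>n. norm (f n * \<beta> i ^ n))"
        by (rule summable_comparison_test'[OF fR, of 0])
          (use bi in \<open>auto simp: norm_mult norm_power intro!: mult_left_mono power_mono\<close>)
      show "(\<lambda>n. f n * \<beta> i ^ n) sums \<phi> (\<beta> i)" by (rule \<phi>_sums) (use bi R in simp)
    qed
  qed
  \<comment> \<open>Divided difference of the power \<open>n + 1\<close>, written without division
    so that it also covers the diagonal.\<close>
  define D where "D n z w = (\<Sum>p<Suc n. z ^ p * w ^ (n - p))" for n and z w :: complex
  define Q where "Q z w = suminf (\<lambda>n. if n = 0 then 0 else f (Suc n) / f 1 * D n z w)" for z w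
  have D_rep: "rep 2 r ?Xh (\<lambda>\<beta>. D n (\<beta> 1) (\<beta> 2)) (of_nat (Suc n) * r ^ n)" for n
  proof -
    have v: "rep 2 r ?Xh (\<lambda>\<beta>. \<beta> i) r" if "i \<in> {1..2}" for i
      by (rule rep_var) (use that r0 in auto)
    have v2: "rep 2 r ?Xh (\<lambda>\<beta>. \<beta> 1 ^ p * \<beta> 2 ^ q) (r ^ p * r ^ q)" for p q
      by (rule rep_mult[OF r0 rep_power[OF r0 v] rep_power[OF r0 v]]) (auto simp: pair_add_def)
    have "rep 2 r ?Xh (\<lambda>\<beta>. D n (\<beta> 1) (\<beta> 2)) (\<Sum>p<Suc n. r ^ p * r ^ (n - p))"
      unfolding D_def by (rule rep_sum[OF r0 _ v2]) simp
    also have "(\<Sum>p<Suc n. r ^ p * r ^ (n - p)) = (\<Sum>p<Suc n. r ^ n)"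
      by (rule sum.cong) (auto simp: power_add[symmetric])
    finally show ?thesis by simp
  qed
  \<comment> \<open>\<open>n + 1 \<le> 2 ^ n\<close> and \<open>2 * r \<le> R\<close> replace
    \<open>(n + 1) * r ^ n\<close> by \<open>2 * r * R ^ (n - 1)\<close>, which reduces the bound to
    the series with sum S.\<close>
  define B where "B n = 2 * r / (R\<^sup>2 * cmod (f 1)) * (cmod (f (Suc n)) * R ^ Suc n)" for n
  have Bn: "cmod (f (Suc n) / f 1) * (of_nat (Suc n) * r ^ n) \<le> B n" if n: "n \<noteq> 0" for n
  proof -
    obtain k where k: "n = Suc k" using n by (cases n) auto
    have "of_nat (Suc n) \<le> (2::real) ^ n"
      using of_nat_mono[OF Suc_leI[OF less_exp[of n]], where 'a = real] by simp
    then have "of_nat (Suc n) * r ^ n \<le> 2 ^ n * r ^ n" using r by (intro mult_right_mono) auto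
    also have "\<dots> = (2 * r) * (2 * r) ^ k" by (simp add: k power_mult_distrib)
    also have "\<dots> \<le> (2 * r) * R ^ k" by (rule mult_left_mono[OF power_mono]) (use r in auto)
    finally have "cmod (f (Suc n) / f 1) * (of_nat (Suc n) * r ^ n) \<le> cmod (f (Suc n) / f 1) * ((2 * r) * R ^ k)"
      by (rule mult_left_mono) simp
    also have "\<dots> = B n" using R by (simp add: B_def k norm_divide power2_eq_square field_simps)
    finally show ?thesis .
  qed
  have S': "((\<lambda>n. cmod (f (Suc n)) * R ^ Suc n) has_sum S) UNIV"
  proof (rule norm_summable_imp_has_sum)
    show "summable (\<lambda>n. norm (cmod (f (Suc n)) * R ^ Suc n))"
      using summable_Suc_iff[THEN iffD2, OF fR] R by (simp add: abs_mult)
    have "(\<lambda>n. cmod (f n) * R ^ n) sums S" by (rule has_sum_imp_sums[OF S])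
    then show "(\<lambda>n. cmod (f (Suc n)) * R ^ Suc n) sums S"
      using sums_Suc_iff[of "\<lambda>n. cmod (f n) * R ^ n" S] f0 by simp
  qed
  have B_sum: "(B has_sum 2 * r / (R\<^sup>2 * cmod (f 1)) * S) UNIV"
    unfolding B_def by (rule has_sum_cmult_right[OF S'])
  have B0: "0 \<le> B n" for n using R r by (simp add: B_def)
  have D_le: "cmod (D n z w) \<le> of_nat (Suc n) * r ^ n" if "cmod z \<le> r" "cmod w \<le> r" for n z w
    using rep_bound[OF D_rep[of n], of "\<lambda>i. if i = 1 then z else w"] that
    by (auto simp: closed_polydisc_def)
  have term_le: "cmod (f (Suc n) / f 1 * D n z w) \<le> B n" if "cmod z \<le> r" "cmod w \<le> r" "n \<noteq> 0" for n z w
    using Bn[OF that(3)] mult_left_mono[OF D_le[OF that(1,2), of n], of "cmod (f (Suc n) / f 1)"]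
    unfolding norm_mult by (meson norm_ge_zero order_trans)
  have sumB: "summable B" using has_sum_imp_sums[OF B_sum] by (simp add: sums_iff)
  have Q_abs: "summable (\<lambda>n. norm (if n = 0 then 0 else f (Suc n) / f 1 * D n z w))"
    if "cmod z \<le> r" "cmod w \<le> r" for z w
    by (rule summable_comparison_test'[OF sumB, of 0]) (use term_le[OF that] B0 in auto)
  have Q_rep: "rep 2 r ?Xh (\<lambda>\<beta>. Q (\<beta> 1) (\<beta> 2)) (2 * r / (R\<^sup>2 * cmod (f 1)) * S)"
  proof (rule rep_infsum[OF r0 _ B_sum])
    show "rep 2 r ?Xh (\<lambda>\<beta>. if n = 0 then 0 else f (Suc n) / f 1 * D n (\<beta> 1) (\<beta> 2)) (B n)" for n
    proof (cases "n = 0")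
      case True
      then show ?thesis using rep_mono[OF rep_zero[OF r0] order_refl B0] by simp
    next
      case False
      then show ?thesis
        using rep_mono[OF rep_cmult[OF r0 D_rep[of n], of "f (Suc n) / f 1"] order_refl Bn[OF False]] by simp
    qed
    show "((\<lambda>n. if n = 0 then 0 else f (Suc n) / f 1 * D n (\<beta> 1) (\<beta> 2)) has_sum Q (\<beta> 1) (\<beta> 2)) UNIV"
      if "\<beta> \<in> closed_polydisc 2 r" for \<beta>
    proof (rule norm_summable_imp_has_sum)
      have *: "cmod (\<beta> 1) \<le> r" "cmod (\<beta> 2) \<le> r" using that by (auto simp: closed_polydisc_def)
      show "summable (\<lambda>n. norm (if n = 0 then 0 else f (Suc n) / f 1 * D n (\<beta> 1) (\<beta> 2)))"
        by (rule Q_abs[OF *])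
      then show "(\<lambda>n. if n = 0 then 0 else f (Suc n) / f 1 * D n (\<beta> 1) (\<beta> 2)) sums Q (\<beta> 1) (\<beta> 2)"
        unfolding Q_def by (intro summable_sums) (rule summable_norm_cancel)
    qed
  qed
  have Q_eq: "(if z = w then deriv \<phi> w else (\<phi> z - \<phi> w) / (z - w)) = f 1 * (1 + Q z w)"
    if zw: "cmod z \<le> r" "cmod w \<le> r" for z w
  proof -
    have lt: "cmod z < \<rho>" "cmod w < \<rho>" using zw r R by auto
    have "(\<lambda>n. if n = 0 then 0 else f (Suc n) / f 1 * D n z w) sums Q z w"
      unfolding Q_def by (rule summable_sums, rule summable_norm_cancel, rule Q_abs[OF zw])
    moreover have "(\<lambda>n. if n = 0 then 1 else 0) sums (1::complex)"
      using sums_single[of 0 "\<lambda>_. 1::complex"] by simp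
    ultimately have "(\<lambda>n. (if n = 0 then 0 else f (Suc n) / f 1 * D n z w) + (if n = 0 then 1 else 0)) sums (Q z w + 1)"
      by (rule sums_add)
    then have "(\<lambda>n. f 1 * ((if n = 0 then 0 else f (Suc n) / f 1 * D n z w) + (if n = 0 then 1 else 0))) sums (f 1 * (Q z w + 1))"
      by (rule sums_mult)
    moreover have "f 1 * ((if n = 0 then 0 else f (Suc n) / f 1 * D n z w) + (if n = 0 then 1 else 0)) = f (Suc n) * D n z w" for n
      using f1 by (cases "n = 0") (simp_all add: D_def del: sum.lessThan_Suc)
    ultimately have s: "(\<lambda>n. f (Suc n) * D n z w) sums (f 1 * (1 + Q z w))"
      by (simp only: add.commute)
    show ?thesis
    proof (cases "z = w")
      case True
      have "D n w w = of_nat (Suc n) * w ^ n" for n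
      proof -
        have "D n w w = (\<Sum>p<Suc n. w ^ n)"
          unfolding D_def by (rule sum.cong) (auto simp: power_add[symmetric])
        then show ?thesis by simp
      qed
      then show ?thesis using s d\<phi>_sums[OF lt(2)] True sums_unique2 by (simp add: mult_ac)
    next
      case False
      have "(\<lambda>n. f n * z ^ n - f n * w ^ n) sums (\<phi> z - \<phi> w)"
        by (rule sums_diff[OF \<phi>_sums[OF lt(1)] \<phi>_sums[OF lt(2)]])
      then have "(\<lambda>n. f (Suc n) * z ^ Suc n - f (Suc n) * w ^ Suc n) sums (\<phi> z - \<phi> w)"
        using sums_Suc_iff[of "\<lambda>n. f n * z ^ n - f n * w ^ n"] f0 by simp
      moreover have "f (Suc n) * z ^ Suc n - f (Suc n) * w ^ Suc n = (z - w) * (f (Suc n) * D n z w)" for n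
        unfolding right_diff_distrib[symmetric] diff_power_eq_sum D_def by (simp add: mult_ac)
      ultimately have "(\<lambda>n. (z - w) * (f (Suc n) * D n z w)) sums (\<phi> z - \<phi> w)" by simp
      with sums_mult[OF s, of "z - w"] have "\<phi> z - \<phi> w = (z - w) * (f 1 * (1 + Q z w))"
        using sums_unique2 by blast
      then show ?thesis using False by simp
    qed
  qed
  have L1: "rep 2 r ?Xh (\<lambda>\<beta>. Ln (1 + Q (\<beta> 1) (\<beta> 2))) (1 / (1 - 2 * r / (R\<^sup>2 * cmod (f 1)) * S))"
    by (rule rep_Ln[OF r0 Q_rep _ r2]) (auto simp: pair_add_def)
  have "rep 2 r ?X1 (\<lambda>\<beta>. \<phi> (\<beta> 1)) (r / R * S)"
    by (rule \<phi>_rep) (auto simp: pair_add_def)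
  moreover have "rep 2 r ?X1 (\<lambda>\<beta>. cnj (\<phi> (\<beta> 2))) (r / R * S)"
  proof -
    have "rep 2 r ?X2 (\<lambda>\<beta>. \<phi> (\<beta> 2)) (r / R * S)"
      by (rule \<phi>_rep) (auto simp: pair_add_def)
    from rep_cnj[OF this] show ?thesis
      by (rule rep_mono) (auto simp: pair_swap_def)
  qed
  ultimately have "rep 2 r ?X1 (\<lambda>\<beta>. - (\<phi> (\<beta> 1) * cnj (\<phi> (\<beta> 2)))) ((r / R * S) * (r / R * S))"
    by (intro rep_minus[OF r0] rep_mult[OF r0]) (auto simp: pair_add_def)
  then have L2: "rep 2 r ?X1 (\<lambda>\<beta>. Ln (1 + - (\<phi> (\<beta> 1) * cnj (\<phi> (\<beta> 2))))) (1 / (1 - (r / R * S) * (r / R * S)))"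
  proof (rule rep_Ln[OF r0])
    have "(r / R * S) * (r / R * S) \<le> (r / R * S) * 1"
      by (rule mult_left_mono) (use r1 R r S0 in auto)
    then show "(r / R * S) * (r / R * S) < 1" using r1 by simp
  qed (auto simp: pair_add_def)
  have c0: "rep 2 r harmonic_exponents (\<lambda>_. of_real (ln (cmod (f 1)))) (cmod (of_real (ln (cmod (f 1)))))"
    by (rule rep_const) (use r0 in \<open>auto simp: harmonic_exponents_def\<close>)
  have L1': "rep 2 r harmonic_exponents (\<lambda>\<beta>. of_real (Re (Ln (1 + Q (\<beta> 1) (\<beta> 2))))) (1 / (1 - 2 * r / (R\<^sup>2 * cmod (f 1)) * S))"
    by (rule rep_mono[OF rep_Re[OF r0 L1]]) (auto simp: harmonic_exponents_def pair_swap_def)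
  have L2': "rep 2 r harmonic_exponents (\<lambda>\<beta>. of_real (Re (Ln (1 + - (\<phi> (\<beta> 1) * cnj (\<phi> (\<beta> 2))))))) (1 / (1 - (r / R * S) * (r / R * S)))"
    by (rule rep_mono[OF rep_Re[OF r0 L2]]) (auto simp: harmonic_exponents_def pair_swap_def)
  note final = rep_cmult[OF r0 rep_diff[OF r0 rep_add[OF r0 c0 L1'] L2'], of "of_real (1 / (2 * pi))"]
  have sub: "cball 0 r \<subseteq> \<Omega>" using \<rho> r R by (auto intro!: subsetD[OF \<rho>(2)])
  have "rep 2 r harmonic_exponents (\<lambda>\<beta>. of_real (\<gamma> (\<beta> 1) (\<beta> 2)))
    (cmod (of_real (1 / (2 * pi))) * (cmod (of_real (ln (cmod (f 1)))) + 1 / (1 - 2 * r / (R\<^sup>2 * cmod (f 1)) * S)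
      + 1 / (1 - (r / R * S) * (r / R * S))))"
  proof (rule rep_cong[OF final])
    fix \<beta> assume \<beta>: "\<beta> \<in> closed_polydisc 2 r"
    then have b: "cmod (\<beta> 1) \<le> r" "cmod (\<beta> 2) \<le> r" by (auto simp: closed_polydisc_def)
    then have b\<Omega>: "\<beta> 1 \<in> \<Omega>" "\<beta> 2 \<in> \<Omega>" using sub by auto
    have "cmod (Q (\<beta> 1) (\<beta> 2)) < 1" using rep_bound[OF Q_rep \<beta>] r2 by simp
    then have nz: "1 + Q (\<beta> 1) (\<beta> 2) \<noteq> 0"
      by (metis add.commute add_eq_0_iff norm_minus_cancel norm_one order_less_irrefl)
    have "\<phi> (\<beta> 1) \<in> ball 0 1" "\<phi> (\<beta> 2) \<in> ball 0 1"
      using \<phi>(1) b\<Omega> by (auto simp: biholomorphic_def bij_betw_def)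
    then have "cmod (\<phi> (\<beta> 1) * cnj (\<phi> (\<beta> 2))) < 1"
      by (simp add: norm_mult) (smt (verit) mult_left_le norm_ge_zero)
    then have nz': "1 - \<phi> (\<beta> 1) * cnj (\<phi> (\<beta> 2)) \<noteq> 0" by auto
    have "\<gamma> (\<beta> 1) (\<beta> 2) = 1 / (2 * pi) * (ln (cmod (f 1 * (1 + Q (\<beta> 1) (\<beta> 2))))
        - ln (cmod (1 - \<phi> (\<beta> 1) * cnj (\<phi> (\<beta> 2)))))"
      unfolding Q_eq[OF b, symmetric] by (rule regular_part_formula[OF \<Omega>(1,2) \<gamma> \<phi>(1) b\<Omega>(2,1)])
    also have "ln (cmod (f 1 * (1 + Q (\<beta> 1) (\<beta> 2)))) = ln (cmod (f 1)) + Re (Ln (1 + Q (\<beta> 1) (\<beta> 2)))"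
      using nz f1 by (simp add: norm_mult ln_mult Re_Ln)
    also have "ln (cmod (1 - \<phi> (\<beta> 1) * cnj (\<phi> (\<beta> 2)))) = Re (Ln (1 + - (\<phi> (\<beta> 1) * cnj (\<phi> (\<beta> 2)))))"
      using nz' by (simp add: Re_Ln)
    finally show "of_real (1 / (2 * pi)) * (of_real (ln (cmod (f 1))) + of_real (Re (Ln (1 + Q (\<beta> 1) (\<beta> 2)))) -
        of_real (Re (Ln (1 + - (\<phi> (\<beta> 1) * cnj (\<phi> (\<beta> 2))))))) = complex_of_real (\<gamma> (\<beta> 1) (\<beta> 2))"
      by simp
  qed
  with that[OF r(1) sub] show ?thesis by blast
qed

section \<open>Power sums in Jacobi coordinates\<close>

text \<open>\<open>J\<close> plays the role of an ideal in \<open>H\<close> that contains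
  \<open>e\<close> and the square of \<open>v\<close>: modulo \<open>J\<close> a power is its Taylor
  polynomial of first order in \<open>v\<close>. A geometric bound is kept because these powers are
  summed later.\<close>

lemma rep_linear_expansion:
  assumes r: "0 \<le> r" and C: "rep N r Z C \<rho>" and v: "rep N r V v \<rho>" and e: "rep N r W e \<rho>"
    and sub: "Z \<subseteq> H" "V \<subseteq> H" "W \<subseteq> H" "J \<subseteq> H" and 0: "(\<lambda>_. 0, \<lambda>_. 0) \<in> H"
    and H: "\<And>x y. x \<in> H \<Longrightarrow> y \<in> H \<Longrightarrow> pair_add x y \<in> H"
    and JH: "\<And>x y. x \<in> J \<Longrightarrow> y \<in> H \<Longrightarrow> pair_add y x \<in> J"
    and WH: "\<And>x y. x \<in> W \<Longrightarrow> y \<in> H \<Longrightarrow> pair_add x y \<in> J"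
    and VV: "\<And>x y. x \<in> V \<Longrightarrow> y \<in> V \<Longrightarrow> pair_add x y \<in> J"
  shows "rep N r J (\<lambda>\<beta>. (C \<beta> + v \<beta> + e \<beta>) ^ i - C \<beta> ^ i - of_nat i * C \<beta> ^ (i - 1) * v \<beta>) ((5 * \<rho>) ^ i)"
proof (induction i)
  case 0
  then show ?case using rep_mono[OF rep_zero[OF r], of J J 1 N] by simp
next
  case (Suc i)
  have \<rho>: "0 \<le> \<rho>" by (rule rep_nonneg[OF C r])
  have CH: "rep N r H C \<rho>" and vH: "rep N r H v \<rho>" and eH: "rep N r H e \<rho>"
    using rep_mono[OF C sub(1) order_refl] rep_mono[OF v sub(2) order_refl] rep_mono[OF e sub(3) order_refl] .
  have C_pow: "rep N r H (\<lambda>\<beta>. C \<beta> ^ k) (\<rho> ^ k)" for k by (rule rep_power[OF r CH H 0])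
  let ?E = "\<lambda>\<beta>. (C \<beta> + v \<beta> + e \<beta>) ^ i - C \<beta> ^ i - of_nat i * C \<beta> ^ (i - 1) * v \<beta>"
  let ?P = "\<lambda>\<beta>. C \<beta> ^ i + of_nat i * (C \<beta> ^ (i - 1) * v \<beta>)"
  have sumH: "rep N r H (\<lambda>\<beta>. C \<beta> + v \<beta> + e \<beta>) (3 * \<rho>)"
    using rep_add[OF r rep_add[OF r CH vH] eH] by simp
  have 1: "rep N r J (\<lambda>\<beta>. (C \<beta> + v \<beta> + e \<beta>) * ?E \<beta>) (3 * \<rho> * (5 * \<rho>) ^ i)"
    by (rule rep_mult[OF r sumH Suc]) (use JH in blast)
  have Cv: "rep N r H (\<lambda>\<beta>. of_nat i * (C \<beta> ^ (i - 1) * v \<beta>)) (of_nat i * \<rho> ^ i)"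
  proof (cases i)
    case 0
    then show ?thesis using rep_zero[OF r] by simp
  next
    case (Suc k)
    then show ?thesis using rep_cmult[OF r rep_mult[OF r C_pow[of k] vH H], of "of_nat i"] by (simp add: mult.commute del: of_nat_Suc)
  qed
  have 2: "rep N r J (\<lambda>\<beta>. e \<beta> * ?P \<beta>) (\<rho> * (\<rho> ^ i + of_nat i * \<rho> ^ i))"
    by (rule rep_mult[OF r e rep_add[OF r C_pow Cv]]) (use WH in blast)
  have 3: "rep N r J (\<lambda>\<beta>. of_nat i * (C \<beta> ^ (i - 1) * (v \<beta> * v \<beta>))) (of_nat i * \<rho> ^ Suc i)"
  proof (cases i)
    case 0
    then show ?thesis using rep_zero[OF r] by simp
  next
    case (Suc k)
    have "rep N r J (\<lambda>\<beta>. v \<beta> * v \<beta>) (\<rho> * \<rho>)" by (rule rep_mult[OF r v v VV])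
    then have "rep N r J (\<lambda>\<beta>. C \<beta> ^ k * (v \<beta> * v \<beta>)) (\<rho> ^ k * (\<rho> * \<rho>))"
      by (rule rep_mult[OF r C_pow[of k]]) (rule JH)
    from rep_cmult[OF r this, of "of_nat i"] show ?thesis using Suc by (simp add: mult_ac del: of_nat_Suc)
  qed
  have eq: "(C \<beta> + v \<beta> + e \<beta>) * ?E \<beta> + e \<beta> * ?P \<beta> + of_nat i * (C \<beta> ^ (i - 1) * (v \<beta> * v \<beta>)) =
      (C \<beta> + v \<beta> + e \<beta>) ^ Suc i - C \<beta> ^ Suc i - of_nat (Suc i) * C \<beta> ^ (Suc i - 1) * v \<beta>" for \<beta>
    by (cases i) (simp_all add: algebra_simps)
  \<comment> \<open>Here the factor 5 comes from: 3 bounds the sum of three terms, and the remaining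
    \<open>1 + 2 * i\<close> is at most \<open>2 * 5 ^ i\<close>.\<close>
  have le: "3 * \<rho> * (5 * \<rho>) ^ i + \<rho> * (\<rho> ^ i + of_nat i * \<rho> ^ i) + of_nat i * \<rho> ^ Suc i \<le> (5 * \<rho>) ^ Suc i"
  proof -
    have "1 + 2 * real i \<le> 2 * 5 ^ i" by (induction i) auto
    then have "(1 + 2 * real i) * (\<rho> * \<rho> ^ i) \<le> (2 * 5 ^ i) * (\<rho> * \<rho> ^ i)"
      using \<rho> by (intro mult_right_mono) auto
    then show ?thesis by (simp add: power_mult_distrib algebra_simps)
  qed
  show ?case
    using rep_mono[OF rep_add[OF r rep_add[OF r 1 2] 3] order_refl le] unfolding eq .
qed

text \<open>Exponents of polynomials in the products \<open>\<beta>\<^sub>j \<cdots> \<beta>\<^bsub>n-1\<^esub>\<close> with \<open>j < n\<close>, without their conjugates; for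
  \<open>n = N\<close> the exponents of \<open>\<beta>\<^sub>N\<close> and of its conjugate are unrestricted.\<close>

definition cluster_exponents :: "nat \<Rightarrow> nat \<Rightarrow> exponent_pair set" where
  "cluster_exponents N n = {x \<in> multi_indices N \<times> multi_indices N.
     (\<forall>i j. 1 \<le> i \<longrightarrow> i \<le> j \<longrightarrow> j < n \<longrightarrow> fst x i \<le> fst x j) \<and>
     (\<forall>i. n \<le> i \<longrightarrow> i < N \<longrightarrow> fst x i = 0) \<and> (\<forall>i<N. snd x i = 0) \<and>
     (n < N \<longrightarrow> fst x N = 0 \<and> snd x N = 0)}"

lemma multi_indices_add: "K \<in> multi_indices N \<Longrightarrow> L \<in> multi_indices N \<Longrightarrow> (\<lambda>i. K i + L i) \<in> multi_indices N"
  by (simp add: multi_indices_def)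

lemma cluster_exponents_add:
  assumes "x \<in> cluster_exponents N n" "y \<in> cluster_exponents N n"
  shows "pair_add x y \<in> cluster_exponents N n"
  using assms unfolding cluster_exponents_def pair_add_def
  by (auto simp: mem_Times_iff intro!: multi_indices_add add_mono)

lemma cluster_exponents_0: "(\<lambda>_. 0, \<lambda>_. 0) \<in> cluster_exponents N n"
  by (auto simp: cluster_exponents_def multi_indices_def)

text \<open>For exponents that increase up to \<open>m\<close>, a zero at \<open>m - 1\<close> means
  that all earlier ones vanish too. What is excluded then are the terms linear in
  \<open>u\<^sub>m\<close> that contain no \<open>u\<^sub>j\<close> with j < m.\<close>

definition no_leading_one :: "nat \<Rightarrow> (nat \<Rightarrow> nat) \<Rightarrow> bool" where
  "no_leading_one m K \<longleftrightarrow> K m \<noteq> 1 \<or> K (m - 1) \<noteq> 0"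

definition chain_pair :: "nat \<Rightarrow> nat \<Rightarrow> exponent_pair" where
  "chain_pair n j = (\<lambda>i. if j \<le> i \<and> i < n then 1 else 0, \<lambda>_. 0)"

text \<open>Because of the centre of mass weights, the terms linear in \<open>u\<^sub>m\<close> cancel in the power sums when the
  \<open>u\<^sub>j\<close> with \<open>j < m\<close> vanish.\<close>

lemma power_sum_rep:
  fixes u :: "nat \<Rightarrow> (nat \<Rightarrow> complex) \<Rightarrow> complex"
  assumes r: "0 \<le> r" and n: "1 \<le> n" "n \<le> N" and m: "1 \<le> m" "m < N"
    and A: "\<And>k. k \<in> {1..N} \<Longrightarrow> partial_strength a k \<noteq> 0"
    and u0: "u 0 = (\<lambda>_. 0)"
    and u: "\<And>j. 1 \<le> j \<Longrightarrow> j < n \<Longrightarrow> rep N r {chain_pair n j} (u j) b"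
    and base: "rep N r {x \<in> cluster_exponents N n. \<forall>i<N. fst x i = 0} base b" and b: "0 \<le> b"
    and C: "\<And>l \<beta>. C l \<beta> = base \<beta> + (\<Sum>j=l..<n. of_real (kappa a (j + 1)) * u j \<beta>)"
    and y: "\<And>l \<beta>. y l \<beta> = C (l - 1) \<beta> - u (l - 1) \<beta>"
    and \<rho>: "\<rho> = b * (2 + (\<Sum>j<n. \<bar>kappa a (j + 1)\<bar>))"
  shows "rep N r {x \<in> cluster_exponents N n. no_leading_one m (fst x)}
    (\<lambda>\<beta>. \<Sum>l=1..n. of_real (a l) * y l \<beta> ^ p) (2 * (\<Sum>l=1..n. \<bar>a l\<bar>) * (5 * \<rho>) ^ p)"
proof -
  let ?\<kappa> = "\<lambda>j. kappa a (j + 1)"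
  let ?H = "cluster_exponents N n"
  let ?X = "{x \<in> ?H. no_leading_one m (fst x)}"
  define \<kappa>s where "\<kappa>s = (\<Sum>j<n. \<bar>?\<kappa> j\<bar>)"
  have \<kappa>s0: "0 \<le> \<kappa>s" by (auto simp: \<kappa>s_def intro!: sum_nonneg)
  have \<rho>': "\<rho> = b * (2 + \<kappa>s)" by (simp add: \<rho> \<kappa>s_def)
  have \<rho>0: "0 \<le> \<rho>" using b \<kappa>s0 by (simp add: \<rho>')
  have chainH: "chain_pair n j \<in> ?H" if "1 \<le> j" for j
    using that n by (auto simp: chain_pair_def cluster_exponents_def multi_indices_def)
  have lin: "rep N r T (\<lambda>\<beta>. \<Sum>j\<in>{l..<k}. of_real (?\<kappa> j) * u j \<beta>) (b * \<kappa>s)"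
    if k: "k \<le> n" and T: "\<And>j. 1 \<le> j \<Longrightarrow> l \<le> j \<Longrightarrow> j < k \<Longrightarrow> chain_pair n j \<in> T" for l k T
  proof -
    have "rep N r T (\<lambda>\<beta>. of_real (?\<kappa> j) * u j \<beta>) (\<bar>?\<kappa> j\<bar> * b)" if "j \<in> {l..<k}" for j
    proof (cases "j = 0")
      case True
      have "0 \<le> \<bar>?\<kappa> j\<bar> * b" using b by simp
      then show ?thesis using rep_mono[OF rep_zero[OF r] order_refl] True u0 by simp
    next
      case False
      then have "rep N r T (u j) b"
        by (intro rep_mono[OF u _ order_refl]) (use that k T in auto)
      from rep_cmult[OF r this, of "of_real (?\<kappa> j)"] show ?thesis by simp
    qed
    then have "rep N r T (\<lambda>\<beta>. \<Sum>j\<in>{l..<k}. of_real (?\<kappa> j) * u j \<beta>) (\<Sum>j\<in>{l..<k}. \<bar>?\<kappa> j\<bar> * b)"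
      by (intro rep_sum[OF r]) auto
    moreover have "(\<Sum>j\<in>{l..<k}. \<bar>?\<kappa> j\<bar> * b) \<le> b * \<kappa>s"
    proof -
      have "(\<Sum>j\<in>{l..<k}. \<bar>?\<kappa> j\<bar>) \<le> \<kappa>s" unfolding \<kappa>s_def
        by (rule sum_mono2) (use k in auto)
      then have "(\<Sum>j\<in>{l..<k}. \<bar>?\<kappa> j\<bar>) * b \<le> \<kappa>s * b" using b by (rule mult_right_mono)
      then show ?thesis by (simp only: sum_distrib_right[symmetric] mult.commute[of b \<kappa>s])
    qed
    ultimately show ?thesis by (rule rep_mono[OF _ order_refl])
  qed
  have u_any: "rep N r T (u j) b" if "j < n" "1 \<le> j \<Longrightarrow> chain_pair n j \<in> T" for j T
  proof (cases "j = 0")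
    case True
    then show ?thesis using rep_mono[OF rep_zero[OF r] order_refl b] u0 by simp
  next
    case False
    then show ?thesis by (intro rep_mono[OF u _ order_refl]) (use that in auto)
  qed
  have y_gen: "rep N r T (y l) \<rho>"
    if l: "l \<in> {1..n}" and T: "\<And>j. 1 \<le> j \<Longrightarrow> l - 1 \<le> j \<Longrightarrow> j < n \<Longrightarrow> chain_pair n j \<in> T"
      "{x \<in> ?H. \<forall>i<N. fst x i = 0} \<subseteq> T" for l T
  proof -
    have "rep N r T (\<lambda>\<beta>. (base \<beta> + (\<Sum>j\<in>{l-1..<n}. of_real (?\<kappa> j) * u j \<beta>)) - u (l - 1) \<beta>) ((b + b * \<kappa>s) + b)"
      by (intro rep_diff[OF r] rep_add[OF r] lin rep_mono[OF base T(2) order_refl] u_any)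
        (use l T in auto)
    then show ?thesis by (rule rep_cong[OF rep_mono]) (auto simp: y C \<rho>' algebra_simps)
  qed
  show ?thesis
  proof (cases "m < n")
    case False
    \<comment> \<open>The first \<open>n\<close> vortices do not involve
      \<open>\<beta>\<^sub>m\<close> when \<open>n \<le> m\<close>, so the restriction holds
      trivially.\<close>
    have HX: "?H \<subseteq> ?X" using False m by (auto simp: cluster_exponents_def no_leading_one_def)
    have "rep N r ?X (\<lambda>\<beta>. of_real (a l) * y l \<beta> ^ p) (\<bar>a l\<bar> * \<rho> ^ p)" if "l \<in> {1..n}" for l
    proof -
      have "rep N r ?H (y l) \<rho>" by (rule y_gen[OF that chainH]) auto
      from rep_cmult[OF r rep_power[OF r this cluster_exponents_add cluster_exponents_0], of "of_real (a l)" p]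
      show ?thesis by (intro rep_mono[OF _ HX]) auto
    qed
    then have "rep N r ?X (\<lambda>\<beta>. \<Sum>l=1..n. of_real (a l) * y l \<beta> ^ p) (\<Sum>l=1..n. \<bar>a l\<bar> * \<rho> ^ p)"
      by (intro rep_sum[OF r]) auto
    then show ?thesis
    proof (rule rep_mono[OF _ order_refl])
      have "\<rho> ^ p \<le> (5 * \<rho>) ^ p" using \<rho>0 by (intro power_mono) auto
      then have "(\<Sum>l=1..n. \<bar>a l\<bar>) * \<rho> ^ p \<le> (\<Sum>l=1..n. \<bar>a l\<bar>) * (2 * (5 * \<rho>) ^ p)"
        using \<rho>0 by (intro mult_left_mono sum_nonneg) (auto intro: order_trans)
      then show "(\<Sum>l=1..n. \<bar>a l\<bar> * \<rho> ^ p) \<le> 2 * (\<Sum>l=1..n. \<bar>a l\<bar>) * (5 * \<rho>) ^ p"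
        by (simp add: sum_distrib_right[symmetric] mult_ac)
    qed
  next
    case True
    let ?Z = "{x \<in> ?H. fst x m = 0}"
    let ?V = "{x \<in> ?H. 1 \<le> fst x m}"
    let ?W = "{x \<in> ?H. 1 \<le> fst x (m - 1)}"
    let ?J = "{x \<in> ?H. 1 \<le> fst x (m - 1) \<or> 2 \<le> fst x m}"
    \<comment> \<open>\<open>d l\<close> is the coefficient of \<open>u m\<close> in
      \<open>y l\<close>, \<open>Cl l\<close> is the part free of \<open>\<beta>\<^sub>m\<close>,
      and \<open>e l\<close> collects the \<open>u j\<close> with j < m, which all contain the
      \<beta> of index m - 1. Where \<open>d l\<close> is nonzero, \<open>Cl l\<close> is the same
      function for all l.\<close>
    define d where "d l = (if l \<le> m then ?\<kappa> m else if l = m + 1 then ?\<kappa> m - 1 else 0)" for l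
    define Cl where "Cl l = (if l \<le> m + 1 then C (m + 1) else y l)" for l
    define e where "e l \<beta> = y l \<beta> - Cl l \<beta> - of_real (d l) * u m \<beta>" for l \<beta>
    have CZ: "rep N r ?Z (C (m + 1)) \<rho>"
    proof -
      have "rep N r ?Z (\<lambda>\<beta>. base \<beta> + (\<Sum>j\<in>{m+1..<n}. of_real (?\<kappa> j) * u j \<beta>)) (b + b * \<kappa>s)"
        by (intro rep_add[OF r] lin rep_mono[OF base _ order_refl])
          (use m True chainH in \<open>auto simp: chain_pair_def\<close>)
      then show ?thesis
        by (rule rep_cong[OF rep_mono]) (use b in \<open>auto simp: C \<rho>' algebra_simps\<close>)
    qed
    have ClZ: "rep N r ?Z (Cl l) \<rho>" if l: "l \<in> {1..n}" for l
    proof (cases "l \<le> m + 1")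
      case False
      have "rep N r ?Z (y l) \<rho>"
        by (rule y_gen[OF l]) (use False m chainH in \<open>auto simp: chain_pair_def\<close>)
      then show ?thesis using False by (simp add: Cl_def)
    qed (use CZ in \<open>simp add: Cl_def\<close>)
    have \<kappa>m: "\<bar>?\<kappa> m\<bar> \<le> \<kappa>s" unfolding \<kappa>s_def
      by (rule member_le_sum[of m "{..<n}" "\<lambda>j. \<bar>?\<kappa> j\<bar>"]) (use True in auto)
    have dV: "rep N r ?V (\<lambda>\<beta>. of_real (d l) * u m \<beta>) \<rho>" for l
    proof -
      have "rep N r ?V (u m) b" by (rule u_any) (use True m chainH in \<open>auto simp: chain_pair_def\<close>)
      from rep_cmult[OF r this, of "of_real (d l)"]
      have "rep N r ?V (\<lambda>\<beta>. of_real (d l) * u m \<beta>) (\<bar>d l\<bar> * b)" by simp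
      moreover have "\<bar>d l\<bar> \<le> 2 + \<kappa>s" using \<kappa>m by (auto simp: d_def)
      then have "\<bar>d l\<bar> * b \<le> \<rho>" using b by (simp add: \<rho>' mult.commute mult_left_mono)
      ultimately show ?thesis by (rule rep_mono[OF _ order_refl])
    qed
    have C_split: "C l \<beta> = C k \<beta> + (\<Sum>j=l..<k. of_real (?\<kappa> j) * u j \<beta>)" if "l \<le> k" "k \<le> n" for l k \<beta>
      using sum.atLeastLessThan_concat[OF that, of "\<lambda>j. of_real (?\<kappa> j) * u j \<beta>", symmetric]
      by (simp add: C add_ac)
    have eW: "rep N r ?W (e l) \<rho>" if l: "l \<in> {1..n}" for l
    proof -
      consider "l \<le> m" | "l = m + 1" | "m + 1 < l" by linarith
      then show ?thesis
      proof cases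
        case 1
        have e_eq: "e l = (\<lambda>\<beta>. (\<Sum>j\<in>{l-1..<m}. of_real (?\<kappa> j) * u j \<beta>) - u (l - 1) \<beta>)"
        proof
          fix \<beta>
          have "C (l - 1) \<beta> = C (m + 1) \<beta> + ((\<Sum>j=l-1..<m. of_real (?\<kappa> j) * u j \<beta>) + of_real (?\<kappa> m) * u m \<beta>)"
            using C_split[of "l - 1" "m + 1" \<beta>] 1 True by (simp add: sum.atLeastLessThan_Suc)
          then show "e l \<beta> = (\<Sum>j\<in>{l-1..<m}. of_real (?\<kappa> j) * u j \<beta>) - u (l - 1) \<beta>"
            using 1 by (simp add: e_def y Cl_def d_def)
        qed
        have cW: "chain_pair n j \<in> ?W" if "1 \<le> j" "j < m" for j
          using chainH[OF that(1)] that True by (auto simp: chain_pair_def)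
        have "rep N r ?W (\<lambda>\<beta>. (\<Sum>j\<in>{l-1..<m}. of_real (?\<kappa> j) * u j \<beta>) - u (l - 1) \<beta>) (b * \<kappa>s + b)"
          by (intro rep_diff[OF r] lin u_any cW) (use 1 True l in auto)
        then show ?thesis unfolding e_eq
          by (rule rep_mono[OF _ order_refl]) (use b in \<open>auto simp: \<rho>' algebra_simps\<close>)
      next
        case 2
        have "e l = (\<lambda>_. 0)"
        proof
          fix \<beta>
          show "e l \<beta> = 0"
            using C_split[of m "m + 1" \<beta>] 2 True by (simp add: e_def y Cl_def d_def algebra_simps)
        qed
        then show ?thesis using rep_mono[OF rep_zero[OF r] order_refl \<rho>0] by simp
      next
        case 3
        then have "e l = (\<lambda>_. 0)" by (auto simp: e_def Cl_def d_def)
        then show ?thesis using rep_mono[OF rep_zero[OF r] order_refl \<rho>0] by simp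
      qed
    qed
    have y_eq: "y l \<beta> = Cl l \<beta> + of_real (d l) * u m \<beta> + e l \<beta>" for l \<beta> by (simp add: e_def)
    define E where "E l \<beta> = y l \<beta> ^ p - Cl l \<beta> ^ p - of_nat p * Cl l \<beta> ^ (p - 1) * (of_real (d l) * u m \<beta>)" for l \<beta>
    have ER: "rep N r ?J (E l) ((5 * \<rho>) ^ p)" if l: "l \<in> {1..n}" for l
    proof -
      have "rep N r ?J (\<lambda>\<beta>. (Cl l \<beta> + of_real (d l) * u m \<beta> + e l \<beta>) ^ p - Cl l \<beta> ^ p
          - of_nat p * Cl l \<beta> ^ (p - 1) * (of_real (d l) * u m \<beta>)) ((5 * \<rho>) ^ p)"
        by (rule rep_linear_expansion[OF r ClZ[OF l] dV eW[OF l], where H = ?H])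
          (auto simp: cluster_exponents_0 cluster_exponents_add, auto simp: pair_add_def)
      then show ?thesis unfolding E_def[abs_def] y_eq .
    qed
    have S_eq: "(\<Sum>l=1..n. of_real (a l) * y l \<beta> ^ p) =
        (\<Sum>l=1..n. of_real (a l) * E l \<beta> + of_real (a l) * Cl l \<beta> ^ p)" for \<beta>
    proof -
      have "(\<Sum>l=1..n. of_real (a l) * (of_nat p * Cl l \<beta> ^ (p - 1) * (of_real (d l) * u m \<beta>))) =
          (\<Sum>l=1..n. of_nat p * C (m + 1) \<beta> ^ (p - 1) * u m \<beta> * of_real (a l * d l))"
        by (rule sum.cong) (auto simp: Cl_def d_def)
      also have "\<dots> = of_nat p * C (m + 1) \<beta> ^ (p - 1) * u m \<beta> * of_real (\<Sum>l=1..n. a l * d l)"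
        by (simp add: sum_distrib_left)
      \<comment> \<open>Varying \<open>u m\<close> moves the first \<open>m\<close> vortices against
        the next one with their common centre fixed.\<close>
      also have "(\<Sum>l=1..n. a l * d l) = 0"
      proof -
        have "{1..n} = {1..m} \<union> insert (m + 1) {m+2..n}" using m True by auto
        then have "(\<Sum>l=1..n. a l * d l) = (\<Sum>l\<in>{1..m}. a l * d l) + (\<Sum>l\<in>insert (m + 1) {m+2..n}. a l * d l)"
          by (subst sum.union_disjoint[symmetric]) auto
        also have "(\<Sum>l\<in>insert (m + 1) {m+2..n}. a l * d l) = a (m + 1) * (?\<kappa> m - 1)"
          by (subst sum.insert) (auto simp: d_def)
        also have "(\<Sum>l\<in>{1..m}. a l * d l) = partial_strength a m * ?\<kappa> m"
          by (simp add: d_def partial_strength_def sum_distrib_right)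
        also have "partial_strength a m * ?\<kappa> m + a (m + 1) * (?\<kappa> m - 1) =
            partial_strength a (m + 1) * ?\<kappa> m - a (m + 1)"
          by (simp add: partial_strength_def algebra_simps)
        also have "\<dots> = 0" using A[of "m + 1"] m by (simp add: kappa_def)
        finally show ?thesis .
      qed
      finally have z: "(\<Sum>l=1..n. of_real (a l) * (of_nat p * Cl l \<beta> ^ (p - 1) * (of_real (d l) * u m \<beta>))) = 0"
        by simp
      have "(\<Sum>l=1..n. of_real (a l) * y l \<beta> ^ p) = (\<Sum>l=1..n. (of_real (a l) * E l \<beta> + of_real (a l) * Cl l \<beta> ^ p)
          + of_real (a l) * (of_nat p * Cl l \<beta> ^ (p - 1) * (of_real (d l) * u m \<beta>)))"
        by (rule sum.cong) (auto simp: E_def algebra_simps)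
      then show ?thesis unfolding sum.distrib[of "\<lambda>l. _ l + _ l"] z by simp
    qed
    have "rep N r ?X (\<lambda>\<beta>. of_real (a l) * E l \<beta> + of_real (a l) * Cl l \<beta> ^ p)
        (\<bar>a l\<bar> * (5 * \<rho>) ^ p + \<bar>a l\<bar> * \<rho> ^ p)" if l: "l \<in> {1..n}" for l
    proof (rule rep_add[OF r])
      have J: "?J \<subseteq> ?X" by (auto simp: no_leading_one_def)
      show "rep N r ?X (\<lambda>\<beta>. of_real (a l) * E l \<beta>) (\<bar>a l\<bar> * (5 * \<rho>) ^ p)"
        using rep_mono[OF rep_cmult[OF r ER[OF l], of "of_real (a l)"] J order_refl] by simp
      have Z: "?Z \<subseteq> ?X" by (auto simp: no_leading_one_def)
      have "rep N r ?Z (\<lambda>\<beta>. Cl l \<beta> ^ p) (\<rho> ^ p)"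
        by (rule rep_power[OF r ClZ[OF l]])
          (auto simp: cluster_exponents_0 cluster_exponents_add, auto simp: pair_add_def)
      from rep_mono[OF rep_cmult[OF r this, of "of_real (a l)"] Z order_refl]
      show "rep N r ?X (\<lambda>\<beta>. of_real (a l) * Cl l \<beta> ^ p) (\<bar>a l\<bar> * \<rho> ^ p)" by simp
    qed
    then have "rep N r ?X (\<lambda>\<beta>. \<Sum>l=1..n. of_real (a l) * E l \<beta> + of_real (a l) * Cl l \<beta> ^ p)
        (\<Sum>l=1..n. \<bar>a l\<bar> * (5 * \<rho>) ^ p + \<bar>a l\<bar> * \<rho> ^ p)"
      by (intro rep_sum[OF r]) auto
    then show ?thesis unfolding S_eq
    proof (rule rep_mono[OF _ order_refl])
      have le: "\<rho> ^ p \<le> (5 * \<rho>) ^ p" using \<rho>0 by (intro power_mono) auto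
      have "(\<Sum>l=1..n. \<bar>a l\<bar> * (5 * \<rho>) ^ p + \<bar>a l\<bar> * \<rho> ^ p) \<le> (\<Sum>l=1..n. \<bar>a l\<bar> * (2 * (5 * \<rho>) ^ p))"
        by (rule sum_mono) (use mult_left_mono[OF le] in \<open>force simp: algebra_simps\<close>)
      also have "\<dots> = 2 * (\<Sum>l=1..n. \<bar>a l\<bar>) * (5 * \<rho>) ^ p"
        by (simp add: sum_distrib_right[symmetric])
      finally show "(\<Sum>l=1..n. \<bar>a l\<bar> * (5 * \<rho>) ^ p + \<bar>a l\<bar> * \<rho> ^ p) \<le> 2 * (\<Sum>l=1..n. \<bar>a l\<bar>) * (5 * \<rho>) ^ p" .
    qed
  qed
qed

lemma has_sum_finite_sum:
  fixes f :: "'a \<Rightarrow> nat \<Rightarrow> complex"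
  assumes "finite A" "\<And>a. a \<in> A \<Longrightarrow> (f a has_sum F a) UNIV"
  shows "((\<lambda>p. \<Sum>a\<in>A. f a p) has_sum (\<Sum>a\<in>A. F a)) UNIV"
  using assms by (induction A rule: finite_induct) (auto intro: has_sum_add)

section \<open>Vortex positions in terms of \<beta>\<close>

text \<open>\<open>chain N j\<close> is \<open>\<alpha>\<^sub>j\<close> for 1 \<le> j < N, and for n
  < N \<open>chain n j\<close> is the quotient of \<open>\<alpha>\<^sub>j\<close> by
  \<open>\<alpha>\<^sub>n\<close>. The value at \<open>j = 0\<close> implements the convention that
  \<open>u\<^sub>0\<close> is zero.\<close>

definition chain :: "nat \<Rightarrow> nat \<Rightarrow> (nat \<Rightarrow> complex) \<Rightarrow> complex" where
  "chain n j \<beta> = (if j = 0 then 0 else \<Prod>i=j..<n. \<beta> i)"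

lemma chain_monomial:
  assumes "1 \<le> j" "n \<le> N"
  shows "monomial N \<beta> (chain_pair n j) = chain n j \<beta>"
proof -
  have "(\<Prod>i=1..N. \<beta> i ^ (if j \<le> i \<and> i < n then 1 else 0)) = (\<Prod>i=1..N. if i \<in> {j..<n} then \<beta> i else 1)"
    by (rule prod.cong) auto
  also have "\<dots> = (\<Prod>i\<in>{j..<n}. \<beta> i)"
    using assms by (subst prod.inter_restrict[symmetric]) (auto intro!: prod.cong)
  finally show ?thesis using assms by (simp add: monomial_def chain_pair_def chain_def)
qed

lemma chain_rep:
  assumes "1 \<le> j" "j < n" "n \<le> N" "0 \<le> r" "r \<le> 1"
  shows "rep N r {chain_pair n j} (chain n j) r"
proof -
  have "pair_degree N (chain_pair n j) \<ge> 1"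
  proof -
    have "fst (chain_pair n j) j + snd (chain_pair n j) j \<le> pair_degree N (chain_pair n j)"
      unfolding pair_degree_def by (rule member_le_sum) (use assms in auto)
    then show ?thesis using assms by (simp add: chain_pair_def)
  qed
  then have "r ^ pair_degree N (chain_pair n j) \<le> r ^ 1" using assms by (intro power_decreasing) auto
  moreover have "rep N r {chain_pair n j} (\<lambda>\<beta>. 1 * monomial N \<beta> (chain_pair n j)) (cmod 1 * r ^ pair_degree N (chain_pair n j))"
    by (rule rep_monomial) (use assms in auto)
  note le = calculation this
  have "rep N r {chain_pair n j} (\<lambda>\<beta>. 1 * monomial N \<beta> (chain_pair n j)) r"
    by (rule rep_mono[OF le(2) order_refl]) (use le(1) in simp)
  then show ?thesis by (rule rep_cong) (use assms in \<open>simp add: chain_monomial\<close>)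
qed

lemma chain_concat:
  assumes "1 \<le> n" "j \<le> n" "n \<le> N"
  shows "chain N j \<beta> = chain n j \<beta> * chain N n \<beta>"
  using prod.atLeastLessThan_concat[OF assms(2,3), of \<beta>] assms(1) by (auto simp: chain_def)

text \<open>Positions of the first \<open>n\<close> vortices in terms of Jacobi coordinates \<open>u\<^sub>1, \<dots>, u\<^bsub>n-1\<^esub>\<close> and of the
  centre of mass; \<open>u\<^sub>0\<close> has to be zero.\<close>

definition centre :: "(nat \<Rightarrow> real) \<Rightarrow> nat \<Rightarrow> (nat \<Rightarrow> complex) \<Rightarrow> complex \<Rightarrow> nat \<Rightarrow> complex" where
  "centre a n u c l = c + (\<Sum>j=l..<n. of_real (kappa a (j + 1)) * u j)"

definition position :: "(nat \<Rightarrow> real) \<Rightarrow> nat \<Rightarrow> (nat \<Rightarrow> complex) \<Rightarrow> complex \<Rightarrow> nat \<Rightarrow> complex" where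
  "position a n u c l = centre a n u c (l - 1) - u (l - 1)"

definition kappa_sum :: "(nat \<Rightarrow> real) \<Rightarrow> nat \<Rightarrow> real" where
  "kappa_sum a n = (\<Sum>j<n. \<bar>kappa a (j + 1)\<bar>)"

lemma kappa_sum_mono: "n \<le> N \<Longrightarrow> kappa_sum a n \<le> kappa_sum a N"
  unfolding kappa_sum_def by (rule sum_mono2) auto

lemma kappa_sum_nonneg: "0 \<le> kappa_sum a n"
  by (auto simp: kappa_sum_def intro: sum_nonneg)

lemma norm_position_le:
  assumes "l \<in> {1..n}" "\<And>j. j < n \<Longrightarrow> cmod (u j) \<le> b" "cmod c \<le> b"
  shows "cmod (position a n u c l) \<le> b * (2 + kappa_sum a n)"
proof -
  have b: "0 \<le> b" using assms(3) norm_ge_zero order_trans by blast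
  have "cmod (\<Sum>j=l-1..<n. of_real (kappa a (j + 1)) * u j) \<le> (\<Sum>j=l-1..<n. \<bar>kappa a (j + 1)\<bar> * b)"
    by (rule sum_norm_le) (use assms(2) in \<open>auto simp: norm_mult intro!: mult_left_mono\<close>)
  also have "\<dots> \<le> (\<Sum>j<n. \<bar>kappa a (j + 1)\<bar> * b)"
    by (rule sum_mono2) (use b in auto)
  also have "\<dots> = b * kappa_sum a n" by (simp add: kappa_sum_def sum_distrib_left mult.commute)
  finally have 1: "cmod (\<Sum>j=l-1..<n. of_real (kappa a (j + 1)) * u j) \<le> b * kappa_sum a n" .
  have 2: "cmod (u (l - 1)) \<le> b" using assms by auto
  have "cmod (position a n u c l) \<le> cmod c + cmod (\<Sum>j=l-1..<n. of_real (kappa a (j + 1)) * u j) + cmod (u (l - 1))"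
    unfolding position_def centre_def by (meson add_mono norm_triangle_ineq norm_triangle_ineq4 order_refl order_trans)
  also have "\<dots> \<le> b + b * kappa_sum a n + b" using 1 2 assms(3) by linarith
  also have "\<dots> = b * (2 + kappa_sum a n)" by (simp add: algebra_simps)
  finally show ?thesis .
qed

lemma centre_step:
  assumes "l < n"
  shows "centre a n u c l = centre a n u c (Suc l) + of_real (kappa a (l + 1)) * u l"
  unfolding centre_def using sum.atLeast_Suc_lessThan[OF assms, of "\<lambda>j. of_real (kappa a (j + 1)) * u j"] by simp

text \<open>By induction \<open>centre a N u c k\<close> is the centre of mass of the first
  \<open>k\<close> vortices; its recursion is the definition of \<kappa> with denominators
  cleared.\<close>

lemma jacobi_position:
  assumes A: "\<And>k. k \<in> {1..N} \<Longrightarrow> partial_strength a k \<noteq> 0" and u: "u 0 = 0" and k: "k \<in> {1..N}"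
  shows "jacobi_coord a N (position a N u c) k = (if k = N then c else u k)"
proof -
  have sum: "(\<Sum>l=1..k. of_real (a l) * position a N u c l) = of_real (partial_strength a k) * centre a N u c k"
    if "k \<le> N" for k
    using that
  proof (induction k)
    case (Suc k)
    have e: "of_real (partial_strength a (Suc k)) * of_real (kappa a (Suc k)) = (of_real (a (Suc k)) :: complex)"
      using A[of "Suc k"] Suc.prems by (simp add: kappa_def)
    have p: "of_real (partial_strength a k) = (of_real (partial_strength a (Suc k)) - of_real (a (Suc k)) :: complex)"
      by (simp add: partial_strength_def)
    have c: "centre a N u c k = centre a N u c (Suc k) + of_real (kappa a (Suc k)) * u k"
      using centre_step[of k N a u c] Suc.prems by simp
    have "(\<Sum>l=1..Suc k. of_real (a l) * position a N u c l) =
        of_real (partial_strength a k) * centre a N u c k + of_real (a (Suc k)) * (centre a N u c k - u k)"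
      using Suc by (simp add: position_def)
    also have "\<dots> = of_real (partial_strength a (Suc k)) * centre a N u c (Suc k) +
        (of_real (partial_strength a (Suc k)) * of_real (kappa a (Suc k)) - of_real (a (Suc k))) * u k"
      unfolding p c by (simp only: algebra_simps)
    finally show ?case unfolding e by simp
  qed (simp add: partial_strength_def)
  have "(\<Sum>l=1..k. of_real (a l) * position a N u c l) / of_real (partial_strength a k) = centre a N u c k"
    using sum[of k] A[OF k] k by simp
  then show ?thesis by (auto simp: jacobi_coord_def position_def centre_def)
qed

text \<open>Seen from vortex \<open>n + 1\<close>, and in units of \<open>u n\<close>, the first
  \<open>n\<close> vortices form a cluster of the same kind with rescaled coordinates. This splits
  each logarithm into one of \<open>h0\<close>, a constant and a power series.\<close>

lemma position_diff:
  assumes n: "1 \<le> n" "n < N" and l: "l \<in> {1..n}" and u: "\<And>j. j < n \<Longrightarrow> u j = u' j * u n"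
  shows "position a N u c l - position a N u c (Suc n) = u n * (1 + position a n u' 0 l)"
proof -
  have "centre a N u c (l - 1) = c + ((\<Sum>j=l-1..<n. of_real (kappa a (j + 1)) * u j) + (\<Sum>j=n..<N. of_real (kappa a (j + 1)) * u j))"
    unfolding centre_def by (subst sum.atLeastLessThan_concat) (use l n in auto)
  also have "(\<Sum>j=l-1..<n. of_real (kappa a (j + 1)) * u j) = (\<Sum>j=l-1..<n. of_real (kappa a (j + 1)) * u' j) * u n"
    unfolding sum_distrib_right by (rule sum.cong) (auto simp: u)
  finally show ?thesis
    using u[of "l - 1"] l by (auto simp: position_def centre_def algebra_simps)
qed

section \<open>Exponents of the logarithmic and of the regular part\<close>

text \<open>Monotonicity is asked only where the larger index carries a nonzero exponent, because
  the logarithms of the first \<open>n + 1\<close> vortices break off before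
  \<open>\<beta>\<^sub>n\<close>.\<close>

definition final_exponents :: "nat \<Rightarrow> nat \<Rightarrow> exponent_pair set" where
  "final_exponents N m = {x \<in> multi_indices N \<times> multi_indices N.
     (\<forall>i j. 1 \<le> i \<longrightarrow> i \<le> j \<longrightarrow> j < N \<longrightarrow> fst x j \<noteq> 0 \<longrightarrow> fst x i \<le> fst x j) \<and>
     (\<forall>i j. 1 \<le> i \<longrightarrow> i \<le> j \<longrightarrow> j < N \<longrightarrow> snd x j \<noteq> 0 \<longrightarrow> snd x i \<le> snd x j) \<and>
     (\<forall>i j l. i \<le> j \<longrightarrow> j \<le> l \<longrightarrow> fst x i \<noteq> 0 \<or> snd x i \<noteq> 0 \<longrightarrow> fst x l \<noteq> 0 \<or> snd x l \<noteq> 0 \<longrightarrow>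
        fst x j \<noteq> 0 \<or> snd x j \<noteq> 0) \<and>
     no_leading_one m (fst x) \<and> no_leading_one m (snd x)}"

text \<open>The part of \<open>final_exponents\<close> that is closed under addition; it serves the
  regular part, where power sums get multiplied.\<close>

definition monotone_exponents :: "nat \<Rightarrow> nat \<Rightarrow> exponent_pair set" where
  "monotone_exponents N m = {x \<in> multi_indices N \<times> multi_indices N.
     (\<forall>i j. 1 \<le> i \<longrightarrow> i \<le> j \<longrightarrow> j < N \<longrightarrow> fst x i \<le> fst x j) \<and>
     (\<forall>i j. 1 \<le> i \<longrightarrow> i \<le> j \<longrightarrow> j < N \<longrightarrow> snd x i \<le> snd x j) \<and>
     no_leading_one m (fst x) \<and> no_leading_one m (snd x)}"

lemma monotone_exponents_add:
  assumes "x \<in> monotone_exponents N m" "y \<in> monotone_exponents N m"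
  shows "pair_add x y \<in> monotone_exponents N m"
  using assms unfolding monotone_exponents_def pair_add_def no_leading_one_def
  by (auto simp: mem_Times_iff intro!: multi_indices_add add_mono)

lemma multi_indices_outside: "K \<in> multi_indices N \<Longrightarrow> K i \<noteq> 0 \<Longrightarrow> 1 \<le> i \<and> i \<le> N"
  unfolding multi_indices_def by (cases "i \<in> {1..N}") auto

lemma monotone_final: "monotone_exponents N m \<subseteq> final_exponents N m"
proof
  fix x assume x: "x \<in> monotone_exponents N m"
  have MI: "fst x \<in> multi_indices N" "snd x \<in> multi_indices N"
    using x by (auto simp: monotone_exponents_def)
  have mono: "fst x i \<le> fst x j" "snd x i \<le> snd x j" if "1 \<le> i" "i \<le> j" "j < N" for i j
    using x that by (auto simp: monotone_exponents_def)
  have "fst x j \<noteq> 0 \<or> snd x j \<noteq> 0"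
    if h: "i \<le> j" "j \<le> l" "fst x i \<noteq> 0 \<or> snd x i \<noteq> 0" "fst x l \<noteq> 0 \<or> snd x l \<noteq> 0" for i j l
  proof -
    have "1 \<le> i" "l \<le> N" using h multi_indices_outside MI by blast+
    show ?thesis
    proof (cases "j < N")
      case True
      then show ?thesis using mono[of i j] h \<open>1 \<le> i\<close> by auto
    next
      case False
      then have "j = l" using \<open>l \<le> N\<close> h by simp
      then show ?thesis using h by simp
    qed
  qed
  then show "x \<in> final_exponents N m"
    using x unfolding final_exponents_def monotone_exponents_def by blast
qed

lemma cluster_final:
  assumes n: "n < N" and x: "x \<in> cluster_exponents N n" "no_leading_one m (fst x)"
  shows "x \<in> final_exponents N m" "pair_swap x \<in> final_exponents N m"
proof -
  have MI: "fst x \<in> multi_indices N" "snd x \<in> multi_indices N"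
    using x by (auto simp: cluster_exponents_def)
  have snd0: "snd x i = 0" for i
    using x n MI(2) by (cases "i \<le> N") (auto simp: cluster_exponents_def multi_indices_def le_less)
  have fst0: "fst x i = 0" if "n \<le> i" for i
    using x n MI(1) that by (cases "i \<le> N") (auto simp: cluster_exponents_def multi_indices_def le_less)
  have mono: "fst x i \<le> fst x j" if "1 \<le> i" "i \<le> j" "j < n" for i j
    using x that by (auto simp: cluster_exponents_def)
  have 1: "fst x i \<le> fst x j" if "1 \<le> i" "i \<le> j" "fst x j \<noteq> 0" for i j
    using mono[of i j] fst0[of j] that by (cases "j < n") auto
  have 2: "fst x j \<noteq> 0" if "i \<le> j" "j \<le> l" "fst x i \<noteq> 0" "fst x l \<noteq> 0" for i j l
  proof -
    have "1 \<le> i" using multi_indices_outside[OF MI(1) that(3)] by simp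
    moreover have "j < n" using fst0[of l] that by (cases "l < n") auto
    ultimately show ?thesis using mono[of i j] that by auto
  qed
  have nl: "no_leading_one m (snd x)" by (simp add: no_leading_one_def snd0)
  show "x \<in> final_exponents N m" "pair_swap x \<in> final_exponents N m"
    using MI x(2) nl 1 2 unfolding final_exponents_def pair_swap_def by (auto simp: snd0 mem_Times_iff)
qed

text \<open>Exchanging the sum over vortices with the logarithmic series leaves weighted power sums
  of the cluster, to which the cancellation applies; the logarithm of a single vortex would contain
  the linear terms.\<close>

lemma log_part_rep:
  assumes n: "1 \<le> n" "n < N" and m: "1 \<le> m" "m < N"
    and A: "\<And>k. k \<in> {1..N} \<Longrightarrow> partial_strength a k \<noteq> 0"
    and r: "0 \<le> r" "r \<le> 1" "5 * (r * (2 + kappa_sum a n)) < 1"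
  shows "\<exists>B. rep N r (final_exponents N m)
    (\<lambda>\<beta>. of_real (\<Sum>l=1..n. a l * ln (cmod (1 + position a n (\<lambda>j. chain n j \<beta>) 0 l)))) B"
proof -
  define \<rho> where "\<rho> = r * (2 + kappa_sum a n)"
  have \<rho>: "0 \<le> \<rho>" "5 * \<rho> < 1" using r kappa_sum_nonneg[of a n] by (simp_all add: \<rho>_def)
  let ?y = "\<lambda>l \<beta>. position a n (\<lambda>j. chain n j \<beta>) 0 l"
  let ?X = "{x \<in> cluster_exponents N n. no_leading_one m (fst x)}"
  define K where "K = 2 * (\<Sum>l=1..n. \<bar>a l\<bar>)"
  have K: "0 \<le> K" by (auto simp: K_def intro!: sum_nonneg)
  have S: "rep N r ?X (\<lambda>\<beta>. \<Sum>l=1..n. of_real (a l) * ?y l \<beta> ^ p) (K * (5 * \<rho>) ^ p)" for p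
    unfolding K_def
  proof (rule power_sum_rep[OF r(1) n(1) less_imp_le[OF n(2)] m A, where u = "chain n" and b = r and base = "\<lambda>_. 0"
        and C = "\<lambda>l \<beta>. centre a n (\<lambda>j. chain n j \<beta>) 0 l"])
    show "rep N r {chain_pair n j} (chain n j) r" if "1 \<le> j" "j < n" for j
      by (rule chain_rep) (use that n r in auto)
    show "rep N r {x \<in> cluster_exponents N n. \<forall>i<N. fst x i = 0} (\<lambda>_. 0) r"
      using rep_mono[OF rep_zero[OF r(1)] order_refl r(1)] by simp
  qed (use r in \<open>auto simp: chain_def centre_def position_def \<rho>_def kappa_sum_def fun_eq_iff\<close>)
  have y_le: "cmod (?y l \<beta>) \<le> \<rho>" if "l \<in> {1..n}" "\<beta> \<in> closed_polydisc N r" for l \<beta>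
    unfolding \<rho>_def
  proof (rule norm_position_le[OF that(1)])
    show "cmod (chain n j \<beta>) \<le> r" if j: "j < n" for j
    proof (cases "j = 0")
      case True
      then show ?thesis using r by (simp add: chain_def)
    next
      case False
      have "rep N r {chain_pair n j} (chain n j) r" by (rule chain_rep) (use False j n r in auto)
      then show ?thesis by (rule rep_bound) (rule \<open>\<beta> \<in> closed_polydisc N r\<close>)
    qed
  qed (use r in simp)
  have "rep N r ?X (\<lambda>\<beta>. \<Sum>l=1..n. of_real (a l) * Ln (1 + ?y l \<beta>)) (K * (1 / (1 - 5 * \<rho>)))"
  proof (rule rep_infsum[OF r(1)])
    show "rep N r ?X (\<lambda>\<beta>. (- ((-1) ^ p) / of_nat p) * (\<Sum>l=1..n. of_real (a l) * ?y l \<beta> ^ p)) (K * (5 * \<rho>) ^ p)" for p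
    proof -
      have c: "cmod (- ((-1) ^ p) / of_nat p) \<le> 1"
        by (cases p) (simp_all add: norm_divide norm_power del: of_nat_Suc)
      have "cmod (- ((-1) ^ p) / of_nat p) * (K * (5 * \<rho>) ^ p) \<le> 1 * (K * (5 * \<rho>) ^ p)"
        by (rule mult_right_mono[OF c]) (use K \<rho> in auto)
      then have le: "cmod (- ((-1) ^ p) / of_nat p) * (K * (5 * \<rho>) ^ p) \<le> K * (5 * \<rho>) ^ p" by simp
      show ?thesis by (rule rep_mono[OF rep_cmult[OF r(1) S] order_refl le])
    qed
    show "((\<lambda>p. K * (5 * \<rho>) ^ p) has_sum K * (1 / (1 - 5 * \<rho>))) UNIV"
      by (intro has_sum_cmult_right has_sum_geometric) (use \<rho> in auto)
    fix \<beta> assume \<beta>: "\<beta> \<in> closed_polydisc N r"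
    have "((\<lambda>p. (- ((-1) ^ p) / of_nat p) * ?y l \<beta> ^ p) has_sum Ln (1 + ?y l \<beta>)) UNIV" if "l \<in> {1..n}" for l
      by (rule has_sum_Ln) (use y_le[OF that \<beta>] \<rho> in linarith)
    then have "((\<lambda>p. \<Sum>l=1..n. of_real (a l) * ((- ((-1) ^ p) / of_nat p) * ?y l \<beta> ^ p)) has_sum
        (\<Sum>l=1..n. of_real (a l) * Ln (1 + ?y l \<beta>))) UNIV"
      by (intro has_sum_finite_sum has_sum_cmult_right) auto
    then show "((\<lambda>p. (- ((-1) ^ p) / of_nat p) * (\<Sum>l=1..n. of_real (a l) * ?y l \<beta> ^ p)) has_sum
        (\<Sum>l=1..n. of_real (a l) * Ln (1 + ?y l \<beta>))) UNIV"
      by (simp add: sum_distrib_left mult_ac)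
  qed
  from rep_Re[OF r(1) this]
  have "rep N r (final_exponents N m) (\<lambda>\<beta>. of_real (Re (\<Sum>l=1..n. of_real (a l) * Ln (1 + ?y l \<beta>)))) (K * (1 / (1 - 5 * \<rho>)))"
    by (rule rep_mono) (use cluster_final[OF n(2)] in auto)
  then have "rep N r (final_exponents N m) (\<lambda>\<beta>. of_real (\<Sum>l=1..n. a l * ln (cmod (1 + ?y l \<beta>)))) (K * (1 / (1 - 5 * \<rho>)))"
  proof (rule rep_cong)
    fix \<beta> assume \<beta>: "\<beta> \<in> closed_polydisc N r"
    have "Re (of_real (a l) * Ln (1 + ?y l \<beta>)) = a l * ln (cmod (1 + ?y l \<beta>))" if "l \<in> {1..n}" for l
    proof -
      have "cmod (?y l \<beta>) < 1" using y_le[OF that \<beta>] \<rho> by linarith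
      then have "1 + ?y l \<beta> \<noteq> 0" by (metis add.commute add_eq_0_iff norm_minus_cancel norm_one order_less_irrefl)
      then show ?thesis by (simp add: Re_Ln)
    qed
    then have "(\<Sum>l=1..n. Re (of_real (a l) * Ln (1 + ?y l \<beta>))) = (\<Sum>l=1..n. a l * ln (cmod (1 + ?y l \<beta>)))"
      by (rule sum.cong[OF refl])
    then show "complex_of_real (Re (\<Sum>l=1..n. of_real (a l) * Ln (1 + ?y l \<beta>))) =
        complex_of_real (\<Sum>l=1..n. a l * ln (cmod (1 + ?y l \<beta>)))"
      unfolding Re_sum by (rule arg_cong)
  qed
  then show ?thesis by blast
qed

text \<open>Each monomial in the expansion of \<gamma> is a factor in \<open>z k\<close> times a
  factor in \<open>z l\<close>, so the weighted double sum is a product of two single sums. By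
  harmonicity each of them is a power sum of the positions or of their conjugates.\<close>

lemma green_part_rep:
  fixes base :: "(nat \<Rightarrow> complex) \<Rightarrow> complex"
  assumes N: "2 \<le> N" and m: "1 \<le> m" "m < N"
    and A: "\<And>k. k \<in> {1..N} \<Longrightarrow> partial_strength a k \<noteq> 0"
    and r: "0 \<le> r" "r \<le> 1"
    and base: "rep N r {x \<in> cluster_exponents N N. \<forall>i<N. fst x i = 0} base b" and b: "sqrt 2 * r \<le> b"
    and \<gamma>: "rep 2 s harmonic_exponents (\<lambda>\<beta>. of_real (\<gamma> (\<beta> 1) (\<beta> 2))) G"
    and s: "5 * (b * (2 + kappa_sum a N)) \<le> s"
  shows "\<exists>B. rep N r (final_exponents N m)
    (\<lambda>\<beta>. of_real (\<Sum>k=1..N. \<Sum>l=1..N. a k * a l *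
      \<gamma> (position a N (\<lambda>j. of_real (sqrt 2) * chain N j \<beta>) (base \<beta>) k)
        (position a N (\<lambda>j. of_real (sqrt 2) * chain N j \<beta>) (base \<beta>) l))) B"
proof -
  define \<rho> where "\<rho> = b * (2 + kappa_sum a N)"
  have "0 \<le> sqrt 2 * r" using r by simp
  then have b0: "0 \<le> b" using b by linarith
  have \<rho>: "0 \<le> \<rho>" "5 * \<rho> \<le> s" using b0 s kappa_sum_nonneg[of a N] by (simp_all add: \<rho>_def)
  have s0: "0 \<le> s" using \<rho> by linarith
  let ?z = "\<lambda>k \<beta>. position a N (\<lambda>j. of_real (sqrt 2) * chain N j \<beta>) (base \<beta>) k"
  let ?X = "{x \<in> cluster_exponents N N. no_leading_one m (fst x)}"
  let ?M = "monotone_exponents N m"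
  define K where "K = 2 * (\<Sum>l=1..N. \<bar>a l\<bar>)"
  have K: "0 \<le> K" by (auto simp: K_def intro!: sum_nonneg)
  have u_rep: "rep N r {chain_pair N j} (\<lambda>\<beta>. of_real (sqrt 2) * chain N j \<beta>) b" if "1 \<le> j" "j < N" for j
  proof -
    have "rep N r {chain_pair N j} (\<lambda>\<beta>. of_real (sqrt 2) * chain N j \<beta>) (cmod (of_real (sqrt 2)) * r)"
      by (rule rep_cmult[OF r(1) chain_rep]) (use that r in auto)
    then show ?thesis by (rule rep_mono[OF _ order_refl]) (use b in simp)
  qed
  have S: "rep N r ?X (\<lambda>\<beta>. \<Sum>l=1..N. of_real (a l) * ?z l \<beta> ^ p) (K * (5 * \<rho>) ^ p)" for p
    unfolding K_def
  proof (rule power_sum_rep[OF r(1) _ order_refl m A, where u = "\<lambda>j \<beta>. of_real (sqrt 2) * chain N j \<beta>" and b = b and base = base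
        and C = "\<lambda>l \<beta>. centre a N (\<lambda>j. of_real (sqrt 2) * chain N j \<beta>) (base \<beta>) l"])
  qed (use N b0 u_rep base in \<open>auto simp: chain_def centre_def position_def \<rho>_def kappa_sum_def fun_eq_iff\<close>)
  have X: "x \<in> ?M \<and> pair_swap x \<in> ?M" if "x \<in> ?X" for x
  proof -
    have MI: "fst x \<in> multi_indices N" "snd x \<in> multi_indices N"
      and mono: "\<forall>i j. 1 \<le> i \<longrightarrow> i \<le> j \<longrightarrow> j < N \<longrightarrow> fst x i \<le> fst x j"
      and z: "\<forall>i<N. snd x i = 0" and nl: "no_leading_one m (fst x)"
      using that by (auto simp: cluster_exponents_def)
    have "\<forall>i j. 1 \<le> i \<longrightarrow> i \<le> j \<longrightarrow> j < N \<longrightarrow> snd x i \<le> snd x j" "no_leading_one m (snd x)"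
      using z m by (auto simp: no_leading_one_def)
    then show ?thesis
      using MI mono nl by (simp add: monotone_exponents_def pair_swap_def mem_Times_iff)
  qed
  then have XM: "?X \<subseteq> ?M" "pair_swap ` ?X \<subseteq> ?M" by blast+
  have S': "rep N r ?M (\<lambda>\<beta>. \<Sum>l=1..N. of_real (a l) * ?z l \<beta> ^ p) (K * s ^ p)"
    "rep N r ?M (\<lambda>\<beta>. \<Sum>l=1..N. of_real (a l) * cnj (?z l \<beta>) ^ p) (K * s ^ p)" for p
  proof -
    have le: "K * (5 * \<rho>) ^ p \<le> K * s ^ p" using K \<rho> by (intro mult_left_mono power_mono) auto
    show "rep N r ?M (\<lambda>\<beta>. \<Sum>l=1..N. of_real (a l) * ?z l \<beta> ^ p) (K * s ^ p)"
      by (rule rep_mono[OF S XM(1) le])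
    have "rep N r ?M (\<lambda>\<beta>. cnj (\<Sum>l=1..N. of_real (a l) * ?z l \<beta> ^ p)) (K * s ^ p)"
      by (rule rep_mono[OF rep_cnj[OF S] XM(2) le])
    then show "rep N r ?M (\<lambda>\<beta>. \<Sum>l=1..N. of_real (a l) * cnj (?z l \<beta>) ^ p) (K * s ^ p)" by simp
  qed
  have S'': "rep N r ?M (\<lambda>\<beta>. \<Sum>l=1..N. of_real (a l) * (?z l \<beta> ^ p * cnj (?z l \<beta>) ^ q)) (K * s ^ (p + q))"
    if "p = 0 \<or> q = 0" for p q
    using that S'(1)[of p] S'(2)[of q] by auto
  have z_le: "cmod (?z l \<beta>) \<le> s" if l: "l \<in> {1..N}" and \<beta>: "\<beta> \<in> closed_polydisc N r" for l \<beta>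
  proof -
    have "cmod (?z l \<beta>) \<le> \<rho>" unfolding \<rho>_def
    proof (rule norm_position_le[OF l])
      show "cmod (of_real (sqrt 2) * chain N j \<beta>) \<le> b" if "j < N" for j
        using rep_bound[OF u_rep \<beta>, of j] that b0 by (cases "j = 0") (auto simp: chain_def)
      show "cmod (base \<beta>) \<le> b" by (rule rep_bound[OF base \<beta>])
    qed
    then show ?thesis using \<rho> by linarith
  qed
  obtain c E t where cE: "\<And>n::nat. c n \<noteq> 0 \<Longrightarrow> E n \<in> harmonic_exponents"
     and t: "((\<lambda>n. cmod (c n) * s ^ pair_degree 2 (E n)) has_sum t) UNIV"
     and \<gamma>s: "\<And>\<beta>. \<beta>\<in>closed_polydisc 2 s \<Longrightarrow> ((\<lambda>n. c n * monomial 2 \<beta> (E n)) has_sum of_real (\<gamma> (\<beta> 1) (\<beta> 2))) UNIV"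
    using \<gamma> unfolding rep_def by blast
  let ?f = "\<lambda>q \<beta>. c q * ((\<Sum>k=1..N. of_real (a k) * (?z k \<beta> ^ fst (E q) 1 * cnj (?z k \<beta>) ^ snd (E q) 1)) *
      (\<Sum>l=1..N. of_real (a l) * (?z l \<beta> ^ fst (E q) 2 * cnj (?z l \<beta>) ^ snd (E q) 2)))"
  have "rep N r ?M (\<lambda>\<beta>. of_real (\<Sum>k=1..N. \<Sum>l=1..N. a k * a l * \<gamma> (?z k \<beta>) (?z l \<beta>))) (K * K * t)"
  proof (rule rep_infsum[OF r(1)])
    show "rep N r ?M (?f q) (K * K * (cmod (c q) * s ^ pair_degree 2 (E q)))" for q
    proof (cases "c q = 0")
      case True
      then show ?thesis using rep_zero[OF r(1)] by simp
    next
      case False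
      have h: "fst (E q) 1 = 0 \<or> snd (E q) 1 = 0" "fst (E q) 2 = 0 \<or> snd (E q) 2 = 0"
        using cE[OF False] by (auto simp: harmonic_exponents_def)
      have "pair_degree 2 (E q) = (fst (E q) 1 + snd (E q) 1) + (fst (E q) 2 + snd (E q) 2)"
        by (simp add: pair_degree_def numeral_2_eq_2)
      then have eq: "cmod (c q) * ((K * s ^ (fst (E q) 1 + snd (E q) 1)) * (K * s ^ (fst (E q) 2 + snd (E q) 2))) =
          K * K * (cmod (c q) * s ^ pair_degree 2 (E q))"
        by (simp add: power_add)
      show ?thesis unfolding eq[symmetric]
        by (rule rep_cmult[OF r(1) rep_mult[OF r(1) S''[OF h(1)] S''[OF h(2)] monotone_exponents_add]])
    qed
    show "((\<lambda>q. K * K * (cmod (c q) * s ^ pair_degree 2 (E q))) has_sum K * K * t) UNIV"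
      by (rule has_sum_cmult_right[OF t])
    fix \<beta> assume \<beta>: "\<beta> \<in> closed_polydisc N r"
    have "((\<lambda>q. c q * (?z k \<beta> ^ fst (E q) 1 * ?z l \<beta> ^ fst (E q) 2 * (cnj (?z k \<beta>) ^ snd (E q) 1 * cnj (?z l \<beta>) ^ snd (E q) 2)))
        has_sum of_real (\<gamma> (?z k \<beta>) (?z l \<beta>))) UNIV" if "k \<in> {1..N}" "l \<in> {1..N}" for k l
    proof -
      let ?b = "\<lambda>i::nat. if i = 1 then ?z k \<beta> else ?z l \<beta>"
      have "?b \<in> closed_polydisc 2 s" using z_le[OF _ \<beta>] that by (auto simp: closed_polydisc_def)
      from \<gamma>s[OF this] show ?thesis by (simp add: monomial_def numeral_2_eq_2)
    qed
    then have "((\<lambda>q. \<Sum>k=1..N. \<Sum>l=1..N. of_real (a k * a l) *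
          (c q * (?z k \<beta> ^ fst (E q) 1 * ?z l \<beta> ^ fst (E q) 2 * (cnj (?z k \<beta>) ^ snd (E q) 1 * cnj (?z l \<beta>) ^ snd (E q) 2))))
        has_sum (\<Sum>k=1..N. \<Sum>l=1..N. of_real (a k * a l) * of_real (\<gamma> (?z k \<beta>) (?z l \<beta>)))) UNIV"
      by (intro has_sum_finite_sum has_sum_cmult_right) auto
    moreover have "?f q \<beta> = (\<Sum>k=1..N. \<Sum>l=1..N. of_real (a k * a l) *
          (c q * (?z k \<beta> ^ fst (E q) 1 * ?z l \<beta> ^ fst (E q) 2 * (cnj (?z k \<beta>) ^ snd (E q) 1 * cnj (?z l \<beta>) ^ snd (E q) 2))))" for q
      unfolding sum_product unfolding sum_distrib_left
      by (intro sum.cong refl) (simp only: of_real_mult mult_ac)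
    moreover have "of_real (\<Sum>k=1..N. \<Sum>l=1..N. a k * a l * \<gamma> (?z k \<beta>) (?z l \<beta>)) =
        (\<Sum>k=1..N. \<Sum>l=1..N. of_real (a k * a l) * complex_of_real (\<gamma> (?z k \<beta>) (?z l \<beta>)))"
      by simp
    ultimately show "((\<lambda>q. ?f q \<beta>) has_sum of_real (\<Sum>k=1..N. \<Sum>l=1..N. a k * a l * \<gamma> (?z k \<beta>) (?z l \<beta>))) UNIV"
      by (simp only:)
  qed
  then show ?thesis using rep_mono[OF _ monotone_final order_refl] by blast
qed

section \<open>The perturbation as a function of \<beta>\<close>

text \<open>In this form the centre of mass is a linear polynomial in \<open>\<beta>\<^sub>N\<close>
  and its conjugate.\<close>

lemma real_linear_inverse:
  assumes S: "linear S" "real_linear_det S = 1"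
  obtains p q where "surj S" "\<And>z. inv S z = p * z + q * cnj z"
proof -
  have S_eq: "S z = of_real (Re z) * S 1 + of_real (Im z) * S \<i>" for z
  proof -
    have "z = Re z *\<^sub>R 1 + Im z *\<^sub>R \<i>" by (simp add: complex_eq_iff)
    then have "S z = Re z *\<^sub>R S 1 + Im z *\<^sub>R S \<i>"
      using linear_add[OF S(1)] linear_scale[OF S(1)] by metis
    then show ?thesis by (simp add: scaleR_conv_of_real)
  qed
  have "inj S"
    unfolding linear_injective_0[OF S(1)]
  proof (intro allI impI)
    fix z assume "S z = 0"
    then have e: "Re z * Re (S 1) + Im z * Re (S \<i>) = 0" "Re z * Im (S 1) + Im z * Im (S \<i>) = 0"
      using S_eq[of z] by (auto simp: complex_eq_iff)
    have "Re z * real_linear_det S = Im (S \<i>) * (Re z * Re (S 1) + Im z * Re (S \<i>)) -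
        Re (S \<i>) * (Re z * Im (S 1) + Im z * Im (S \<i>))"
      "Im z * real_linear_det S = Re (S 1) * (Re z * Im (S 1) + Im z * Im (S \<i>)) -
        Im (S 1) * (Re z * Re (S 1) + Im z * Re (S \<i>))"
      by (simp_all add: real_linear_det_def algebra_simps)
    then have "Re z = 0" "Im z = 0" unfolding e S(2) by simp_all
    then show "z = 0" by (simp add: complex_eq_iff)
  qed
  then have surj: "surj S" using S(1) by (metis linear_inj_imp_surj)
  let ?T = "inv S"
  have T: "linear ?T" by (rule inj_linear_imp_inv_linear[OF S(1) \<open>inj S\<close>])
  define p where "p = (?T 1 - \<i> * ?T \<i>) / 2"
  define q where "q = (?T 1 + \<i> * ?T \<i>) / 2"
  have "?T z = p * z + q * cnj z" for z
  proof -
    have "z = Re z *\<^sub>R 1 + Im z *\<^sub>R \<i>" by (simp add: complex_eq_iff)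
    then have 1: "?T z = Re z *\<^sub>R ?T 1 + Im z *\<^sub>R ?T \<i>"
      using linear_add[OF T] linear_scale[OF T] by metis
    have 2: "z + cnj z = 2 * of_real (Re z)" "z - cnj z = 2 * of_real (Im z) * \<i>"
      by (simp_all add: complex_eq_iff)
    have "p * z + q * cnj z = (?T 1 * (z + cnj z) - \<i> * ?T \<i> * (z - cnj z)) / 2"
      by (simp add: p_def q_def field_simps)
    also have "\<dots> = ?T z" unfolding 1 2 by (simp add: scaleR_conv_of_real field_simps)
    finally show ?thesis ..
  qed
  then show ?thesis using that surj by blast
qed

text \<open>\<open>deriv h\<close> must agree with the termwise derivative on a neighbourhood of 0
  before it can be differentiated again, hence a sum on an interval and not only at 0.\<close>

lemma power_series_second_derivative:
  fixes a :: "nat \<Rightarrow> real"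
  assumes "\<And>t. \<bar>t\<bar> \<le> 1 \<Longrightarrow> (\<lambda>n. a n * t ^ n) sums h t"
  shows "(h has_real_derivative a 1) (at 0)" "(deriv ^^ 2) h 0 = 2 * a 2"
proof -
  have sm: "summable (\<lambda>n. a n * 1 ^ n)" using assms[of 1] by (simp add: sums_iff)
  define F where "F c t = (suminf (\<lambda>n. c n * t ^ n))" for c :: "nat \<Rightarrow> real" and t
  have F0: "F c 0 = c 0" for c by (simp add: F_def)
  have d1: "(F a has_real_derivative F (diffs a) t) (at t)" if "\<bar>t\<bar> < 1" for t
    unfolding F_def by (rule termdiffs_strong[OF sm]) (use that in simp)
  have sm2: "summable (\<lambda>n. diffs a n * x ^ n)" if "\<bar>x\<bar> < 1" for x
  proof (rule termdiff_converges[where K = 1])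
    show "summable (\<lambda>n. a n * y ^ n)" if "norm y < 1" for y :: real
      using assms[of y] that by (simp add: sums_iff)
  qed (use that in simp)
  have d2: "(F (diffs a) has_real_derivative F (diffs (diffs a)) 0) (at 0)"
    unfolding F_def by (rule termdiffs_strong[OF sm2[of "1/2"]]) simp_all
  have hF: "h t = F a t" if "\<bar>t\<bar> \<le> 1" for t
    using assms[OF that] by (simp add: F_def sums_iff)
  have h1: "(h has_real_derivative F (diffs a) t) (at t)" if "\<bar>t\<bar> < 1" for t
  proof (rule DERIV_cong_ev[THEN iffD2, OF refl _ refl d1[OF that]])
    have "eventually (\<lambda>x. x \<in> {-1<..<1}) (nhds t)"
      by (rule eventually_nhds_in_open) (use that in auto)
    then show "\<forall>\<^sub>F x in nhds t. h x = F a x" by eventually_elim (rule hF, auto)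
  qed
  from h1[of 0] show "(h has_real_derivative a 1) (at 0)" by (simp add: F0 diffs_def)
  have "(deriv h has_real_derivative F (diffs (diffs a)) 0) (at 0)"
  proof (rule DERIV_cong_ev[THEN iffD2, OF refl _ refl d2])
    have "eventually (\<lambda>x::real. x \<in> {-1<..<1}) (nhds 0)"
      by (rule eventually_nhds_in_open) auto
    then show "\<forall>\<^sub>F x in nhds 0. deriv h x = F (diffs a) x"
      by eventually_elim (rule DERIV_imp_deriv[OF h1], auto)
  qed
  then have "deriv (deriv h) 0 = F (diffs (diffs a)) 0" by (rule DERIV_imp_deriv)
  then show "(deriv ^^ 2) h 0 = 2 * a 2" by (simp add: F0 diffs_def numeral_2_eq_2)
qed

lemma centre_of_mass_rep:
  assumes N: "2 \<le> N" and r: "0 \<le> r"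
  shows "rep N r {x \<in> cluster_exponents N N. \<forall>i<N. fst x i = 0} (\<lambda>\<beta>. p * \<beta> N + q * cnj (\<beta> N))
    (cmod p * r + cmod q * r)"
proof -
  let ?T = "{x \<in> cluster_exponents N N. \<forall>i<N. fst x i = 0}"
  have mem: "(\<lambda>j. if j = N then 1 else 0, \<lambda>_. 0) \<in> ?T" "(\<lambda>_. 0, \<lambda>j. if j = N then 1 else 0) \<in> ?T"
    using N by (auto simp: cluster_exponents_def multi_indices_def)
  have "rep N r ?T (\<lambda>\<beta>. \<beta> N) r" by (rule rep_var[OF mem(1)]) (use N r in auto)
  moreover have "rep N r ?T (\<lambda>\<beta>. cnj (\<beta> N)) r"
  proof -
    have "rep N r {(\<lambda>j. if j = N then 1 else 0, \<lambda>_. 0)} (\<lambda>\<beta>. \<beta> N) r"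
      by (rule rep_var) (use N r in auto)
    from rep_cnj[OF this] show ?thesis
      by (rule rep_mono) (use mem in \<open>auto simp: pair_swap_def\<close>)
  qed
  ultimately show ?thesis by (intro rep_add[OF r] rep_cmult[OF r])
qed

text \<open>An exponent 1 at \<open>l\<close> forces a nonzero exponent at \<open>l - 1\<close>,
  which is 1 by monotonicity. Descending, the value 1 would reach index 0, where \<open>K\<close>
  vanishes.\<close>

lemma no_one:
  assumes K: "K \<in> multi_indices N"
    and mono: "\<forall>i j. 1 \<le> i \<longrightarrow> i \<le> j \<longrightarrow> j < N \<longrightarrow> K j \<noteq> 0 \<longrightarrow> K i \<le> K j"
    and nl: "\<And>m. 1 \<le> m \<Longrightarrow> m < N \<Longrightarrow> no_leading_one m K"
  shows "l < N \<Longrightarrow> K l \<noteq> (1::nat)"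
proof (induction l)
  case 0
  then show ?case using K by (simp add: multi_indices_def)
next
  case (Suc l)
  show ?case
  proof
    assume 1: "K (Suc l) = 1"
    then have "K l \<noteq> 0" using nl[of "Suc l"] Suc.prems by (simp add: no_leading_one_def)
    moreover from this have "1 \<le> l" using multi_indices_outside[OF K] by blast
    ultimately have "K l \<le> 1" using mono 1 Suc.prems by (metis le_SucI order_refl zero_neq_one)
    then show False using \<open>K l \<noteq> 0\<close> Suc by (auto simp: le_Suc_eq)
  qed
qed

text \<open>The vortex Hamiltonian minus \<open>h\<^sub>0\<close> and the constant \<open>c\<close>, as a function of \<open>\<beta>\<close> that is also
  defined where some of the \<open>\<beta>\<^sub>i\<close> vanish.\<close>

definition beta_perturbation ::
  "(nat \<Rightarrow> real) \<Rightarrow> nat \<Rightarrow> (complex \<Rightarrow> complex \<Rightarrow> real) \<Rightarrow> (complex \<Rightarrow> complex) \<Rightarrow> real \<Rightarrow> real \<Rightarrow>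
    (nat \<Rightarrow> complex) \<Rightarrow> real" where
  "beta_perturbation a N \<gamma> T \<omega> c \<beta> =
    - (1/2) * (\<Sum>k=1..N. \<Sum>l=1..N. a k * a l *
      \<gamma> (position a N (\<lambda>j. of_real (sqrt 2) * chain N j \<beta>) (T (of_real (sqrt 2) * \<beta> N)) k)
        (position a N (\<lambda>j. of_real (sqrt 2) * chain N j \<beta>) (T (of_real (sqrt 2) * \<beta> N)) l))
    + (\<Sum>n\<in>{1..<N}. - a (n + 1) / (2 * pi) *
        (\<Sum>l=1..n. a l * ln (cmod (1 + position a n (\<lambda>j. chain n j \<beta>) 0 l))))
    + \<omega> * (cmod (\<beta> N))\<^sup>2 - c"

lemma beta_perturbation_rep:
  assumes N: "2 \<le> N" and m: "1 \<le> m" "m < N"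
    and A: "\<And>k. k \<in> {1..N} \<Longrightarrow> partial_strength a k \<noteq> 0"
    and r: "0 \<le> r" "r \<le> 1" and T: "\<And>z. T z = p * z + q * cnj z"
    and \<gamma>: "rep 2 s harmonic_exponents (\<lambda>\<beta>. of_real (\<gamma> (\<beta> 1) (\<beta> 2))) G"
    and b: "b = (2 + 2 * cmod p + 2 * cmod q) * r"
    and s: "5 * (b * (2 + kappa_sum a N)) \<le> s" "5 * (b * (2 + kappa_sum a N)) < 1"
  shows "\<exists>B. rep N r (final_exponents N m) (\<lambda>\<beta>. of_real (beta_perturbation a N \<gamma> T \<omega> c \<beta>)) B"
proof -
  have sq: "sqrt 2 \<le> 2" by (rule real_le_lsqrt) auto
  define base where "base \<beta> = T (of_real (sqrt 2) * \<beta> N)" for \<beta>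
  have base_eq: "base \<beta> = (p * of_real (sqrt 2)) * \<beta> N + (q * of_real (sqrt 2)) * cnj (\<beta> N)" for \<beta>
    by (simp add: base_def T)
  have "rep N r {x \<in> cluster_exponents N N. \<forall>i<N. fst x i = 0} base
      (cmod (p * of_real (sqrt 2)) * r + cmod (q * of_real (sqrt 2)) * r)"
    unfolding base_eq[abs_def] by (rule centre_of_mass_rep[OF N r(1)])
  moreover have "cmod (p * of_real (sqrt 2)) * r + cmod (q * of_real (sqrt 2)) * r \<le> b"
  proof -
    have "cmod p * sqrt 2 * r \<le> cmod p * 2 * r" "cmod q * sqrt 2 * r \<le> cmod q * 2 * r"
      using sq r by (auto intro!: mult_right_mono mult_left_mono)
    then show ?thesis using r by (simp add: b norm_mult algebra_simps)
  qed
  ultimately have base: "rep N r {x \<in> cluster_exponents N N. \<forall>i<N. fst x i = 0} base b"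
    by (rule rep_mono[OF _ order_refl])
  have b2: "2 * r \<le> b"
  proof -
    have "2 * r \<le> (2 + 2 * cmod p + 2 * cmod q) * r" using r by (intro mult_right_mono) auto
    then show ?thesis by (simp add: b)
  qed
  have "sqrt 2 * r \<le> b" using mult_right_mono[OF sq r(1)] b2 by linarith
  from green_part_rep[OF N m A r base this \<gamma> s(1)] obtain B1 where
    B1: "rep N r (final_exponents N m) (\<lambda>\<beta>. of_real (\<Sum>k=1..N. \<Sum>l=1..N. a k * a l *
      \<gamma> (position a N (\<lambda>j. of_real (sqrt 2) * chain N j \<beta>) (base \<beta>) k)
        (position a N (\<lambda>j. of_real (sqrt 2) * chain N j \<beta>) (base \<beta>) l))) B1" by blast
  have "\<exists>B. rep N r (final_exponents N m)
    (\<lambda>\<beta>. of_real (\<Sum>l=1..n. a l * ln (cmod (1 + position a n (\<lambda>j. chain n j \<beta>) 0 l)))) B"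
    if "n \<in> {1..<N}" for n
  proof (rule log_part_rep[OF _ _ m A r])
    have "r * (2 + kappa_sum a n) \<le> b * (2 + kappa_sum a N)"
      using b2 r kappa_sum_mono[of n N a] kappa_sum_nonneg[of a n] that
      by (intro mult_mono) auto
    then show "5 * (r * (2 + kappa_sum a n)) < 1" using s(2) by linarith
  qed (use that in auto)
  then have "\<exists>B2. \<forall>n\<in>{1..<N}. rep N r (final_exponents N m)
    (\<lambda>\<beta>. of_real (\<Sum>l=1..n. a l * ln (cmod (1 + position a n (\<lambda>j. chain n j \<beta>) 0 l)))) (B2 n)"
    by (intro bchoice ballI)
  then obtain B2 where B2: "\<forall>n\<in>{1..<N}. rep N r (final_exponents N m)
    (\<lambda>\<beta>. of_real (\<Sum>l=1..n. a l * ln (cmod (1 + position a n (\<lambda>j. chain n j \<beta>) 0 l)))) (B2 n)" ..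
  have B3: "rep N r (final_exponents N m) (\<lambda>\<beta>. \<Sum>n\<in>{1..<N}. of_real (- a (n + 1) / (2 * pi)) *
      of_real (\<Sum>l=1..n. a l * ln (cmod (1 + position a n (\<lambda>j. chain n j \<beta>) 0 l))))
      (\<Sum>n\<in>{1..<N}. cmod (of_real (- a (n + 1) / (2 * pi))) * B2 n)"
    by (rule rep_sum[OF r(1) _ rep_cmult[OF r(1) bspec[OF B2]]]) auto
  let ?d = "\<lambda>j. if j = N then 1 else 0 :: nat"
  have B4: "rep N r (final_exponents N m) (\<lambda>\<beta>. of_real \<omega> * monomial N \<beta> (?d, ?d))
      (cmod (of_real \<omega>) * r ^ pair_degree N (?d, ?d))"
    by (rule rep_monomial) (use N m r in \<open>auto simp: final_exponents_def multi_indices_def no_leading_one_def split: if_splits\<close>)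
  have B5: "rep N r (final_exponents N m) (\<lambda>_. of_real c) (cmod (of_real c))"
    by (rule rep_const) (use r in \<open>auto simp: final_exponents_def multi_indices_def no_leading_one_def\<close>)
  have mono: "monomial N \<beta> (?d, ?d) = of_real ((cmod (\<beta> N))\<^sup>2)" for \<beta>
  proof -
    have "(\<Prod>i=1..N. f i ^ ?d i) = f N" for f :: "nat \<Rightarrow> complex"
    proof -
      have "(\<Prod>i=1..N. f i ^ ?d i) = (\<Prod>i=1..N. if i = N then f N else 1)" by (rule prod.cong) auto
      then show ?thesis using N by simp
    qed
    from this[of \<beta>] this[of "\<lambda>i. cnj (\<beta> i)"] show ?thesis
      unfolding monomial_def fst_conv snd_conv by (simp only: complex_norm_square)
  qed
  note all = rep_diff[OF r(1) rep_add[OF r(1) rep_add[OF r(1) rep_cmult[OF r(1) B1, of "- (1/2)"] B3] B4] B5]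
  show ?thesis
  proof (rule exI, rule rep_cong[OF all])
    fix \<beta>
    show "- (1 / 2) * complex_of_real (\<Sum>k=1..N. \<Sum>l=1..N. a k * a l *
          \<gamma> (position a N (\<lambda>j. of_real (sqrt 2) * chain N j \<beta>) (base \<beta>) k)
            (position a N (\<lambda>j. of_real (sqrt 2) * chain N j \<beta>) (base \<beta>) l)) +
         (\<Sum>n\<in>{1..<N}. of_real (- a (n + 1) / (2 * pi)) *
            of_real (\<Sum>l=1..n. a l * ln (cmod (1 + position a n (\<lambda>j. chain n j \<beta>) 0 l)))) +
         of_real \<omega> * monomial N \<beta> (?d, ?d) - of_real c =
         of_real (beta_perturbation a N \<gamma> T \<omega> c \<beta>)"
      unfolding beta_perturbation_def base_def mono by simp
  qed
qed

text \<open>An explicit configuration realises every small \<beta> with nonzero entries below N. The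
  constant \<open>C\<close> arises because \<open>h0\<close> is written in \<alpha>, which is
  smaller than the Jacobi coordinates by the factor \<open>sqrt 2\<close>.\<close>

lemma beta_perturbation_eq:
  assumes N: "2 \<le> N" and A: "\<forall>k\<in>{1..N}. partial_strength a k \<noteq> 0"
    and S: "surj S"
    and small: "\<forall>n\<in>{1..<N}. \<forall>l\<in>{1..n}. cmod (position a n (\<lambda>j. chain n j \<beta>) 0 l) < 1"
    and \<beta>: "\<forall>i\<in>{1..<N}. \<beta> i \<noteq> 0"
    and z: "z = position a N (\<lambda>j. of_real (sqrt 2) * chain N j \<beta>) (inv S (of_real (sqrt 2) * \<beta> N))"
    and C: "C = (\<Sum>n\<in>{1..<N}. a (n + 1) * partial_strength a n / (2 * pi) * ln (sqrt 2))"
  shows "\<And>k. k \<in> {1..<N} \<Longrightarrow> alpha_coord a N S z k \<noteq> 0"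
    "\<And>i. i \<in> {1..N} \<Longrightarrow> beta_coord a N S z i = \<beta> i"
    "vortex_hamiltonian a N \<gamma> z - h0_fun a N \<omega> (alpha_coord a N S z) - c =
      beta_perturbation a N \<gamma> (inv S) \<omega> (c + C) \<beta>"
proof -
  let ?u = "\<lambda>j. of_real (sqrt 2) * chain N j \<beta>"
  have s2: "of_real (sqrt 2) \<noteq> (0::complex)" by simp
  have jac: "jacobi_coord a N z k = (if k = N then inv S (of_real (sqrt 2) * \<beta> N) else ?u k)" if "k \<in> {1..N}" for k
    unfolding z by (rule jacobi_position[OF bspec[OF A] _ that]) (auto simp: chain_def)
  have alpha: "alpha_coord a N S z k = (if k = N then \<beta> N else chain N k \<beta>)" if "k \<in> {1..N}" for k
    using jac[OF that] N S by (auto simp: alpha_coord_def surj_f_inv_f)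
  have chain_nz: "chain N k \<beta> \<noteq> 0" if "k \<in> {1..<N}" for k
    using that \<beta> by (auto simp: chain_def)
  show al: "alpha_coord a N S z k \<noteq> 0" if "k \<in> {1..<N}" for k
    using alpha[of k] chain_nz[OF that] that by auto
  show "beta_coord a N S z i = \<beta> i" if i: "i \<in> {1..N}" for i
  proof -
    consider "i + 2 \<le> N" | "i + 1 = N" | "i = N" using i by fastforce
    then show ?thesis
    proof cases
      case 1
      have "chain N i \<beta> = \<beta> i * chain N (i + 1) \<beta>"
        using 1 i prod.atLeast_Suc_lessThan[of i N \<beta>] by (simp add: chain_def)
      then show ?thesis
        using 1 i chain_nz[of "i + 1"] alpha[of i] alpha[of "i + 1"] by (simp add: beta_coord_def)
    next
      case 2
      then have "{i..<N} = {i}" by auto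
      then have "chain N i \<beta> = \<beta> i" using i by (simp add: chain_def)
      then show ?thesis using 2 i alpha[of i] by (simp add: beta_coord_def)
    next
      case 3
      then show ?thesis using alpha[of N] N by (simp add: beta_coord_def)
    qed
  qed
  have ln_diff: "ln (cmod (z (n + 1) - z l)) = ln (sqrt 2) + ln (cmod (chain N n \<beta>)) +
      ln (cmod (1 + position a n (\<lambda>j. chain n j \<beta>) 0 l))" if n: "n \<in> {1..<N}" and l: "l \<in> {1..n}" for n l
  proof -
    have "z l - z (Suc n) = ?u n * (1 + position a n (\<lambda>j. chain n j \<beta>) 0 l)"
      unfolding z
    proof (rule position_diff[OF _ _ l])
      show "?u j = chain n j \<beta> * ?u n" if "j < n" for j
        using chain_concat[of n j N \<beta>] that n by (cases "j = 0") (auto simp: chain_def)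
    qed (use n in auto)
    then have "cmod (z (n + 1) - z l) = sqrt 2 * cmod (chain N n \<beta>) * cmod (1 + position a n (\<lambda>j. chain n j \<beta>) 0 l)"
      by (simp add: norm_minus_commute norm_mult)
    moreover have "1 + position a n (\<lambda>j. chain n j \<beta>) 0 l \<noteq> 0"
      using bspec[OF bspec[OF small n] l] by (metis add.commute add_eq_0_iff norm_minus_cancel norm_one order_less_irrefl)
    ultimately show ?thesis using chain_nz[OF n] by (simp add: ln_mult)
  qed
  have pairs: "(\<Sum>k=1..N. \<Sum>l=1..<k. a k * a l / (2 * pi) * ln (cmod (z k - z l))) =
      (\<Sum>n\<in>{1..<N}. a (n + 1) / (2 * pi) * (\<Sum>l=1..n. a l * ln (cmod (z (n + 1) - z l))))"
  proof -
    have "(\<Sum>k=1..N. \<Sum>l=1..<k. a k * a l / (2 * pi) * ln (cmod (z k - z l))) =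
        (\<Sum>k\<in>Suc ` {0..<N}. \<Sum>l=1..<k. a k * a l / (2 * pi) * ln (cmod (z k - z l)))"
      by (simp add: image_Suc_atLeastLessThan atLeastLessThanSuc_atLeastAtMost)
    also have "\<dots> = (\<Sum>n\<in>{0..<N}. \<Sum>l=1..<Suc n. a (Suc n) * a l / (2 * pi) * ln (cmod (z (Suc n) - z l)))"
      by (subst sum.reindex) auto
    also have "\<dots> = (\<Sum>n\<in>{1..<N}. \<Sum>l=1..<Suc n. a (Suc n) * a l / (2 * pi) * ln (cmod (z (Suc n) - z l)))"
      using N by (subst sum.atLeast_Suc_lessThan) auto
    finally show ?thesis by (simp add: sum_distrib_left atLeastLessThanSuc_atLeastAtMost mult_ac)
  qed
  have inner: "a (n + 1) / (2 * pi) * (\<Sum>l=1..n. a l * ln (cmod (z (n + 1) - z l))) =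
      a (n + 1) * partial_strength a n / (2 * pi) * ln (sqrt 2) +
      a (n + 1) * partial_strength a n / (4 * pi) * ln ((cmod (chain N n \<beta>))\<^sup>2) +
      a (n + 1) / (2 * pi) * (\<Sum>l=1..n. a l * ln (cmod (1 + position a n (\<lambda>j. chain n j \<beta>) 0 l)))"
    if n: "n \<in> {1..<N}" for n
  proof -
    have "(\<Sum>l=1..n. a l * ln (cmod (z (n + 1) - z l))) = (\<Sum>l=1..n. a l * (ln (sqrt 2) + ln (cmod (chain N n \<beta>)))
        + a l * ln (cmod (1 + position a n (\<lambda>j. chain n j \<beta>) 0 l)))"
      by (rule sum.cong) (auto simp: ln_diff[OF n, simplified] algebra_simps)
    also have "\<dots> = partial_strength a n * (ln (sqrt 2) + ln (cmod (chain N n \<beta>))) +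
        (\<Sum>l=1..n. a l * ln (cmod (1 + position a n (\<lambda>j. chain n j \<beta>) 0 l)))"
      by (simp add: sum.distrib partial_strength_def sum_distrib_right)
    finally show ?thesis
      using chain_nz[OF n] by (simp add: ln_realpow field_simps)
  qed
  have h0: "h0_fun a N \<omega> (alpha_coord a N S z) =
      - (\<Sum>n\<in>{1..<N}. a (n + 1) * partial_strength a n / (4 * pi) * ln ((cmod (chain N n \<beta>))\<^sup>2)) - \<omega> * (cmod (\<beta> N))\<^sup>2"
  proof -
    have "{1..N-1} = {1..<N}" using N by auto
    moreover have "(\<Sum>n\<in>{1..<N}. a (n + 1) * partial_strength a n / (4 * pi) * ln ((cmod (alpha_coord a N S z n))\<^sup>2)) =
        (\<Sum>n\<in>{1..<N}. a (n + 1) * partial_strength a n / (4 * pi) * ln ((cmod (chain N n \<beta>))\<^sup>2))"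
      by (rule sum.cong) (auto simp: alpha)
    ultimately show ?thesis using N by (simp add: h0_fun_def alpha)
  qed
  have green: "(\<Sum>k=1..N. \<Sum>l=1..N. a k * a l / 2 * \<gamma> (z k) (z l)) = 1 / 2 * (\<Sum>k=1..N. \<Sum>l=1..N. a k * a l * \<gamma> (z k) (z l))"
    by (simp add: sum_distrib_left mult_ac)
  have logs: "(\<Sum>n\<in>{1..<N}. a (n + 1) / (2 * pi) * (\<Sum>l=1..n. a l * ln (cmod (z (n + 1) - z l)))) =
      C + (\<Sum>n\<in>{1..<N}. a (n + 1) * partial_strength a n / (4 * pi) * ln ((cmod (chain N n \<beta>))\<^sup>2)) +
      (\<Sum>n\<in>{1..<N}. a (n + 1) / (2 * pi) * (\<Sum>l=1..n. a l * ln (cmod (1 + position a n (\<lambda>j. chain n j \<beta>) 0 l))))"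
    unfolding C sum.distrib[symmetric] by (rule sum.cong[OF refl inner])
  show "vortex_hamiltonian a N \<gamma> z - h0_fun a N \<omega> (alpha_coord a N S z) - c =
      beta_perturbation a N \<gamma> (inv S) \<omega> (c + C) \<beta>"
    unfolding vortex_hamiltonian_def pairs logs green h0 beta_perturbation_def z[symmetric]
    by (simp add: sum_negf)
qed

section \<open>Monomials in the last variable alone\<close>

definition last_only :: "nat \<Rightarrow> exponent_pair \<Rightarrow> bool" where
  "last_only N x \<longleftrightarrow> (\<forall>i\<in>{1..<N}. fst x i = 0 \<and> snd x i = 0)"

lemma monomial_last:
  assumes N: "1 \<le> N" and x: "last_only N x"
  shows "monomial N \<beta> x = \<beta> N ^ fst x N * cnj (\<beta> N) ^ snd x N"
proof -
  have "{1..N} = insert N {1..<N}" using N by auto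
  moreover have "(\<Prod>i\<in>{1..<N}. f i ^ fst x i) = 1" "(\<Prod>i\<in>{1..<N}. f i ^ snd x i) = 1" for f :: "nat \<Rightarrow> complex"
    using x by (auto simp: last_only_def intro!: prod.neutral)
  ultimately show ?thesis by (simp add: monomial_def)
qed

lemma monomial_not_last:
  assumes x: "\<not> last_only N x" and \<beta>: "\<forall>i\<in>{1..<N}. \<beta> i = 0"
  shows "monomial N \<beta> x = 0"
proof -
  obtain i where i: "i \<in> {1..<N}" "fst x i \<noteq> 0 \<or> snd x i \<noteq> 0"
    using x by (auto simp: last_only_def)
  then have "i \<in> {1..N}" "\<beta> i ^ fst x i = 0 \<or> cnj (\<beta> i) ^ snd x i = 0" using \<beta> by auto
  then have "(\<Prod>i=1..N. \<beta> i ^ fst x i) = 0 \<or> (\<Prod>i=1..N. cnj (\<beta> i) ^ snd x i) = 0"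
    by (auto simp: prod_zero_iff)
  then show ?thesis by (auto simp: monomial_def)
qed

text \<open>At \<open>\<beta>\<^sub>1 = \<dots> = \<beta>\<^bsub>N-1\<^esub> = 0\<close> all vortices coincide with their centre of mass. The linear terms vanish
  because \<open>0\<close> is a critical point, and the quadratic ones cancel by the choice of \<open>S\<close> and \<open>\<omega>\<close>.\<close>

lemma pure_coefficients_vanish:
  assumes N: "2 \<le> N" and r: "0 < r"
    and T: "\<And>z. T z = p * z + q * cnj z"
    and critical: "((\<lambda>z. \<gamma> z z) has_derivative (\<lambda>_. 0)) (at 0)"
    and quadratic: "\<And>\<zeta>. quadratic_part (\<lambda>\<zeta>. - (partial_strength a N)\<^sup>2 / 2 * \<gamma> (T \<zeta>) (T \<zeta>)) \<zeta>
            = - \<omega> / 2 * (cmod \<zeta>)\<^sup>2"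
    and series: "\<And>\<beta>. \<beta> \<in> closed_polydisc N r \<Longrightarrow>
      ((\<lambda>x. R x * monomial N \<beta> x) has_sum of_real (beta_perturbation a N \<gamma> T \<omega> c \<beta>))
        (multi_indices N \<times> multi_indices N)"
    and x: "x \<in> multi_indices N \<times> multi_indices N" "last_only N x" "pair_degree N x = d" "d = 1 \<or> d = 2"
  shows "R x = 0"
proof -
  let ?MI = "multi_indices N \<times> multi_indices N"
  let ?A = "\<lambda>d. {x \<in> ?MI. pair_degree N x = d}"
  \<comment> \<open>On the axis of \<open>\<beta>\<^sub>N\<close> only these coefficients are
    visible. With the others set to zero, vanishing on the axis becomes vanishing at all points, as
    the uniqueness argument requires.\<close>
  define D where "D x = (if last_only N x then R x else 0)" for x
  define G where "G v d = (\<Sum>x\<in>?A d. R x * monomial N (\<lambda>i. if i = N then v else 0) x)" for v d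
  define Q where "Q v t = - (partial_strength a N)\<^sup>2 / 2 * \<gamma> (T (of_real t * v)) (T (of_real t * v))" for v :: complex and t :: real
  have at_last: "beta_perturbation a N \<gamma> T \<omega> c (\<lambda>i. if i = N then of_real t * v else 0) =
      Q (of_real (sqrt 2) * v) t + \<omega> * (cmod v)\<^sup>2 * t\<^sup>2 - c" for v t
  proof -
    let ?\<beta> = "\<lambda>i. if i = N then of_real t * v else 0"
    have ch: "chain n j ?\<beta> = 0" if "j < n" "n \<le> N" for n j
      using that by (auto simp: chain_def)
    have pos: "position a n (\<lambda>j. of_real k * chain n j ?\<beta>) b l = b" if "l \<in> {1..n}" "n \<le> N" for n k b l
    proof -
      have "(\<Sum>j=l-1..<n. of_real (kappa a (j + 1)) * (of_real k * chain n j ?\<beta>)) = 0"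
        by (rule sum.neutral) (use that in \<open>auto simp: ch\<close>)
      moreover have "chain n (l - 1) ?\<beta> = 0" by (rule ch) (use that in auto)
      ultimately show ?thesis by (simp add: position_def centre_def)
    qed
    have "(\<Sum>k=1..N. \<Sum>l=1..N. a k * a l *
      \<gamma> (position a N (\<lambda>j. of_real (sqrt 2) * chain N j ?\<beta>) (T (of_real (sqrt 2) * ?\<beta> N)) k)
        (position a N (\<lambda>j. of_real (sqrt 2) * chain N j ?\<beta>) (T (of_real (sqrt 2) * ?\<beta> N)) l)) =
      (\<Sum>k=1..N. \<Sum>l=1..N. a k * a l * \<gamma> (T (of_real (sqrt 2) * ?\<beta> N)) (T (of_real (sqrt 2) * ?\<beta> N)))"
      by (intro sum.cong refl) (simp only: pos order_refl)
    also have "\<dots> = (partial_strength a N)\<^sup>2 * \<gamma> (T (of_real t * (of_real (sqrt 2) * v))) (T (of_real t * (of_real (sqrt 2) * v)))"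
    proof -
      have "of_real (sqrt 2) * ?\<beta> N = of_real t * (of_real (sqrt 2) * v)" by simp
      moreover have "(\<Sum>k=1..N. \<Sum>l=1..N. a k * a l * X) = (partial_strength a N)\<^sup>2 * X" for X :: real
        by (simp only: partial_strength_def power2_eq_square sum_distrib_right[symmetric] sum_product[symmetric])
      ultimately show ?thesis by (simp only:)
    qed
    finally have 1: "(\<Sum>k=1..N. \<Sum>l=1..N. a k * a l *
      \<gamma> (position a N (\<lambda>j. of_real (sqrt 2) * chain N j ?\<beta>) (T (of_real (sqrt 2) * ?\<beta> N)) k)
        (position a N (\<lambda>j. of_real (sqrt 2) * chain N j ?\<beta>) (T (of_real (sqrt 2) * ?\<beta> N)) l)) =
      (partial_strength a N)\<^sup>2 * \<gamma> (T (of_real t * (of_real (sqrt 2) * v))) (T (of_real t * (of_real (sqrt 2) * v)))" .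
    have 2: "(\<Sum>n\<in>{1..<N}. - a (n + 1) / (2 * pi) *
        (\<Sum>l=1..n. a l * ln (cmod (1 + position a n (\<lambda>j. chain n j ?\<beta>) 0 l)))) = 0"
    proof (intro sum.neutral ballI)
      fix n assume n: "n \<in> {1..<N}"
      have "(\<Sum>l=1..n. a l * ln (cmod (1 + position a n (\<lambda>j. chain n j ?\<beta>) 0 l))) = 0"
        by (intro sum.neutral ballI) (use pos[of _ n 1 0] n in simp)
      then show "- a (n + 1) / (2 * pi) * (\<Sum>l=1..n. a l * ln (cmod (1 + position a n (\<lambda>j. chain n j ?\<beta>) 0 l))) = 0"
        by simp
    qed
    show ?thesis
      unfolding beta_perturbation_def 1 2 by (simp add: Q_def norm_mult power_mult_distrib)
  qed
  have G_zero: "G v d = 0" if v: "cmod v \<le> r" and d: "d = 1 \<or> d = 2" for v d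
  proof -
    let ?b = "\<lambda>i. if i = N then v else 0"
    have ser: "((\<lambda>d. of_real t ^ d * G v d) has_sum of_real (Q (of_real (sqrt 2) * v) t + \<omega> * (cmod v)\<^sup>2 * t\<^sup>2 - c)) UNIV"
      if t: "\<bar>t\<bar> \<le> 1" for t :: real
    proof -
      have b: "(\<lambda>i. of_real t * ?b i) = (\<lambda>i. if i = N then of_real t * v else 0)" by auto
      have "\<bar>t\<bar> * cmod v \<le> 1 * r" using t v by (intro mult_mono) auto
      then have "(\<lambda>i. of_real t * ?b i) \<in> closed_polydisc N r"
        using r by (auto simp: closed_polydisc_def norm_mult)
      from has_sum_by_degree[OF series[OF this]] show ?thesis
        unfolding b at_last G_def .
    qed
    have Im0: "Im (G v d) = 0" for d
    proof -
      have "complex_of_real (Im (G v d)) = 0"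
      proof (rule power_series_zero)
        fix t :: real assume t: "0 < t" "t \<le> 1"
        have "(\<lambda>d. Im (of_real t ^ d * G v d)) sums 0"
          using sums_Im[OF has_sum_imp_sums[OF ser[of t]]] t by simp
        moreover have "Im (of_real t ^ d * G v d) = t ^ d * Im (G v d)" for d
          by (simp flip: of_real_power)
        ultimately have "(\<lambda>d. t ^ d * Im (G v d)) sums 0" by simp
        from sums_of_real[OF this, where 'a = complex]
        show "(\<lambda>d. of_real t ^ d * complex_of_real (Im (G v d))) sums 0" by simp
      qed
      then show ?thesis by simp
    qed
    \<comment> \<open>The real coefficients corrected by the known terms \<omega> and c, so that the
      remaining series represents \<open>Q\<close> alone.\<close>
    define A where "A d = Re (G v d) - (if d = 2 then \<omega> * (cmod v)\<^sup>2 else 0) - (if d = 0 then - c else 0)" for d :: nat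
    have A_sums: "(\<lambda>d. A d * t ^ d) sums Q (of_real (sqrt 2) * v) t" if t: "\<bar>t\<bar> \<le> 1" for t
    proof -
      have "(\<lambda>d. Re (of_real t ^ d * G v d)) sums (Q (of_real (sqrt 2) * v) t + \<omega> * (cmod v)\<^sup>2 * t\<^sup>2 - c)"
        using sums_Re[OF has_sum_imp_sums[OF ser[OF t]]] by simp
      moreover have "Re (of_real t ^ d * G v d) = Re (G v d) * t ^ d" for d
        by (simp flip: of_real_power)
      ultimately have "(\<lambda>d. Re (G v d) * t ^ d) sums (Q (of_real (sqrt 2) * v) t + \<omega> * (cmod v)\<^sup>2 * t\<^sup>2 - c)"
        by (simp only:)
      from sums_diff[OF sums_diff[OF this sums_single[of 2 "\<lambda>d. \<omega> * (cmod v)\<^sup>2 * t ^ d"]] sums_single[of 0 "\<lambda>d. - c * t ^ d"]]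
      have "(\<lambda>d. Re (G v d) * t ^ d - (if d = 2 then \<omega> * (cmod v)\<^sup>2 * t ^ d else 0) - (if d = 0 then - c * t ^ d else 0))
          sums Q (of_real (sqrt 2) * v) t" by simp
      moreover have "Re (G v d) * t ^ d - (if d = 2 then \<omega> * (cmod v)\<^sup>2 * t ^ d else 0) - (if d = 0 then - c * t ^ d else 0) = A d * t ^ d" for d
        by (auto simp: A_def algebra_simps)
      ultimately show ?thesis by simp
    qed
    have der: "(Q (of_real (sqrt 2) * v) has_real_derivative A 1) (at 0)"
      "(deriv ^^ 2) (Q (of_real (sqrt 2) * v)) 0 = 2 * A 2"
      by (rule power_series_second_derivative, rule A_sums, assumption)+
    have "Re (G v 1) = 0"
    proof -
      have lin: "((\<lambda>t::real. T (of_real t * (of_real (sqrt 2) * v))) has_derivative (\<lambda>h. T (of_real h * (of_real (sqrt 2) * v)))) (at 0)"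
        unfolding T by (auto intro!: derivative_eq_intros simp: algebra_simps)
      have T0: "T (of_real 0 * (of_real (sqrt 2) * v)) = 0" by (simp add: T)
      have "((\<lambda>t. \<gamma> (T (of_real t * (of_real (sqrt 2) * v))) (T (of_real t * (of_real (sqrt 2) * v)))) has_derivative (\<lambda>_. 0)) (at 0)"
        using has_derivative_compose[OF lin, of "\<lambda>z. \<gamma> z z" "\<lambda>_. 0"] critical T0 by simp
      then have "(Q (of_real (sqrt 2) * v) has_derivative (\<lambda>_. 0)) (at 0)"
        unfolding Q_def[abs_def] by (auto intro!: derivative_eq_intros)
      then have "(Q (of_real (sqrt 2) * v) has_real_derivative 0) (at 0)"
        unfolding has_field_derivative_def by (rule has_derivative_eq_rhs) auto
      with der(1) have "A 1 = 0" by (rule DERIV_unique)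
      then show ?thesis by (simp add: A_def)
    qed
    moreover have "Re (G v 2) = 0"
    proof -
      have "quadratic_part (\<lambda>\<zeta>. - (partial_strength a N)\<^sup>2 / 2 * \<gamma> (T \<zeta>) (T \<zeta>)) (of_real (sqrt 2) * v) =
          (deriv ^^ 2) (Q (of_real (sqrt 2) * v)) 0 / 2"
        by (simp only: quadratic_part_def Q_def[abs_def])
      \<comment> \<open>The direction is \<open>sqrt 2 * v\<close>, which doubles the quadratic form
        and makes it cancel the term with \<omega> exactly.\<close>
      then have "A 2 = - \<omega> * (cmod v)\<^sup>2" unfolding quadratic der(2) by (simp add: norm_mult power_mult_distrib)
      then show ?thesis by (simp add: A_def)
    qed
    ultimately show ?thesis using d Im0[of d] by (auto simp: complex_eq_iff)
  qed
  have "D x = 0"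
  proof (rule homogeneous_unique[OF r _ x(1,3)])
    fix \<beta> :: "nat \<Rightarrow> complex" assume "\<forall>i\<in>{1..N}. \<beta> i \<noteq> 0 \<and> cmod (\<beta> i) < r"
    then have v: "cmod (\<beta> N) \<le> r" using N by (simp add: less_imp_le)
    have "(\<Sum>x\<in>?A d. D x * monomial N \<beta> x) = G (\<beta> N) d"
      unfolding G_def
    proof (rule sum.cong[OF refl])
      fix y
      show "D y * monomial N \<beta> y = R y * monomial N (\<lambda>i. if i = N then \<beta> N else 0) y"
        using monomial_last[of N y \<beta>] monomial_last[of N y "\<lambda>i. if i = N then \<beta> N else 0"]
          monomial_not_last[of N y "\<lambda>i. if i = N then \<beta> N else 0"] N
        by (cases "last_only N y") (auto simp: D_def)
    qed
    then show "(\<Sum>x\<in>?A d. D x * monomial N \<beta> x) = 0" using G_zero[OF v x(4)] by simp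
  qed
  then show ?thesis using x(2) by (simp add: D_def)
qed

section \<open>The exponents of the initial perturbation\<close>

text \<open>Taken together over all \<open>m\<close>, the restrictions exclude the value 1 for every
  \<open>K l\<close> and \<open>L l\<close> with l < N, which is more than the gap condition
  asks.\<close>

lemma good_exponentI:
  assumes N: "2 \<le> N" and x: "\<And>m. 1 \<le> m \<Longrightarrow> m < N \<Longrightarrow> (K, L) \<in> final_exponents N m"
    and pure: "last_only N (K, L) \<Longrightarrow> 3 \<le> pair_degree N (K, L)"
  shows "good_exponent N 1 (alpha_exponent N K) (alpha_exponent N L)"
proof -
  have x1: "(K, L) \<in> final_exponents N 1" using x N by simp
  then have MI: "K \<in> multi_indices N" "L \<in> multi_indices N"
    and conn: "\<forall>i j l. i \<le> j \<longrightarrow> j \<le> l \<longrightarrow> K i \<noteq> 0 \<or> L i \<noteq> 0 \<longrightarrow> K l \<noteq> 0 \<or> L l \<noteq> 0 \<longrightarrow> K j \<noteq> 0 \<or> L j \<noteq> 0"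
    and mono: "\<forall>i j. 1 \<le> i \<longrightarrow> i \<le> j \<longrightarrow> j < N \<longrightarrow> K j \<noteq> 0 \<longrightarrow> K i \<le> K j"
      "\<forall>i j. 1 \<le> i \<longrightarrow> i \<le> j \<longrightarrow> j < N \<longrightarrow> L j \<noteq> 0 \<longrightarrow> L i \<le> L j"
    by (simp_all add: final_exponents_def)
  have nl: "no_leading_one m K" "no_leading_one m L" if "1 \<le> m" "m < N" for m
    using x[OF that] by (simp_all add: final_exponents_def)
  have K1: "K l \<noteq> 1" and L1: "L l \<noteq> 1" if "l < N" for l
    using no_one[OF MI(1) mono(1) nl(1) that] no_one[OF MI(2) mono(2) nl(2) that] by simp_all
  have "good_pair N 1 (\<lambda>i. int (K i)) (\<lambda>i. int (L i))"
  proof (rule good_pairI)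
    show "int (K i) = 0 \<and> int (L i) = 0" if "i \<notin> {1..N}" for i
      using MI that by (auto simp: multi_indices_def)
    show "interval_like (\<lambda>i. int (K i) \<noteq> 0 \<or> int (L i) \<noteq> 0)"
      using conn by (simp add: interval_like_def)
    show "gap_pair (int (K l)) (int (L l))" if "l < N" for l
      using K1[OF that] L1[OF that] by (auto simp: gap_pair_def)
    show "3 \<le> int (K N) + int (L N)" if z: "\<forall>l<N. int (K l) = 0 \<and> int (L l) = 0"
    proof -
      have "{1..N} = insert N {1..<N}" using N by auto
      then have "pair_degree N (K, L) = K N + L N" using z by (simp add: pair_degree_def)
      moreover have "last_only N (K, L)" using z by (simp add: last_only_def)
      ultimately show ?thesis using pure by simp
    qed
  qed auto
  moreover have "beta_exp N (alpha_exponent N K) = (\<lambda>i. int (K i))" "beta_exp N (alpha_exponent N L) = (\<lambda>i. int (L i))"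
    using beta_exp_alpha_exponent[OF MI(1) N] beta_exp_alpha_exponent[OF MI(2) N] by auto
  ultimately show ?thesis
    using alpha_exponent_eq[OF MI(1) N] alpha_exponent_eq[OF MI(2) N] by (auto simp: good_exponent_def)
qed

theorem perturbation_good_exponent:
  assumes N: "N \<ge> 2"
    and partial_strengths: "\<And>k. k \<in> {1..N} \<Longrightarrow> partial_strength a k \<noteq> 0"
    and domain: "open \<Omega>" "simply_connected \<Omega>" "0 \<in> \<Omega>"
    and green: "green_regular_part \<Omega> \<gamma>"
    and critical: "((\<lambda>z. \<gamma> z z) has_derivative (\<lambda>_. 0)) (at 0)"
    and riemann_map: "biholomorphic \<Omega> (ball 0 1) \<phi>" "\<phi> 0 = 0"
    and S: "linear S" "real_linear_det S = 1"
    and \<omega>: "\<And>\<zeta>. quadratic_part (\<lambda>\<zeta>. - (partial_strength a N)\<^sup>2 / 2 * \<gamma> (inv S \<zeta>) (inv S \<zeta>)) \<zeta>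
            = - \<omega> / 2 * (cmod \<zeta>)\<^sup>2"
    and R0: "perturbation_series a N \<gamma> S \<omega> R0"
    and nz: "R0 P Q \<noteq> 0"
  shows "good_exponent N 1 P Q"
proof -
  obtain p q where surj: "surj S" and T: "\<And>z. inv S z = p * z + q * cnj z"
    using real_linear_inverse[OF S] by metis
  obtain s G where s: "0 < s" "rep 2 s harmonic_exponents (\<lambda>\<beta>. of_real (\<gamma> (\<beta> 1) (\<beta> 2))) G"
    using regular_part_rep[OF domain green riemann_map] by metis
  have bs: "beta_series N R0" and R00: "beta_coeff N R0 (\<lambda>_. 0) (\<lambda>_. 0) = 0"
    using R0 by (simp_all add: perturbation_series_def)
  obtain c \<epsilon> where \<epsilon>: "0 < \<epsilon>" and ser: "\<And>z. (\<forall>k\<in>{1..N-1}. alpha_coord a N S z k \<noteq> 0) \<and>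
      (\<forall>i\<in>{1..N}. cmod (beta_coord a N S z i) < \<epsilon>) \<Longrightarrow>
      ((\<lambda>(K, L). beta_coeff N R0 K L * (\<Prod>i=1..N. beta_coord a N S z i ^ K i)
                                   * (\<Prod>i=1..N. cnj (beta_coord a N S z i) ^ L i))
        has_sum of_real (vortex_hamiltonian a N \<gamma> z - h0_fun a N \<omega> (alpha_coord a N S z) - c))
        (multi_indices N \<times> multi_indices N)"
    using R0 unfolding perturbation_series_def by blast
  define cb where "cb = 2 + 2 * cmod p + 2 * cmod q"
  define \<kappa> where "\<kappa> = kappa_sum a N"
  have cb: "2 \<le> cb" by (simp add: cb_def)
  have \<kappa>: "0 \<le> \<kappa>" by (simp add: \<kappa>_def kappa_sum_nonneg)
  \<comment> \<open>The 5 is that of the power sum bounds; the additional 2 makes the comparison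
    with 1 strict.\<close>
  define M where "M = 10 * cb * (2 + \<kappa>)"
  have M: "0 < M" using cb \<kappa> by (simp add: M_def)
  define r where "r = min (min \<epsilon> 1) (min s 1 / M)"
  have r: "0 < r" "r \<le> 1" "r \<le> \<epsilon>" using \<epsilon> s M by (auto simp: r_def)
  have "r \<le> min s 1 / M" by (simp add: r_def)
  then have rM: "r * M \<le> min s 1" using M by (simp add: pos_le_divide_eq)
  define b where "b = cb * r"
  have "5 * (b * (2 + \<kappa>)) * 2 = r * M" by (simp add: b_def M_def)
  then have b: "5 * (b * (2 + \<kappa>)) \<le> s" "5 * (b * (2 + \<kappa>)) < 1"
    using rM s(1) by linarith+
  define C where "C = (\<Sum>n\<in>{1..<N}. a (n + 1) * partial_strength a n / (2 * pi) * ln (sqrt 2))"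
  define F where "F \<beta> = beta_perturbation a N \<gamma> (inv S) \<omega> (c + C) \<beta>" for \<beta>
  have F_rep: "\<exists>B. rep N r (final_exponents N m) (\<lambda>\<beta>. of_real (F \<beta>)) B" if "1 \<le> m" "m < N" for m
    unfolding F_def
    by (rule beta_perturbation_rep[OF N that partial_strengths _ _ T s(2) b_def[unfolded cb_def]])
      (use r b in \<open>auto simp: \<kappa>_def\<close>)
  define R where "R x = beta_coeff N R0 (fst x) (snd x)" for x
  have R_series: "((\<lambda>x. R x * monomial N \<beta> x) has_sum of_real (F \<beta>)) (multi_indices N \<times> multi_indices N)"
    if \<beta>: "\<forall>i\<in>{1..N}. \<beta> i \<noteq> 0 \<and> cmod (\<beta> i) < r" for \<beta>
  proof -
    have small: "\<forall>n\<in>{1..<N}. \<forall>l\<in>{1..n}. cmod (position a n (\<lambda>j. chain n j \<beta>) 0 l) < 1"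
    proof (intro ballI)
      fix n l assume n: "n \<in> {1..<N}" and l: "l \<in> {1..n}"
      have "cmod (position a n (\<lambda>j. chain n j \<beta>) 0 l) \<le> r * (2 + kappa_sum a n)"
      proof (rule norm_position_le[OF l])
        fix j assume j: "j < n"
        show "cmod (chain n j \<beta>) \<le> r"
        proof (cases "j = 0")
          case False
          have "rep N r {chain_pair n j} (chain n j) r"
            by (rule chain_rep) (use False j n r in auto)
          then show ?thesis by (rule rep_bound) (use \<beta> in \<open>auto simp: closed_polydisc_def less_imp_le\<close>)
        qed (use r in \<open>simp add: chain_def\<close>)
      qed (use r in simp)
      also have "\<dots> \<le> b * (2 + \<kappa>)"
      proof (rule mult_mono)
        have "1 * r \<le> cb * r" using cb r by (intro mult_right_mono) auto
        then show "r \<le> b" by (simp add: b_def)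
        then show "0 \<le> b" using r by simp
        show "2 + kappa_sum a n \<le> 2 + \<kappa>" using kappa_sum_mono[of n N a] n by (simp add: \<kappa>_def)
        show "0 \<le> 2 + kappa_sum a n" using kappa_sum_nonneg[of a n] by simp
      qed
      also have "\<dots> < 1" using b(2) \<kappa> r cb by (auto simp: b_def)
      finally show "cmod (position a n (\<lambda>j. chain n j \<beta>) 0 l) < 1" .
    qed
    define z where "z = position a N (\<lambda>j. of_real (sqrt 2) * chain N j \<beta>) (inv S (of_real (sqrt 2) * \<beta> N))"
    have \<beta>nz: "\<forall>i\<in>{1..<N}. \<beta> i \<noteq> 0" using \<beta> by auto
    have "\<forall>k\<in>{1..N}. partial_strength a k \<noteq> 0" using partial_strengths by blast
    note eq = beta_perturbation_eq[OF N this surj small \<beta>nz z_def C_def]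
    have bc: "beta_coord a N S z i = \<beta> i" if "i \<in> {1..N}" for i using eq(2) that by blast
    have "(\<forall>k\<in>{1..N-1}. alpha_coord a N S z k \<noteq> 0) \<and> (\<forall>i\<in>{1..N}. cmod (beta_coord a N S z i) < \<epsilon>)"
    proof (intro conjI ballI)
      show "alpha_coord a N S z k \<noteq> 0" if "k \<in> {1..N-1}" for k
        by (rule eq(1)) (use that N in auto)
      show "cmod (beta_coord a N S z i) < \<epsilon>" if "i \<in> {1..N}" for i
        using bc[OF that] bspec[OF \<beta> that] r(3) by simp
    qed
    note this' = ser[OF this]
    have "((\<lambda>(K, L). beta_coeff N R0 K L * (\<Prod>i=1..N. beta_coord a N S z i ^ K i)
                                   * (\<Prod>i=1..N. cnj (beta_coord a N S z i) ^ L i))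
        has_sum of_real (F \<beta>)) (multi_indices N \<times> multi_indices N)"
      using this' unfolding F_def eq(3)[where \<gamma> = \<gamma> and \<omega> = \<omega> and c = c] .
    moreover have "(\<Prod>i=1..N. beta_coord a N S z i ^ K i) = (\<Prod>i=1..N. \<beta> i ^ K i)"
      "(\<Prod>i=1..N. cnj (beta_coord a N S z i) ^ K i) = (\<Prod>i=1..N. cnj (\<beta> i) ^ K i)" for K
      by (auto intro!: prod.cong simp: bc)
    ultimately show ?thesis
      by (simp add: R_def monomial_def case_prod_unfold mult.assoc)
  qed
  have sub: "final_exponents N m \<subseteq> multi_indices N \<times> multi_indices N" for m
    by (auto simp: final_exponents_def)
  \<comment> \<open>All the representations, one for each \<open>m\<close>, have the same sum
    \<open>F\<close>, so a coefficient of the given series vanishes as soon as its exponent lies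
    outside one of the sets.\<close>
  have R_zero: "R x = 0"
    if x: "x \<in> multi_indices N \<times> multi_indices N" "x \<notin> final_exponents N m" and m: "1 \<le> m" "m < N" for x m
  proof -
    obtain B where "rep N r (final_exponents N m) (\<lambda>\<beta>. of_real (F \<beta>)) B" using F_rep[OF m] ..
    then show ?thesis by (rule rep_identify(1)[OF r(1) _ sub _ x]) (rule R_series)
  qed
  have R_all: "((\<lambda>x. R x * monomial N \<beta> x) has_sum of_real (F \<beta>)) (multi_indices N \<times> multi_indices N)"
    if "\<beta> \<in> closed_polydisc N r" for \<beta>
  proof -
    have "\<exists>B. rep N r (final_exponents N 1) (\<lambda>\<beta>. of_real (F \<beta>)) B" by (rule F_rep) (use N in auto)
    then obtain B where "rep N r (final_exponents N 1) (\<lambda>\<beta>. of_real (F \<beta>)) B" ..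
    then show ?thesis by (rule rep_identify(2)[OF r(1) _ sub _ that]) (rule R_series)
  qed
  obtain K L where KL: "K \<in> multi_indices N" "L \<in> multi_indices N" "P = alpha_exponent N K" "Q = alpha_exponent N L"
    using bs nz unfolding beta_series_def by blast
  have R_nz: "R (K, L) \<noteq> 0" using nz KL by (simp add: R_def beta_coeff_def)
  show ?thesis
    unfolding KL(3,4)
  proof (rule good_exponentI[OF N])
    show "(K, L) \<in> final_exponents N m" if "1 \<le> m" "m < N" for m
      using R_zero[of "(K, L)" m] R_nz KL that by auto
    show "3 \<le> pair_degree N (K, L)" if last: "last_only N (K, L)"
    proof (rule ccontr)
      assume "\<not> 3 \<le> pair_degree N (K, L)"
      then consider "pair_degree N (K, L) = 0" | "pair_degree N (K, L) = 1 \<or> pair_degree N (K, L) = 2" by linarith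
      then show False
      proof cases
        case 1
        then have "K i = 0 \<and> L i = 0" for i
          using KL(1,2) by (cases "i \<in> {1..N}") (auto simp: pair_degree_def multi_indices_def)
        then have "K = (\<lambda>_. 0)" "L = (\<lambda>_. 0)" by auto
        then show False using R_nz R00 by (simp add: R_def)
      next
        case 2
        have "R (K, L) = 0"
          by (rule pure_coefficients_vanish[OF N r(1) T critical \<omega> R_all[unfolded F_def] _ last refl 2]) (use KL in auto)
        then show False using R_nz by simp
      qed
    qed
  qed
qed

section \<open>The normal form\<close>

theorem lemma3p1:
  fixes N :: nat and a :: "nat \<Rightarrow> real"
    and \<Omega> :: "complex set" and \<gamma> :: "complex \<Rightarrow> complex \<Rightarrow> real"
    and \<phi> :: "complex \<Rightarrow> complex" and S :: "complex \<Rightarrow> complex" and \<omega> :: real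
    and R0 :: laurent
  assumes N: "N \<ge> 2"
    and strengths: "\<And>k. k \<in> {1..N} \<Longrightarrow> a k \<noteq> 0"
    and partial_strengths: "\<And>k. k \<in> {1..N} \<Longrightarrow> partial_strength a k \<noteq> 0"
    and domain: "open \<Omega>" "simply_connected \<Omega>" "0 \<in> \<Omega>"
    and green: "green_regular_part \<Omega> \<gamma>"
    and critical: "((\<lambda>z. \<gamma> z z) has_derivative (\<lambda>_. 0)) (at 0)"
    and riemann_map: "biholomorphic \<Omega> (ball 0 1) \<phi>" "\<phi> 0 = 0"
    and stability: "2 * cmod (deriv \<phi> 0) ^ 3 > cmod ((deriv ^^ 3) \<phi> 0)"
    and S: "linear S" "real_linear_det S = 1"
    and \<omega>: "\<omega> > 0"
      "\<And>\<zeta>. quadratic_part (\<lambda>\<zeta>. - (partial_strength a N)\<^sup>2 / 2 * \<gamma> (inv S \<zeta>) (inv S \<zeta>)) \<zeta>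
            = - \<omega> / 2 * (cmod \<zeta>)\<^sup>2"
    and R0: "perturbation_series a N \<gamma> S \<omega> R0"
  shows "\<forall>n\<ge>1. \<exists>gs Z R.
    canonical_transform a N gs
      (add_laurent (h0_series a N \<omega>) R0)
      (add_laurent (add_laurent (h0_series a N \<omega>) Z) R) \<and>
    beta_series N Z \<and> beta_series N R \<and>
    poisson_bracket a N (of_laurent Z) (h0_series a N \<omega>) = (\<lambda>P Q. 0) \<and>
    series_ord N R \<ge> enat (n + 1) \<and>
    exponents N Z \<subseteq> connected_exponents N \<and>
    exponents N R \<subseteq> connected_exponents N"
proof (intro allI impI)
  fix n :: nat
  have "good_exponent N 1 P Q" if "R0 P Q \<noteq> 0" for P Q
    by (rule perturbation_good_exponent) (fact assms that)+
  then show "\<exists>gs Z R.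
    canonical_transform a N gs
      (add_laurent (h0_series a N \<omega>) R0)
      (add_laurent (add_laurent (h0_series a N \<omega>) Z) R) \<and>
    beta_series N Z \<and> beta_series N R \<and>
    poisson_bracket a N (of_laurent Z) (h0_series a N \<omega>) = (\<lambda>P Q. 0) \<and>
    series_ord N R \<ge> enat (n + 1) \<and>
    exponents N Z \<subseteq> connected_exponents N \<and>
    exponents N R \<subseteq> connected_exponents N"
    by (intro normal_form N strengths partial_strengths \<omega>(1))
qed

end
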